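(* Let $E$ be a Hermite-Biehler function without real zeros, let $H(E)$ be its de Branges space and let $\phi$ be its phase function. For any choice of orthonormal basis of reproducing kernels $\{k_{\omega_n}\}$ of $H(E)$, the first intensity function $\rho_1$ of the corresponding de Branges GAF $F(x)=\sum_n a_n k_{\omega_n}(x)$ satisfies $$\rho_1(x)=\frac{1}{\pi}\sqrt{\frac{\phi'(x)^2}{3}+\frac{S\phi(x)}{6}},\qquad x\in\mathbb{R},$$ where $S\phi=\left(\frac{\phi''}{\phi'}\right)'-\frac12\left(\frac{\phi''}{\phi'}\right)^2$ is the Schwarzian derivative of $\phi$.
   Context: Hermite-Biehler function: an entire function $E$ with $|E(z)|>|E^*(z)|$ for $\operatorname{Im} z>0$, where $f^*(z)=\overline{f(\bar z)}$. All Hermite-Biehler functions considered have no real zeros. De Branges space: $H(E)=\{f\text{ entire}: f/E,\ f^*/E\in H^2(\mathbb{C}_+)\}$, where $H^2(\mathbb{C}_+)$ is the Hardy space of the upper half-plane, with norm $\|f\|_{H(E)}^2=\int_{-\infty}^{\infty}|f(x)/E(x)|^2\,dx$. It is a Hilbert space with reproducing kernel $$K(z,w)=\frac{i}{2\pi}\,\frac{E(z)\overline{E(w)}-E^*(z)\overline{E^*(w)}}{z-\overline{w}}.$$ Phase function: a smooth increasing function $\phi:\mathbb{R}\to\mathbb{R}$ with $E(x)=|E(x)|e^{-i\phi(x)}$ for $x\in\mathbb{R}$; it satisfies $\phi'>0$ and $K(x,x)=\frac1\pi\phi'(x)|E(x)|^2$. Normalized reproducing kernels: for $x,y\in\mathbb{R}$,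 $k_y(x)=\frac{K(x,y)}{K(y,y)^{1/2}}=\frac{|E(x)|}{\sqrt{\pi\phi'(y)}}\frac{\sin(\phi(x)-\phi(y))}{x-y}$. Orthonormal basis of reproducing kernels: a family $\{k_{\omega_n}\}$ which is an orthonormal basis of $H(E)$, where, for some $\alpha\in[0,\pi)$, $\{\omega_n\}$ consists of all real points with $\phi(\omega_n)=\alpha+\pi n$, $n\in\mathbb{Z}$ (only those $n$ for which such a point exists). By a theorem of de Branges, for all $\alpha\in[0,\pi)$ except at most one this family is an orthonormal basis. De Branges GAF: $F(x)=\sum_n a_n k_{\omega_n}(x)$, where the $a_n$ are i.i.d. real standard normal random variables and $\{k_{\omega_n}\}$ is such an orthonormal basis. The series converges almost surely uniformly on compact subsets of $\mathbb{C}$, and $\mathbb{E}[F(x)F(y)]=K(x,y)$ for real $x,y$. First intensity function (with respect to Lebesgue measure): the function $\rho_1\ge 0$ on $\mathbb{R}$ with $\mathbb{E}[\#(Z_{\mathbb{R}}(F)\cap D)]=\int_D\rho_1(x)\,dx$ for all Borel sets $D\subset\mathbb{R}$, where $Z_{\mathbb{R}}(F)$ is the set of real zeros of $F$ (pointwise statements refer to the continuous version of this density). *)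

theory Defs
  imports "HOL-Probability.Probability" "HOL-Complex_Analysis.Complex_Analysis"
begin

definition conj_star :: "(complex \<Rightarrow> complex) \<Rightarrow> complex \<Rightarrow> complex" where
  "conj_star f z = cnj (f (cnj z))"

definition hermite_biehler :: "(complex \<Rightarrow> complex) \<Rightarrow> bool" where
  "hermite_biehler E \<longleftrightarrow>
     E holomorphic_on UNIV \<and> (\<forall>z. Im z > 0 \<longrightarrow> cmod (E z) > cmod (conj_star E z))"

definition hardy_H2 :: "(complex \<Rightarrow> complex) set" where
  "hardy_H2 = {f. f holomorphic_on {z. Im z > 0} \<and>
     (SUP y\<in>{0<..}. \<integral>\<^sup>+x. ennreal ((cmod (f (Complex x y)))\<^sup>2) \<partial>lborel) < \<infinity>}"

definition de_branges_space :: "(complex \<Rightarrow> complex) \<Rightarrow> (complex \<Rightarrow> complex) set" where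
  "de_branges_space E = {f. f holomorphic_on UNIV \<and>
     (\<lambda>z. f z / E z) \<in> hardy_H2 \<and> (\<lambda>z. conj_star f z / E z) \<in> hardy_H2}"

definition db_inner ::
  "(complex \<Rightarrow> complex) \<Rightarrow> (complex \<Rightarrow> complex) \<Rightarrow> (complex \<Rightarrow> complex) \<Rightarrow> complex" where
  "db_inner E f g =
     (LINT x|lborel. f (of_real x) * cnj (g (of_real x)) / of_real ((cmod (E (of_real x)))\<^sup>2))"

definition db_norm :: "(complex \<Rightarrow> complex) \<Rightarrow> (complex \<Rightarrow> complex) \<Rightarrow> real" where
  "db_norm E f = sqrt (LINT x|lborel. (cmod (f (of_real x) / E (of_real x)))\<^sup>2)"

text \<open>The quotient defining the kernel has a removable singularity at \<open>z = cnj w\<close>,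
  where its value is the derivative of the numerator.\<close>

definition db_kernel :: "(complex \<Rightarrow> complex) \<Rightarrow> complex \<Rightarrow> complex \<Rightarrow> complex" where
  "db_kernel E z w =
     (let N = (\<lambda>u. E u * cnj (E w) - conj_star E u * cnj (conj_star E w))
      in \<i> / (2 * of_real pi) * (if z = cnj w then deriv N z else N z / (z - cnj w)))"

definition normalized_kernel :: "(complex \<Rightarrow> complex) \<Rightarrow> real \<Rightarrow> complex \<Rightarrow> complex" where
  "normalized_kernel E y z =
     db_kernel E z (of_real y) / csqrt (db_kernel E (of_real y) (of_real y))"

definition phase_function :: "(complex \<Rightarrow> complex) \<Rightarrow> (real \<Rightarrow> real) \<Rightarrow> bool" where
  "phase_function E \<phi> \<longleftrightarrow>
     (\<forall>n. (deriv ^^ n) \<phi> differentiable_on UNIV) \<and> strict_mono \<phi> \<and>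
     (\<forall>x. E (of_real x) = of_real (cmod (E (of_real x))) * exp (- \<i> * of_real (\<phi> x)))"

definition db_orthonormal_basis ::
  "(complex \<Rightarrow> complex) \<Rightarrow> 'i set \<Rightarrow> ('i \<Rightarrow> complex \<Rightarrow> complex) \<Rightarrow> bool" where
  "db_orthonormal_basis E I e \<longleftrightarrow>
     (\<forall>n\<in>I. e n \<in> de_branges_space E) \<and>
     (\<forall>m\<in>I. \<forall>n\<in>I. db_inner E (e m) (e n) = (if m = n then 1 else 0)) \<and>
     (\<forall>f\<in>de_branges_space E. \<forall>\<epsilon>>0. \<exists>J c. finite J \<and> J \<subseteq> I \<and>
        db_norm E (\<lambda>z. f z - (\<Sum>n\<in>J. c n * e n z)) < \<epsilon>)"

text \<open>\<open>I\<close> is the set of those integers \<open>n\<close> for which the level \<open>\<alpha> + n\<pi>\<close> is attained by the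
  phase; the values of \<open>\<omega>\<close> off \<open>I\<close> are irrelevant.\<close>

definition kernel_orthonormal_basis ::
  "(complex \<Rightarrow> complex) \<Rightarrow> (real \<Rightarrow> real) \<Rightarrow> int set \<Rightarrow> (int \<Rightarrow> real) \<Rightarrow> bool" where
  "kernel_orthonormal_basis E \<phi> I \<omega> \<longleftrightarrow>
     (\<exists>\<alpha>. 0 \<le> \<alpha> \<and> \<alpha> < pi \<and>
        I = {n. \<exists>x. \<phi> x = \<alpha> + pi * of_int n} \<and>
        (\<forall>n\<in>I. \<phi> (\<omega> n) = \<alpha> + pi * of_int n)) \<and>
     db_orthonormal_basis E I (\<lambda>n. normalized_kernel E (\<omega> n))"

definition iid_std_normal :: "'s measure \<Rightarrow> 'i set \<Rightarrow> ('i \<Rightarrow> 's \<Rightarrow> real) \<Rightarrow> bool" where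
  "iid_std_normal M I a \<longleftrightarrow>
     prob_space.indep_vars M (\<lambda>_. borel) a I \<and>
     (\<forall>n\<in>I. distributed M lborel (a n) (\<lambda>x. ennreal (std_normal_density x)))"

text \<open>The series over \<open>I\<close> is in general only conditionally convergent (almost surely), so it
  cannot be an \<open>infsum\<close>; it is summed as the limit of the symmetric partial sums.\<close>

definition de_branges_GAF ::
  "(complex \<Rightarrow> complex) \<Rightarrow> int set \<Rightarrow> (int \<Rightarrow> real) \<Rightarrow> (int \<Rightarrow> 's \<Rightarrow> real) \<Rightarrow> 's \<Rightarrow> complex \<Rightarrow> complex" where
  "de_branges_GAF E I \<omega> a s z =
     lim (\<lambda>N. \<Sum>n \<in> I \<inter> {- int N..int N}. of_real (a n s) * normalized_kernel E (\<omega> n) z)"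

definition real_zeros :: "(complex \<Rightarrow> complex) \<Rightarrow> real set" where
  "real_zeros f = {x. f (of_real x) = 0}"

text \<open>The density is only determined almost everywhere by the integral identity; continuity
  selects the version for which pointwise statements are made.\<close>

definition first_intensity ::
  "'s measure \<Rightarrow> ('s \<Rightarrow> complex \<Rightarrow> complex) \<Rightarrow> (real \<Rightarrow> real) \<Rightarrow> bool" where
  "first_intensity M F \<rho> \<longleftrightarrow>
     continuous_on UNIV \<rho> \<and> (\<forall>x. 0 \<le> \<rho> x) \<and>
     (\<forall>D\<in>sets borel.
        (\<integral>\<^sup>+s. emeasure (count_space UNIV) (real_zeros (F s) \<inter> D) \<partial>M)
          = (\<integral>\<^sup>+x\<in>D. ennreal (\<rho> x) \<partial>lborel))"

definition schwarzian :: "(real \<Rightarrow> real) \<Rightarrow> real \<Rightarrow> real" where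
  "schwarzian \<phi> x =
     deriv (\<lambda>t. deriv (deriv \<phi>) t / deriv \<phi> t) x - 1 / 2 * (deriv (deriv \<phi>) x / deriv \<phi> x)\<^sup>2"

end

theory Submission
  imports Defs
begin

text \<open>
  On the real line \<open>k\<^sub>\<omega>(x) = |E(x)| g(x)\<close> with a real function \<open>g\<close>, and \<open>|E(x)| > 0\<close>. The real zeros of the
  GAF are therefore those of the real Gaussian series \<open>G = \<Sum>\<^sub>n a\<^sub>n g\<^sub>n\<close>, whose covariance is
  \<open>\<Sum>\<^sub>n g\<^sub>n(x) g\<^sub>n(y) = sin (\<phi>(x) - \<phi>(y)) / (\<pi> (x - y))\<close>. The theorem is Crofton's formula for the curve
  \<open>\<gamma>(x) = (g\<^sub>n(x))\<^sub>n\<close>, normalized to the unit sphere: a zero of \<open>G\<close> is a crossing of \<open>\<gamma>\<close> with the random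
  hyperplane orthogonal to \<open>(a\<^sub>n)\<^sub>n\<close>, so the expected number of zeros is the length of the curve divided by
  \<open>\<pi>\<close>, and \<open>\<rho>\<^sub>1\<close> is its speed divided by \<open>\<pi>\<close>.

  \<^bold>\<open>Signs.\<close> For two points with correlation \<open>c\<close>, Sheppard's formula (\<open>gauss_opposite_signs\<close>) says that the values
  have opposite signs with probability \<open>arccos c / \<pi>\<close>, the angle between two points of the curve over \<open>\<pi>\<close>.
  Summing over a mesh and refining it gives the length, once the angle of neighbouring points is known to
  first order. A Taylor expansion of order four yields
  \<open>1 - c(x, x + h)\<^sup>2 = h\<^sup>2 (\<phi>'(x)\<^sup>2 / 3 + S\<phi>(x) / 6) + o(h\<^sup>2)\<close>, locally uniformly in \<open>x\<close>
  (\<open>defect_taylor\<close>, \<open>arccos_phase_corr_uniform\<close>).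

  \<^bold>\<open>From sign changes to zeros.\<close> The number of sign changes on a mesh never exceeds the number of zeros, and
  its lower limit is the number of zeros if every zero is a crossing. Zeros without crossing have probability
  zero (\<open>AE_no_touching\<close>): where \<open>g\<^sub>n \<noteq> 0\<close>, such a zero makes \<open>-a\<^sub>n\<close> the maximum or minimum over an interval with
  rational end points of a function that is independent of \<open>a\<^sub>n\<close>. Fatou's lemma in one direction and the
  trivial bound in the other then give the exact expectation on intervals (\<open>expected_zeros_interval\<close>);
  Dynkin's lemma extends it to Borel sets (\<open>expected_count_eq_density\<close>).

  \<^bold>\<open>Covariance.\<close> The norm of \<open>H(E)\<close> controls point values of real combinations of kernels: Cauchy's formula
  bounds them off the real line, with a factor that blows up like \<open>1 / |Im z|\<close>, and the maximum principle
  carries the bound to the line (\<open>evaluation_bound\<close>). Hence the expansion of \<open>K(\<cdot>, y)\<close> in the basis converges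
  pointwise. Its coefficients can be read off at the points \<open>\<omega>\<^sub>m\<close>, where all other basis functions vanish,
  so that no inner product has to be computed (\<open>phase_sinc_expansion\<close>).

  \<^bold>\<open>Convergence.\<close> Kolmogorov's inequality gives almost sure convergence at one point \<open>x\<^sub>0\<close>. Up to a factor that
  does not depend on \<open>n\<close>, the quotient \<open>g\<^sub>n(x) / g\<^sub>n(x\<^sub>0)\<close> is \<open>1 + (x - x\<^sub>0) / (\<omega>\<^sub>n - x)\<close>, which is eventually monotone
  in \<open>n\<close> on each half of the index set. Abel summation thus yields convergence at all \<open>x\<close> at once, to a
  continuous function (\<open>half_series_continuous\<close>).
\<close>

section \<open>Planar Gaussian vectors\<close>

abbreviation std_gauss :: "real measure" where
  "std_gauss \<equiv> density lborel (\<lambda>x. ennreal (std_normal_density x))"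

lemma prob_space_std_gauss: "prob_space std_gauss"
  by (rule prob_space_normal_density) simp

lemma emeasure_std_gauss_UNIV: "emeasure std_gauss UNIV = 1"
  using prob_space.emeasure_space_1[OF prob_space_std_gauss] by simp

lemma std_normal_density_mult:
  "std_normal_density x * std_normal_density y = exp (- (x\<^sup>2 + y\<^sup>2) / 2) / (2 * pi)"
  unfolding std_normal_density_def
  by (simp add: mult_exp_exp add_divide_distrib diff_divide_distrib)

text \<open>
  The rotation is carried out by two affine substitutions in one variable each, separated by an exchange
  of the integrals, so that it reduces to Fubini's theorem and the scaling of Lebesgue measure on the line.
  The first substitution divides by \<open>c\<close>.
\<close>

lemma std_gauss_rotation_nonvertical:
  fixes c s :: real and h :: "real \<times> real \<Rightarrow> ennreal"
  assumes cs: "c\<^sup>2 + s\<^sup>2 = 1" and c: "c \<noteq> 0"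
    and [measurable]: "h \<in> borel_measurable borel"
  shows "(\<integral>\<^sup>+x. \<integral>\<^sup>+y. h (c * x - s * y, s * x + c * y) \<partial>std_gauss \<partial>std_gauss)
       = (\<integral>\<^sup>+x. \<integral>\<^sup>+y. h (x, y) \<partial>std_gauss \<partial>std_gauss)"
proof -
  have [measurable]: "h \<in> borel_measurable (borel \<Otimes>\<^sub>M borel)"
    by (simp add: borel_prod)
  define w :: "real \<Rightarrow> real \<Rightarrow> ennreal" where "w x y = ennreal (std_normal_density x) * ennreal (std_normal_density y)" for x y
  have [measurable]: "case_prod w \<in> borel_measurable (borel \<Otimes>\<^sub>M borel)"
    unfolding w_def by measurable
  have wE: "w x y = ennreal (exp (-(x\<^sup>2 + y\<^sup>2)/2) / (2*pi))" for x y
    unfolding w_def by (simp add: ennreal_mult'[symmetric] std_normal_density_mult)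
  have dens: "(\<integral>\<^sup>+x. \<integral>\<^sup>+y. k (x, y) \<partial>std_gauss \<partial>std_gauss) = (\<integral>\<^sup>+x. \<integral>\<^sup>+y. w x y * k (x, y) \<partial>lborel \<partial>lborel)"
    if [measurable]: "k \<in> borel_measurable (borel \<Otimes>\<^sub>M borel)" for k :: "real \<times> real \<Rightarrow> ennreal"
    by (simp add: nn_integral_density nn_integral_cmult[symmetric] w_def mult.assoc)
  have "(\<integral>\<^sup>+x. \<integral>\<^sup>+y. h (c * x - s * y, s * x + c * y) \<partial>std_gauss \<partial>std_gauss)
     = (\<integral>\<^sup>+x. \<integral>\<^sup>+y. w x y * h (c * x - s * y, s * x + c * y) \<partial>lborel \<partial>lborel)"
    using dens[of "\<lambda>p. h (c * fst p - s * snd p, s * fst p + c * snd p)"] by simp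
  also have "\<dots> = (\<integral>\<^sup>+y. \<integral>\<^sup>+x. w x y * h (c * x - s * y, s * x + c * y) \<partial>lborel \<partial>lborel)"
    by (rule lborel_pair.Fubini') measurable
  also have "\<dots> = (\<integral>\<^sup>+y. ennreal \<bar>1/c\<bar> * (\<integral>\<^sup>+x. w (s/c*y + (1/c)*x) y * h (x, (s * x + y)/c) \<partial>lborel) \<partial>lborel)"
  proof (rule nn_integral_cong)
    fix y
    have e0: "c * (s/c*y + (1/c)*x) - s * y = x" for x
      using c by (simp add: field_simps)
    have e: "s * (s/c*y + (1/c)*x) + c * y = (s * x + y)/c" for x
    proof -
      have "s * (s/c*y + (1/c)*x) + c * y = (s * x + (s\<^sup>2 + c\<^sup>2) * y)/c"
        using c by (simp add: field_simps power2_eq_square)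
      then show ?thesis using cs by (simp add: add.commute)
    qed
    show "(\<integral>\<^sup>+x. w x y * h (c * x - s * y, s * x + c * y) \<partial>lborel)
      = ennreal \<bar>1/c\<bar> * (\<integral>\<^sup>+x. w (s/c*y + (1/c)*x) y * h (x, (s * x + y)/c) \<partial>lborel)"
      apply (subst nn_integral_real_affine[where c="1/c" and t="s/c*y"])
      using c apply (simp_all only: e e0)
      subgoal by measurable
      by simp
  qed
  also have "\<dots> = ennreal \<bar>1/c\<bar> * (\<integral>\<^sup>+y. \<integral>\<^sup>+x. w (s/c*y + (1/c)*x) y * h (x, (s * x + y)/c) \<partial>lborel \<partial>lborel)"
    by (rule nn_integral_cmult) measurable
  also have "(\<integral>\<^sup>+y. \<integral>\<^sup>+x. w (s/c*y + (1/c)*x) y * h (x, (s * x + y)/c) \<partial>lborel \<partial>lborel)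
     = (\<integral>\<^sup>+x. \<integral>\<^sup>+y. w (s/c*y + (1/c)*x) y * h (x, (s * x + y)/c) \<partial>lborel \<partial>lborel)"
    by (rule lborel_pair.Fubini') measurable
  also have "\<dots> = (\<integral>\<^sup>+x. ennreal \<bar>c\<bar> * (\<integral>\<^sup>+y. w x y * h (x, y) \<partial>lborel) \<partial>lborel)"
  proof (rule nn_integral_cong)
    fix x
    have e: "w (s/c*(- s*x + c*y) + (1/c)*x) (- s*x + c*y) = w x y" for y
    proof -
      have "s/c*(- s*x + c*y) + (1/c)*x = ((1 - s\<^sup>2)*x + c * s * y)/c"
        using c by (simp add: field_simps power2_eq_square)
      also have "(1 - s\<^sup>2) = c * c" using cs by (simp add: power2_eq_square)
      also have "(c * c * x + c * s * y)/c = c * x + s * y"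
        using c by (simp add: field_simps)
      finally have 1: "s/c*(- s*x + c*y) + (1/c)*x = c * x + s * y" .
      have "(c * x + s * y)\<^sup>2 + (- s*x + c*y)\<^sup>2 = (c\<^sup>2 + s\<^sup>2) * (x\<^sup>2 + y\<^sup>2)"
        by (simp add: power2_eq_square algebra_simps)
      then show ?thesis unfolding 1 wE using cs by simp
    qed
    have e': "(s * x + (- s*x + c*y))/c = y" for y using c by simp
    show "(\<integral>\<^sup>+y. w (s/c*y + (1/c)*x) y * h (x, (s * x + y)/c) \<partial>lborel)
      = ennreal \<bar>c\<bar> * (\<integral>\<^sup>+y. w x y * h (x, y) \<partial>lborel)"
      apply (subst nn_integral_real_affine[where c="c" and t="- s*x"])
      using c apply (simp_all only: e e')
      subgoal by measurable
      by simp
  qed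
  also have "\<dots> = ennreal \<bar>c\<bar> * (\<integral>\<^sup>+x. \<integral>\<^sup>+y. w x y * h (x, y) \<partial>lborel \<partial>lborel)"
    by (rule nn_integral_cmult) measurable
  also have "ennreal \<bar>1/c\<bar> * (ennreal \<bar>c\<bar> * (\<integral>\<^sup>+x. \<integral>\<^sup>+y. w x y * h (x, y) \<partial>lborel \<partial>lborel))
     = (\<integral>\<^sup>+x. \<integral>\<^sup>+y. w x y * h (x, y) \<partial>lborel \<partial>lborel)"
    using c by (simp add: mult.assoc[symmetric] ennreal_mult'[symmetric])
  finally show ?thesis using dens[of h] by simp
qed

lemma std_gauss_rotation:
  fixes c s :: real and h :: "real \<times> real \<Rightarrow> ennreal"
  assumes cs: "c\<^sup>2 + s\<^sup>2 = 1"
    and [measurable]: "h \<in> borel_measurable borel"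
  shows "(\<integral>\<^sup>+x. \<integral>\<^sup>+y. h (c * x - s * y, s * x + c * y) \<partial>std_gauss \<partial>std_gauss)
       = (\<integral>\<^sup>+x. \<integral>\<^sup>+y. h (x, y) \<partial>std_gauss \<partial>std_gauss)"
proof (cases "c = 0")
  case False then show ?thesis using std_gauss_rotation_nonvertical assms by blast
next
  case True
  have [measurable]: "h \<in> borel_measurable (borel \<Otimes>\<^sub>M borel)"
    by (simp add: borel_prod)
  define r :: real where "r = sqrt (1/2)"
  have r: "r\<^sup>2 = 1/2" "r * r = 1/2" "r \<noteq> 0" by (auto simp: r_def)
  \<comment> \<open>A quarter turn is a composition of two eighth turns.\<close>
  have "s\<^sup>2 = 1" using True cs by simp
  have rs: "r\<^sup>2 + (s * r)\<^sup>2 = 1" using r \<open>s\<^sup>2 = 1\<close> by (simp add: power_mult_distrib)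
  have ss: "s * s = 1" using \<open>s\<^sup>2 = 1\<close> by (simp add: power2_eq_square)
  define h2 where "h2 p = h (r * fst p - (s*r) * snd p, (s*r) * fst p + r * snd p)" for p
  have [measurable]: "h2 \<in> borel_measurable (borel \<Otimes>\<^sub>M borel)" unfolding h2_def by measurable
  then have h2b: "h2 \<in> borel_measurable borel" by (simp add: borel_prod)
  have e: "h2 (r * x - (s*r) * y, (s*r) * x + r * y) = h (c * x - s * y, s * x + c * y)" for x y
  proof -
    have 1: "r * (r * x - (s*r) * y) - (s*r) * ((s*r) * x + r * y) = (r * r) * (1 - s * s) * x - 2 * (r * r) * s * y"
      by (simp add: algebra_simps)
    have 2: "(s*r) * (r * x - (s*r) * y) + r * ((s*r) * x + r * y) = 2 * (r * r) * s * x + (r * r) * (1 - s * s) * y"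
      by (simp add: algebra_simps)
    show ?thesis unfolding h2_def fst_conv snd_conv 1 2 r(2) ss True by simp
  qed
  show ?thesis
    using std_gauss_rotation_nonvertical[OF rs \<open>r \<noteq> 0\<close> h2b] std_gauss_rotation_nonvertical[OF rs \<open>r \<noteq> 0\<close> assms(2)]
    unfolding e by (simp add: h2_def)
qed

text \<open>
  Independence in the form in which it is used: the second variable may be replaced by an independent copy.
\<close>

lemma indep_var_nn_integral:
  assumes "prob_space M" and ind: "prob_space.indep_var M S X T Y"
    and [measurable]: "f \<in> borel_measurable (S \<Otimes>\<^sub>M T)"
  shows "(\<integral>\<^sup>+s. f (X s, Y s) \<partial>M) = (\<integral>\<^sup>+t. (\<integral>\<^sup>+s. f (X s, Y t) \<partial>M) \<partial>M)"
proof -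
  interpret prob_space M by fact
  have X[measurable]: "X \<in> measurable M S" and Y[measurable]: "Y \<in> measurable M T"
    and eq: "distr M S X \<Otimes>\<^sub>M distr M T Y = distr M (S \<Otimes>\<^sub>M T) (\<lambda>s. (X s, Y s))"
    using ind unfolding indep_var_distribution_eq by auto
  interpret pair_prob_space "distr M S X" "distr M T Y"
    unfolding pair_prob_space_def pair_sigma_finite_def
    using prob_space_distr[OF X] prob_space_distr[OF Y] by (simp add: prob_space_imp_sigma_finite)
  have "(\<integral>\<^sup>+s. f (X s, Y s) \<partial>M) = (\<integral>\<^sup>+z. f z \<partial>distr M (S \<Otimes>\<^sub>M T) (\<lambda>s. (X s, Y s)))"
    by (subst nn_integral_distr) auto
  also have "\<dots> = (\<integral>\<^sup>+z. f z \<partial>(distr M S X \<Otimes>\<^sub>M distr M T Y))" unfolding eq ..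
  also have "\<dots> = (\<integral>\<^sup>+y. (\<integral>\<^sup>+x. f (x, y) \<partial>distr M S X) \<partial>distr M T Y)"
    by (subst nn_integral_snd[symmetric]) (auto cong: measurable_cong_sets)
  also have "\<dots> = (\<integral>\<^sup>+y. (\<integral>\<^sup>+s. f (X s, y) \<partial>M) \<partial>distr M T Y)"
    by (intro nn_integral_cong) (subst nn_integral_distr, auto)
  also have "\<dots> = (\<integral>\<^sup>+t. (\<integral>\<^sup>+s. f (X s, Y t) \<partial>M) \<partial>M)"
    by (subst nn_integral_distr) auto
  finally show ?thesis .
qed

lemma indep_vars_nn_integral_split:
  fixes a :: "'i \<Rightarrow> 's \<Rightarrow> real"
  assumes "prob_space M" and ind: "prob_space.indep_vars M (\<lambda>_. borel) a I"
    and n: "J \<subseteq> I" "n \<in> I" "n \<notin> J"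
    and [measurable]: "f \<in> borel_measurable (Pi\<^sub>M J (\<lambda>_. borel) \<Otimes>\<^sub>M borel)"
  shows "(\<integral>\<^sup>+s. f (restrict (\<lambda>i. a i s) J, a n s) \<partial>M)
    = (\<integral>\<^sup>+z. (\<integral>\<^sup>+s. f (restrict (\<lambda>i. a i s) J, z) \<partial>M) \<partial>distr M borel (a n))"
proof -
  interpret prob_space M by fact
  have [measurable]: "random_variable borel (a i)" if "i \<in> I" for i
    using ind that unfolding indep_vars_def by auto
  have [measurable]: "(\<lambda>s. restrict (\<lambda>i. a i s) J) \<in> M \<rightarrow>\<^sub>M Pi\<^sub>M J (\<lambda>_. borel)"
    using n by (intro measurable_restrict) auto
  have i2: "indep_var (Pi\<^sub>M J (\<lambda>_. borel)) (\<lambda>s. restrict (\<lambda>i. a i s) J) (Pi\<^sub>M {n} (\<lambda>_. borel)) (\<lambda>s. restrict (\<lambda>i. a i s) {n})"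
    by (rule indep_var_restrict[OF ind]) (use n in auto)
  show ?thesis
    using indep_var_nn_integral[OF \<open>prob_space M\<close> i2, of "\<lambda>p. f (fst p, snd p n)"] n
    by (simp add: nn_integral_distr)
qed

lemma unit_vector_factor:
  fixes p u :: real
  obtains c s p' where "c\<^sup>2 + s\<^sup>2 = 1" "p = p' * c" "u = p' * s" "0 \<le> p'"
proof (cases "p = 0 \<and> u = 0")
  case True then show ?thesis using that[of 1 0 0] by auto
next
  case False
  then have P: "p\<^sup>2 + u\<^sup>2 > 0" by (simp add: sum_power2_gt_zero_iff)
  define p' where "p' = sqrt (p\<^sup>2 + u\<^sup>2)"
  have "p' > 0" "p'\<^sup>2 = p\<^sup>2 + u\<^sup>2" using P by (auto simp: p'_def)
  moreover have "(p/p')\<^sup>2 + (u/p')\<^sup>2 = 1"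
    unfolding power_divide add_divide_distrib[symmetric] \<open>p'\<^sup>2 = p\<^sup>2 + u\<^sup>2\<close> using P by (metis divide_self less_irrefl)
  ultimately show ?thesis
    using that[of "p/p'" "u/p'" p'] by auto
qed

text \<open>
  The vector \<open>(w, r)\<close> is rotated onto a coordinate axis, and the variable that drops out is integrated away.
\<close>

lemma gauss_combination:
  fixes w r :: real
  obtains r' where "0 \<le> r'" "r'\<^sup>2 = w\<^sup>2 + r\<^sup>2"
    "\<And>k :: real \<Rightarrow> ennreal. k \<in> borel_measurable borel \<Longrightarrow> (\<integral>\<^sup>+z. \<integral>\<^sup>+y. k (w * z + r * y) \<partial>std_gauss \<partial>std_gauss) = (\<integral>\<^sup>+y. k (r' * y) \<partial>std_gauss)"
proof -
  obtain c s r' where cs: "c\<^sup>2 + s\<^sup>2 = 1" "r = r' * c" "w = r' * s" "0 \<le> r'"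
    by (rule unit_vector_factor)
  have "r'\<^sup>2 = w\<^sup>2 + r\<^sup>2"
    using cs(1) unfolding cs(2,3) by (metis add.commute distrib_left mult.right_neutral power_mult_distrib)
  moreover have "(\<integral>\<^sup>+z. \<integral>\<^sup>+y. k (w * z + r * y) \<partial>std_gauss \<partial>std_gauss) = (\<integral>\<^sup>+y. k (r' * y) \<partial>std_gauss)"
    if [measurable]: "k \<in> borel_measurable borel" for k :: "real \<Rightarrow> ennreal"
  proof -
    have m: "(\<lambda>p :: real \<times> real. k (r' * snd p)) \<in> borel_measurable borel"
      unfolding borel_prod[symmetric] by measurable
    show ?thesis
      using std_gauss_rotation[OF cs(1) m] by (simp add: cs(2,3) algebra_simps emeasure_std_gauss_UNIV)
  qed
  ultimately show ?thesis using cs(4) that by blast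
qed

text \<open>
  Cholesky factorization of the Gram matrix of \<open>u\<close> and \<open>v\<close>. The induction keeps the pair in the form
  \<open>(p \<xi>, q \<xi> + r \<eta>)\<close> with independent standard normal \<open>\<xi>\<close> and \<open>\<eta>\<close>. A new summand brings in a third variable \<open>\<zeta>\<close>:
  a rotation of \<open>(\<xi>, \<zeta>)\<close> removes it from the first component, and a second rotation merges it with \<open>\<eta>\<close>
  in the second component.
\<close>

lemma gauss_pair_law:
  fixes u v :: "'i \<Rightarrow> real"
  assumes "prob_space M" and ind: "prob_space.indep_vars M (\<lambda>_. borel) a I"
    and dist: "\<And>n. n \<in> I \<Longrightarrow> distr M borel (a n) = std_gauss"
    and "finite J" "J \<subseteq> I"
  shows "\<exists>p q r. 0 \<le> p \<and> 0 \<le> r \<and> p\<^sup>2 = (\<Sum>n\<in>J. (u n)\<^sup>2) \<and> p * q = (\<Sum>n\<in>J. u n * v n) \<and> q\<^sup>2 + r\<^sup>2 = (\<Sum>n\<in>J. (v n)\<^sup>2) \<and>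
    (\<forall>h\<in>borel_measurable borel. (\<integral>\<^sup>+s. h (\<Sum>n\<in>J. a n s * u n, \<Sum>n\<in>J. a n s * v n) \<partial>M)
       = (\<integral>\<^sup>+x. \<integral>\<^sup>+y. (h (p * x, q * x + r * y) :: ennreal) \<partial>std_gauss \<partial>std_gauss))"
  using \<open>finite J\<close> \<open>J \<subseteq> I\<close>
proof (induction J)
  case empty
  interpret prob_space M by fact
  interpret G: prob_space std_gauss by (rule prob_space_std_gauss)
  show ?case
    by (intro exI[of _ 0]) (simp add: emeasure_space_1 emeasure_std_gauss_UNIV)
next
  case (insert n J)
  interpret prob_space M by fact
  interpret G: prob_space std_gauss by (rule prob_space_std_gauss)
  interpret GG: pair_prob_space std_gauss std_gauss ..
  have [measurable]: "random_variable borel (a i)" if "i \<in> I" for i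
    using ind that unfolding indep_vars_def by auto
  obtain p q r where pqr: "0 \<le> p" "0 \<le> r" "p\<^sup>2 = (\<Sum>n\<in>J. (u n)\<^sup>2)" "p * q = (\<Sum>n\<in>J. u n * v n)" "q\<^sup>2 + r\<^sup>2 = (\<Sum>n\<in>J. (v n)\<^sup>2)"
    and law: "\<And>h. h \<in> borel_measurable borel \<Longrightarrow> (\<integral>\<^sup>+s. h (\<Sum>n\<in>J. a n s * u n, \<Sum>n\<in>J. a n s * v n) \<partial>M)
       = (\<integral>\<^sup>+x. \<integral>\<^sup>+y. (h (p * x, q * x + r * y) :: ennreal) \<partial>std_gauss \<partial>std_gauss)"
    using insert by blast
  have n: "n \<in> I" "n \<notin> J" "J \<subseteq> I" "finite J" using insert by auto
  obtain c s p' where cs: "c\<^sup>2 + s\<^sup>2 = 1" "p = p' * c" "u n = p' * s" "0 \<le> p'"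
    by (rule unit_vector_factor)
  have cs1: "c * c + s * s = 1" using cs(1) by (simp add: power2_eq_square)
  define w where "w = v n * c - q * s"
  define q' where "q' = q * c + v n * s"
  obtain r' where r': "0 \<le> r'" "r'\<^sup>2 = w\<^sup>2 + r\<^sup>2"
    "\<And>k. k \<in> borel_measurable borel \<Longrightarrow> (\<integral>\<^sup>+z. \<integral>\<^sup>+y. k (w * z + r * y) \<partial>std_gauss \<partial>std_gauss) = (\<integral>\<^sup>+y. k (r' * y) \<partial>std_gauss)"
    using gauss_combination[of w r] by blast
  have "(\<integral>\<^sup>+s. h (\<Sum>n\<in>insert n J. a n s * u n, \<Sum>n\<in>insert n J. a n s * v n) \<partial>M)
       = (\<integral>\<^sup>+x. \<integral>\<^sup>+y. (h (p' * x, q' * x + r' * y) :: ennreal) \<partial>std_gauss \<partial>std_gauss)"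
    if h: "h \<in> borel_measurable borel" for h
  proof -
    have [measurable]: "h \<in> borel_measurable (borel \<Otimes>\<^sub>M borel)" using h by (simp add: borel_prod)
    define H where "H x z = (\<integral>\<^sup>+y. h (p * x + z * u n, q * x + r * y + z * v n) \<partial>std_gauss)" for x z
    have [measurable]: "case_prod H \<in> borel_measurable (borel \<Otimes>\<^sub>M borel)"
      unfolding H_def by measurable
    define f where "f = (\<lambda>(b, z). h ((\<Sum>n\<in>J. b n * u n) + z * u n, (\<Sum>n\<in>J. b n * v n) + z * v n))"
    have f: "f \<in> borel_measurable (Pi\<^sub>M J (\<lambda>_. borel) \<Otimes>\<^sub>M borel)" unfolding f_def by measurable
    have "(\<integral>\<^sup>+s. h (\<Sum>n\<in>insert n J. a n s * u n, \<Sum>n\<in>insert n J. a n s * v n) \<partial>M)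
      = (\<integral>\<^sup>+s. f (restrict (\<lambda>i. a i s) J, a n s) \<partial>M)"
      using n by (simp add: add.commute f_def)
    also have "\<dots> = (\<integral>\<^sup>+z. (\<integral>\<^sup>+s. f (restrict (\<lambda>i. a i s) J, z) \<partial>M) \<partial>std_gauss)"
      using indep_vars_nn_integral_split[OF \<open>prob_space M\<close> ind _ _ _ f] dist n by simp
    also have "\<dots> = (\<integral>\<^sup>+z. (\<integral>\<^sup>+x. H x z \<partial>std_gauss) \<partial>std_gauss)"
    proof (rule nn_integral_cong)
      fix z
      have m: "(\<lambda>(x,y). h (x + z * u n, y + z * v n)) \<in> borel_measurable borel"
        unfolding borel_prod[symmetric] by measurable
      show "(\<integral>\<^sup>+s. f (restrict (\<lambda>i. a i s) J, z) \<partial>M) = (\<integral>\<^sup>+x. H x z \<partial>std_gauss)"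
        using law[OF m] by (simp add: H_def f_def)
    qed
    also have "\<dots> = (\<integral>\<^sup>+x. (\<integral>\<^sup>+z. H x z \<partial>std_gauss) \<partial>std_gauss)"
      by (rule GG.Fubini') (simp cong: measurable_cong_sets)
    also have "\<dots> = (\<integral>\<^sup>+x. \<integral>\<^sup>+z. H (c * x - s * z) (s * x + c * z) \<partial>std_gauss \<partial>std_gauss)"
      using std_gauss_rotation[OF cs(1), of "case_prod H"] by (simp add: borel_prod[symmetric])
    also have "\<dots> = (\<integral>\<^sup>+x. \<integral>\<^sup>+y. h (p' * x, q' * x + r' * y) \<partial>std_gauss \<partial>std_gauss)"
    proof (rule nn_integral_cong)
      fix x
      have e1: "p * (c * x - s * z) + (s * x + c * z) * u n = p' * x" for z
      proof -
        have "p * (c * x - s * z) + (s * x + c * z) * u n = p' * (c * c + s * s) * x"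
          unfolding cs by (simp add: algebra_simps)
        then show ?thesis using cs1 by simp
      qed
      have e2: "q * (c * x - s * z) + r * y + (s * x + c * z) * v n = q' * x + (w * z + r * y)" for z y
        by (simp add: q'_def w_def algebra_simps)
      have m: "(\<lambda>t. h (p' * x, q' * x + t)) \<in> borel_measurable borel" by measurable
      show "(\<integral>\<^sup>+z. H (c * x - s * z) (s * x + c * z) \<partial>std_gauss) = (\<integral>\<^sup>+y. h (p' * x, q' * x + r' * y) \<partial>std_gauss)"
        unfolding H_def e1 e2 by (rule r'(3)[OF m])
    qed
    finally show ?thesis .
  qed
  moreover have "p'\<^sup>2 = (\<Sum>n\<in>insert n J. (u n)\<^sup>2)"
  proof -
    have "p'\<^sup>2 * (c\<^sup>2 + s\<^sup>2) = p\<^sup>2 + (u n)\<^sup>2" unfolding cs(2,3) by (simp add: algebra_simps power2_eq_square)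
    then show ?thesis using n pqr(3) cs(1) by simp
  qed
  moreover have "p' * q' = (\<Sum>n\<in>insert n J. u n * v n)"
  proof -
    have "p' * q' = p * q + u n * v n" unfolding q'_def cs(2,3) by (simp add: algebra_simps)
    then show ?thesis using n pqr(4) by simp
  qed
  moreover have "q'\<^sup>2 + r'\<^sup>2 = (\<Sum>n\<in>insert n J. (v n)\<^sup>2)"
  proof -
    have "q'\<^sup>2 + r'\<^sup>2 = (c\<^sup>2 + s\<^sup>2) * (q\<^sup>2 + (v n)\<^sup>2) + r\<^sup>2"
      unfolding r'(2) q'_def w_def by (simp add: algebra_simps power2_eq_square)
    then show ?thesis using n pqr(5) cs(1) by simp
  qed
  ultimately show ?case using cs(4) r'(1) by blast
qed

text \<open>
  Integration along the line of slope \<open>t\<close>: the quotient of two independent standard normal variables has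
  the Cauchy density.
\<close>

lemma gauss_ray_integral:
  fixes t :: real
  shows "(\<integral>\<^sup>+x. ennreal (std_normal_density x * (\<bar>x\<bar> * std_normal_density (x * t))) \<partial>lborel) = ennreal (1 / (pi * (1 + t\<^sup>2)))"
proof -
  define k where "k = 1 + t\<^sup>2"
  have k: "k > 0" by (simp add: k_def add_pos_nonneg)
  define f where "f x = std_normal_density x * (\<bar>x\<bar> * std_normal_density (x * t))" for x
  have [measurable]: "f \<in> borel_measurable borel" unfolding f_def by measurable
  have fE: "f x = \<bar>x\<bar> * exp (- (x\<^sup>2 * k) / 2) / (2 * pi)" for x
  proof -
    have "f x = \<bar>x\<bar> * (std_normal_density x * std_normal_density (x * t))"
      by (simp add: f_def)
    also have "x\<^sup>2 + (x * t)\<^sup>2 = x\<^sup>2 * k" by (simp add: k_def power_mult_distrib distrib_left)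
    then have "std_normal_density x * std_normal_density (x * t) = exp (- (x\<^sup>2 * k) / 2) / (2 * pi)"
      by (simp add: std_normal_density_mult)
    finally show ?thesis by simp
  qed
  have ev: "f (- x) = f x" for x by (simp add: fE)
  have half: "(\<integral>\<^sup>+x. ennreal (f x) * indicator {0..} x \<partial>lborel) = ennreal (1 / (2 * pi * k))"
  proof -
    have "(\<integral>\<^sup>+x. ennreal (f x) * indicator {0..} x \<partial>lborel)
      = (\<integral>\<^sup>+x. ennreal (x * exp (- (x\<^sup>2 * k) / 2) / (2 * pi)) * indicator {0..} x \<partial>lborel)"
      by (intro nn_integral_cong) (simp add: fE indicator_def)
    also have "\<dots> = ennreal (0 - (- exp (- (0\<^sup>2 * k) / 2) / (2 * pi * k)))"
    proof (rule nn_integral_FTC_atLeast)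
      show "((\<lambda>x. - exp (- (x\<^sup>2 * k) / 2) / (2 * pi * k)) \<longlongrightarrow> 0) at_top"
        using k by real_asymp
      show "((\<lambda>x. - exp (- (x\<^sup>2 * k) / 2) / (2 * pi * k)) has_real_derivative x * exp (- (x\<^sup>2 * k) / 2) / (2 * pi)) (at x)" for x
        using k by (auto intro!: derivative_eq_intros simp: field_simps)
    qed (use k in auto)
    finally show ?thesis by simp
  qed
  have half': "(\<integral>\<^sup>+x. ennreal (f x) * indicator {..0} x \<partial>lborel) = ennreal (1 / (2 * pi * k))"
  proof -
    have "(\<integral>\<^sup>+x. ennreal (f x) * indicator {..0} x \<partial>lborel)
        = ennreal \<bar>-1\<bar> * (\<integral>\<^sup>+x. ennreal (f (0 + -1 * x)) * indicator {..0} (0 + -1 * x :: real) \<partial>lborel)"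
      by (rule nn_integral_real_affine) auto
    also have "(\<integral>\<^sup>+x. ennreal (f (0 + -1 * x)) * indicator {..0} (0 + -1 * x :: real) \<partial>lborel)
      = (\<integral>\<^sup>+x. ennreal (f x) * indicator {0..} x \<partial>lborel)"
      by (intro nn_integral_cong) (auto simp: ev indicator_def)
    finally show ?thesis using half by simp
  qed
  have "(\<integral>\<^sup>+x. ennreal (f x) \<partial>lborel) = (\<integral>\<^sup>+x. ennreal (f x) * indicator {0..} x + ennreal (f x) * indicator {..0} x \<partial>lborel)"
    by (intro nn_integral_cong) (auto simp: indicator_def fE)
  also have "\<dots> = ennreal (1 / (2 * pi * k)) + ennreal (1 / (2 * pi * k))"
    by (subst nn_integral_add) (simp_all add: half half')
  also have "\<dots> = ennreal (1 / (pi * k))"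
    using k by (subst ennreal_plus[symmetric]) (auto simp: field_simps)
  finally show ?thesis by (simp add: f_def k_def)
qed

lemma arccos_correlation:
  fixes q r :: real
  assumes "r > 0"
  shows "arccos (q / sqrt (q\<^sup>2 + r\<^sup>2)) = pi / 2 - arctan (q / r)"
proof -
  have "cos (pi / 2 - arctan (q / r)) = sin (arctan (q / r))" by (simp add: cos_diff)
  also have "\<dots> = (q / r) / sqrt (1 + (q / r)\<^sup>2)" by (rule sin_arctan)
  also have "1 + (q / r)\<^sup>2 = (q\<^sup>2 + r\<^sup>2) / r\<^sup>2" using assms by (simp add: field_simps)
  also have "(q / r) / sqrt ((q\<^sup>2 + r\<^sup>2) / r\<^sup>2) = q / sqrt (q\<^sup>2 + r\<^sup>2)"
    using assms by (simp add: real_sqrt_divide)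
  finally have "cos (pi / 2 - arctan (q / r)) = q / sqrt (q\<^sup>2 + r\<^sup>2)" .
  moreover have "arccos (cos (pi / 2 - arctan (q / r))) = pi / 2 - arctan (q / r)"
    using arctan_bounded[of "q/r"] by (intro arccos_cos) auto
  ultimately show ?thesis by simp
qed

text \<open>
  Sheppard's formula. If \<open>r > 0\<close>, then opposite signs mean \<open>\<eta> / \<xi> < - q / r\<close>, and this quotient is Cauchy
  distributed. If \<open>r = 0\<close>, then the two components are proportional and the angle is \<open>0\<close> or \<open>\<pi>\<close>.
\<close>

lemma gauss_opposite_signs:
  fixes p q r :: real
  assumes p: "p > 0" and r: "r \<ge> 0" and qr: "q\<^sup>2 + r\<^sup>2 > 0"
  shows "(\<integral>\<^sup>+x. \<integral>\<^sup>+y. indicator {z. fst z * snd z < 0} (p * x, q * x + r * y) \<partial>std_gauss \<partial>std_gauss)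
     = ennreal (arccos (q / sqrt (q\<^sup>2 + r\<^sup>2)) / pi)"
proof -
  have AE0: "AE x in std_gauss. x \<noteq> 0"
  proof (subst AE_density)
    show "AE x in lborel. 0 < ennreal (std_normal_density x) \<longrightarrow> (x::real) \<noteq> 0"
      using AE_lborel_singleton[of 0] by (rule AE_mp) (rule AE_I2, blast)
  qed measurable
  show ?thesis
  proof (cases "r = 0")
    case True
    then have q: "q \<noteq> 0" using qr by auto
    have e: "p * x * (q * x) < 0 \<longleftrightarrow> q < 0 \<and> x \<noteq> 0" for x
    proof -
      have "p * x * (q * x) = q * (p * x\<^sup>2)" by (simp add: power2_eq_square)
      moreover have "q * (p * x\<^sup>2) < 0 \<longleftrightarrow> q < 0 \<and> x \<noteq> 0"
      proof (cases "x = 0")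
        case False
        then have "p * x\<^sup>2 > 0" using p by simp
        then show ?thesis using False p by (auto simp: mult_less_0_iff)
      qed simp
      ultimately show ?thesis by (simp only:)
    qed
    have "(\<integral>\<^sup>+x. \<integral>\<^sup>+y. indicator {z. fst z * snd z < 0} (p * x, q * x + r * y) \<partial>std_gauss \<partial>std_gauss)
      = (\<integral>\<^sup>+x. \<integral>\<^sup>+y. (if q < 0 then 1 else 0) \<partial>std_gauss \<partial>std_gauss)"
      using AE0 by (intro nn_integral_cong_AE, elim AE_mp, intro AE_I2 impI)
         (simp only: True e indicator_def mem_Collect_eq fst_conv snd_conv mult_zero_left add_0_right, simp)
    also have "\<dots> = (if q < 0 then 1 else 0)" by (simp add: emeasure_std_gauss_UNIV)
    also have "\<dots> = ennreal (arccos (q / sqrt (q\<^sup>2 + r\<^sup>2)) / pi)"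
    proof -
      have "q / sqrt (q\<^sup>2 + r\<^sup>2) = (if q < 0 then -1 else 1)" using q True by simp
      then show ?thesis by simp
    qed
    finally show ?thesis .
  next
    case False
    then have r: "r > 0" using r by simp
    define B where "B = {..< - (q / r)}"
    have B: "p * x * (q * x + r * (x * t)) < 0 \<longleftrightarrow> t \<in> B" if "x \<noteq> 0" for x t
    proof -
      have "p * x * (q * x + r * (x * t)) = (q + r * t) * (p * x\<^sup>2)" by (simp add: power2_eq_square algebra_simps)
      moreover have "p * x\<^sup>2 > 0" using p that by simp
      moreover from this have "(q + r * t) * (p * x\<^sup>2) < 0 \<longleftrightarrow> q + r * t < 0"
        using zero_less_power2[of x] p that by (auto simp: mult_less_0_iff)
      ultimately have "p * x * (q * x + r * (x * t)) < 0 \<longleftrightarrow> q + r * t < 0" by (simp only:)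
      also have "\<dots> \<longleftrightarrow> t \<in> B" using r by (auto simp: B_def field_simps)
      finally show ?thesis .
    qed
    have [measurable]: "B \<in> sets borel" by (simp add: B_def)
    have "(\<integral>\<^sup>+x. \<integral>\<^sup>+y. indicator {z. fst z * snd z < 0} (p * x, q * x + r * y) \<partial>std_gauss \<partial>std_gauss)
      = (\<integral>\<^sup>+x. \<integral>\<^sup>+t. ennreal \<bar>x\<bar> * (ennreal (std_normal_density (x * t)) * indicator B t) \<partial>lborel \<partial>std_gauss)"
    proof (rule nn_integral_cong_AE, rule AE_mp[OF AE0], intro AE_I2 impI)
      fix x :: real assume x: "x \<noteq> 0"
      have "(\<integral>\<^sup>+y. indicator {z. fst z * snd z < 0} (p * x, q * x + r * y) \<partial>std_gauss)
        = (\<integral>\<^sup>+y. ennreal (std_normal_density y) * indicator {y. p * x * (q * x + r * y) < 0} y \<partial>lborel)"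
        by (subst nn_integral_density) (auto simp: indicator_def intro!: nn_integral_cong)
      also have "\<dots> = ennreal \<bar>x\<bar> * (\<integral>\<^sup>+t. ennreal (std_normal_density (x * t)) * indicator B t \<partial>lborel)"
        using x by (subst nn_integral_real_affine[where c=x and t=0]) (auto simp: indicator_def B intro!: arg_cong2[where f=times] nn_integral_cong)
      finally show "(\<integral>\<^sup>+y. indicator {z. fst z * snd z < 0} (p * x, q * x + r * y) \<partial>std_gauss) = (\<integral>\<^sup>+t. ennreal \<bar>x\<bar> * (ennreal (std_normal_density (x * t)) * indicator B t) \<partial>lborel)"
        by (simp add: nn_integral_cmult)
    qed
    also have "\<dots> = (\<integral>\<^sup>+x. \<integral>\<^sup>+t. ennreal (std_normal_density x * (\<bar>x\<bar> * std_normal_density (x * t))) * indicator B t \<partial>lborel \<partial>lborel)"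
    proof (subst nn_integral_density)
      show "(\<integral>\<^sup>+x. ennreal (std_normal_density x) * (\<integral>\<^sup>+t. ennreal \<bar>x\<bar> * (ennreal (std_normal_density (x * t)) * indicator B t) \<partial>lborel) \<partial>lborel)
        = (\<integral>\<^sup>+x. \<integral>\<^sup>+t. ennreal (std_normal_density x * (\<bar>x\<bar> * std_normal_density (x * t))) * indicator B t \<partial>lborel \<partial>lborel)"
        by (intro nn_integral_cong, subst nn_integral_cmult[symmetric])
           (measurable, simp add: ennreal_mult' mult.assoc)
    qed measurable
    also have "\<dots> = (\<integral>\<^sup>+t. \<integral>\<^sup>+x. ennreal (std_normal_density x * (\<bar>x\<bar> * std_normal_density (x * t))) * indicator B t \<partial>lborel \<partial>lborel)"
      by (rule lborel_pair.Fubini') measurable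
    also have "\<dots> = (\<integral>\<^sup>+t. ennreal (1 / (pi * (1 + t\<^sup>2))) * indicator B t \<partial>lborel)"
      by (intro nn_integral_cong) (simp add: nn_integral_multc gauss_ray_integral)
    also have "\<dots> = (\<integral>\<^sup>+t. ennreal (1 / (pi * (1 + t\<^sup>2))) * indicator {q / r <..} t \<partial>lborel)"
      by (subst nn_integral_real_affine[where c="-1" and t=0]) (auto simp: B_def indicator_def intro!: nn_integral_cong)
    also have "\<dots> = (\<integral>\<^sup>+t. ennreal (1 / (pi * (1 + t\<^sup>2))) * indicator {q / r ..} t \<partial>lborel)"
      by (rule nn_integral_cong_AE, rule AE_mp[OF AE_lborel_singleton[of "q / r"]], rule AE_I2) (auto simp: indicator_def)
    also have "\<dots> = ennreal (1 / 2 - arctan (q / r) / pi)"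
    proof (rule nn_integral_FTC_atLeast)
      have "((\<lambda>x. arctan x / pi) \<longlongrightarrow> (pi / 2) / pi) at_top"
        by (intro tendsto_intros tendsto_arctan_at_top) simp
      then show "((\<lambda>x. arctan x / pi) \<longlongrightarrow> 1 / 2) at_top" by simp
      show "((\<lambda>x. arctan x / pi) has_real_derivative 1 / (pi * (1 + x\<^sup>2))) (at x)" for x
        by (auto intro!: derivative_eq_intros simp: field_simps add_nonneg_eq_0_iff)
    qed auto
    also have "\<dots> = ennreal (arccos (q / sqrt (q\<^sup>2 + r\<^sup>2)) / pi)"
      unfolding arccos_correlation[OF r] by (simp add: diff_divide_distrib)
    finally show ?thesis .
  qed
qed

section \<open>Almost sure convergence of independent series\<close>

text \<open>
  On the event that the sums leave \<open>(-\<epsilon>, \<epsilon>)\<close> for the first time at step \<open>k\<close>, the later increments are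
  orthogonal to everything that happened up to step \<open>k\<close>. The second moment of the last sum over this
  event is therefore at least \<open>\<epsilon>\<^sup>2\<close> times its probability. Increasing finite sets \<open>A k\<close> instead of initial
  segments cover tails of a series and sums over the two halves of the integers.
\<close>

lemma kolmogorov_maximal_inequality:
  fixes X :: "'i \<Rightarrow> 's \<Rightarrow> real" and A :: "nat \<Rightarrow> 'i set"
  assumes "prob_space M" and ind: "prob_space.indep_vars M (\<lambda>_. borel) X I"
    and int1: "\<And>n. n \<in> I \<Longrightarrow> integrable M (X n)" and int2: "\<And>n. n \<in> I \<Longrightarrow> integrable M (\<lambda>s. (X n s)\<^sup>2)"
    and mean: "\<And>n. n \<in> I \<Longrightarrow> (LINT s|M. X n s) = 0"
    and A: "mono A" "\<And>k. finite (A k)" "\<And>k. A k \<subseteq> I"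
    and e: "\<epsilon> > 0"
  shows "measure M {s\<in>space M. \<exists>k\<le>N. \<epsilon> \<le> \<bar>\<Sum>n\<in>A k. X n s\<bar>} \<le> (\<Sum>n\<in>A N. LINT s|M. (X n s)\<^sup>2) / \<epsilon>\<^sup>2"
proof -
  interpret prob_space M by fact
  have X[measurable]: "random_variable borel (X i)" if "i \<in> I" for i
    using ind that unfolding indep_vars_def by auto
  define S where "S k s = (\<Sum>n\<in>A k. X n s)" for k s
  have S[measurable]: "S k \<in> borel_measurable M" for k
    unfolding S_def using A(3)[of k] by (intro borel_measurable_sum) auto
  have prod: "integrable M (\<lambda>s. X m s * X n s)" "m \<noteq> n \<Longrightarrow> (LINT s|M. X m s * X n s) = 0" if "m \<in> I" "n \<in> I" for m n
  proof -
    have mm[measurable]: "X m \<in> borel_measurable M" "X n \<in> borel_measurable M" using that by auto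
    show "integrable M (\<lambda>s. X m s * X n s)"
    proof (rule Bochner_Integration.integrable_bound)
      show "integrable M (\<lambda>s. (X m s)\<^sup>2 + (X n s)\<^sup>2)" using int2 that by auto
      have "\<bar>x * y\<bar> \<le> x\<^sup>2 + y\<^sup>2" for x y :: real
        using sum_squares_bound[of "\<bar>x\<bar>" "\<bar>y\<bar>"] mult_nonneg_nonneg[of "\<bar>x\<bar>" "\<bar>y\<bar>"]
        unfolding abs_mult power2_abs by linarith
      then show "AE s in M. norm (X m s * X n s) \<le> norm ((X m s)\<^sup>2 + (X n s)\<^sup>2)"
        by (auto simp: add_nonneg_nonneg)
    qed measurable
    assume "m \<noteq> n"
    have "indep_var borel ((\<lambda>b. b m) \<circ> (\<lambda>s. restrict (\<lambda>i. X i s) {m})) borel ((\<lambda>b. b n) \<circ> (\<lambda>s. restrict (\<lambda>i. X i s) {n}))"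
      by (intro indep_var_compose[OF indep_var_restrict[OF ind]]) (use that \<open>m \<noteq> n\<close> in auto)
    then have "indep_var borel (X m) borel (X n)" by (simp add: comp_def)
    then show "(LINT s|M. X m s * X n s) = 0"
      using indep_var_lebesgue_integral[of "X m" "X n"] int1 mean that by simp
  qed
  have SN2: "(S N s)\<^sup>2 = (\<Sum>m\<in>A N. \<Sum>n\<in>A N. X m s * X n s)" for s
    by (simp add: S_def power2_eq_square sum_product)
  have intS: "integrable M (\<lambda>s. (S k s)\<^sup>2)" for k
    unfolding S_def power2_eq_square sum_product using A(3)[of k] prod(1)
    by (intro Bochner_Integration.integrable_sum) blast
  have ES: "(LINT s|M. (S N s)\<^sup>2) = (\<Sum>n\<in>A N. LINT s|M. (X n s)\<^sup>2)"
  proof -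
    have "(LINT s|M. (S N s)\<^sup>2) = (\<Sum>m\<in>A N. \<Sum>n\<in>A N. LINT s|M. X m s * X n s)"
    proof -
      have i: "integrable M (\<lambda>s. X m s * X n s)" if "m \<in> A N" "n \<in> A N" for m n
        using A(3)[of N] prod(1) that by blast
      show ?thesis
        unfolding SN2 by (simp add: i Bochner_Integration.integral_sum Bochner_Integration.integrable_sum)
    qed
    also have "\<dots> = (\<Sum>m\<in>A N. \<Sum>n\<in>A N. if n = m then LINT s|M. (X m s)\<^sup>2 else 0)"
      using A(3)[of N] prod(2) by (intro sum.cong) (auto simp: power2_eq_square)
    also have "\<dots> = (\<Sum>n\<in>A N. LINT s|M. (X n s)\<^sup>2)" using A(2) by simp
    finally show ?thesis .
  qed
  \<comment> \<open>The first index at which the partial sums leave the interval splits the event.\<close>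
  define D where "D k = {s\<in>space M. \<epsilon> \<le> \<bar>S k s\<bar> \<and> (\<forall>j<k. \<bar>S j s\<bar> < \<epsilon>)}" for k
  have D[measurable]: "D k \<in> sets M" for k unfolding D_def by measurable
  have disj: "disjoint_family_on D {..N}"
    unfolding disjoint_family_on_def D_def by (auto, metis linorder_neqE_nat not_less)
  have un: "{s\<in>space M. \<exists>k\<le>N. \<epsilon> \<le> \<bar>\<Sum>n\<in>A k. X n s\<bar>} = (\<Union>k\<in>{..N}. D k)"
  proof safe
    fix s k assume s: "s \<in> space M" and k: "k \<le> N" "\<epsilon> \<le> \<bar>\<Sum>n\<in>A k. X n s\<bar>"
    define j where "j = (LEAST j. \<epsilon> \<le> \<bar>S j s\<bar>)"
    have j: "\<epsilon> \<le> \<bar>S j s\<bar>" unfolding j_def by (rule LeastI[of _ k]) (use k in \<open>simp add: S_def\<close>)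
    have "j \<le> k" unfolding j_def by (rule Least_le) (use k in \<open>simp add: S_def\<close>)
    moreover have "\<bar>S i s\<bar> < \<epsilon>" if "i < j" for i
      using not_less_Least[of i "\<lambda>j. \<epsilon> \<le> \<bar>S j s\<bar>"] that by (auto simp: j_def)
    ultimately show "s \<in> (\<Union>k\<in>{..N}. D k)" using j k s by (auto simp: D_def intro!: bexI[of _ j])
  qed (auto simp: D_def S_def)
  have key: "\<epsilon>\<^sup>2 * measure M (D k) \<le> (LINT s|M. indicator (D k) s * (S N s)\<^sup>2)" if k: "k \<le> N" for k
  proof -
    define F where "F b = (if \<epsilon> \<le> \<bar>\<Sum>n\<in>A k. b n\<bar> \<and> (\<forall>j\<in>{..<k}. \<bar>\<Sum>n\<in>A j. b n\<bar> < \<epsilon>) then (\<Sum>n\<in>A k. b n) else 0)" for b :: "'i \<Rightarrow> real"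
    have sub: "A j \<subseteq> A k" if "j \<le> k" for j using A(1) that by (rule monoD)
    have mj: "(\<lambda>b. \<Sum>n\<in>A j. b n) \<in> borel_measurable (Pi\<^sub>M (A k) (\<lambda>_. borel :: real measure))" if "j \<le> k" for j
      using sub[OF that] by (intro borel_measurable_sum measurable_component_singleton) auto
    have F: "F \<in> borel_measurable (Pi\<^sub>M (A k) (\<lambda>_. borel))"
    proof -
      have "{b \<in> space (Pi\<^sub>M (A k) (\<lambda>_. borel :: real measure)). \<epsilon> \<le> \<bar>\<Sum>n\<in>A k. b n\<bar> \<and> (\<forall>j\<in>{..<k}. \<bar>\<Sum>n\<in>A j. b n\<bar> < \<epsilon>)}
          \<in> sets (Pi\<^sub>M (A k) (\<lambda>_. borel))"
        by (intro sets.sets_Collect_conj sets.sets_Collect_finite_All borel_measurable_le borel_measurable_less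
            borel_measurable_abs borel_measurable_const mj) auto
      then show ?thesis unfolding F_def by (intro measurable_If mj) simp_all
    qed
    define f where "f s = F (restrict (\<lambda>i. X i s) (A k))" for s
    have fF: "f s = indicator (D k) s * S k s" if "s \<in> space M" for s
    proof -
      define b where "b = restrict (\<lambda>i. X i s) (A k)"
      have e: "(\<Sum>n\<in>A j. b n) = S j s" if "j \<le> k" for j
        unfolding S_def b_def using sub[OF that] by (intro sum.cong) auto
      have "f s = F b" by (simp add: f_def b_def)
      then show ?thesis using that e by (auto simp: F_def D_def indicator_def)
    qed
    have "integrable M (\<lambda>s. indicator (D k) s * S k s)"
      unfolding S_def using A(3)[of k] int1
      by (intro integrable_mult_indicator[where 'b=real, simplified] Bochner_Integration.integrable_sum) auto
    then have intf: "integrable M f"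
      using fF by (subst Bochner_Integration.integrable_cong[OF refl fF]) auto
    have orth: "integrable M (\<lambda>s. f s * X n s) \<and> (LINT s|M. f s * X n s) = 0" if n: "n \<in> A N - A k" for n
    proof -
      have nI: "n \<in> I" using n A(3) by auto
      have "indep_var borel (F \<circ> (\<lambda>s. restrict (\<lambda>i. X i s) (A k))) borel ((\<lambda>b. b n) \<circ> (\<lambda>s. restrict (\<lambda>i. X i s) {n}))"
        by (intro indep_var_compose[OF indep_var_restrict[OF ind]]) (use n nI A(3) F in auto)
      then have "indep_var borel f borel (X n)" by (simp add: comp_def f_def[abs_def])
      then show ?thesis
        using indep_var_lebesgue_integral[of f "X n"] indep_var_integrable[of f "X n"] intf int1 mean nI by simp
    qed
    have split: "S N s = S k s + (\<Sum>n\<in>A N - A k. X n s)" for s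
      unfolding S_def using sum.subset_diff[OF monoD[OF A(1) k] A(2), of "\<lambda>n. X n s"] by simp
    have zero: "(LINT s|M. (\<Sum>n\<in>A N - A k. f s * X n s)) = 0"
      by (subst Bochner_Integration.integral_sum) (use orth in auto)
    have intsum: "integrable M (\<lambda>s. (\<Sum>n\<in>A N - A k. f s * X n s))"
      using orth by (intro Bochner_Integration.integrable_sum) auto
    have intD: "integrable M (\<lambda>s. indicator (D k) s * \<epsilon>\<^sup>2)"
      by (auto intro!: integrable_real_indicator simp: emeasure_eq_measure less_top[symmetric])
    have "\<epsilon>\<^sup>2 * measure M (D k) = (LINT s|M. indicator (D k) s * \<epsilon>\<^sup>2 + 2 * (\<Sum>n\<in>A N - A k. f s * X n s))"
      using zero intsum intD by (subst Bochner_Integration.integral_add) auto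
    also have "\<dots> \<le> (LINT s|M. indicator (D k) s * (S N s)\<^sup>2)"
    proof (rule integral_mono)
      show "integrable M (\<lambda>s. indicator (D k) s * (S N s)\<^sup>2)"
        using intS by (intro integrable_mult_indicator[where 'b=real, simplified]) auto
      fix s assume s: "s \<in> space M"
      show "indicator (D k) s * \<epsilon>\<^sup>2 + 2 * (\<Sum>n\<in>A N - A k. f s * X n s) \<le> indicator (D k) s * (S N s)\<^sup>2"
      proof (cases "s \<in> D k")
        case True
        then have "\<epsilon>\<^sup>2 \<le> (S k s)\<^sup>2" using e by (auto simp: D_def abs_le_square_iff[symmetric])
        moreover have "(S N s)\<^sup>2 = (S k s)\<^sup>2 + 2 * (S k s * (\<Sum>n\<in>A N - A k. X n s)) + (\<Sum>n\<in>A N - A k. X n s)\<^sup>2"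
          unfolding split by (simp add: power2_sum)
        ultimately show ?thesis using True
          by (simp add: fF[OF s] sum_distrib_left[symmetric])
             (use zero_le_power2[of "\<Sum>n\<in>A N - A k. X n s"] in linarith)
      qed (simp add: fF[OF s])
    qed (use intsum intD in auto)
    finally show ?thesis .
  qed
  have "\<epsilon>\<^sup>2 * measure M (\<Union>k\<in>{..N}. D k) = (\<Sum>k\<le>N. \<epsilon>\<^sup>2 * measure M (D k))"
    by (subst finite_measure_finite_Union) (auto simp: disj sum_distrib_left)
  also have "\<dots> \<le> (\<Sum>k\<le>N. (LINT s|M. indicator (D k) s * (S N s)\<^sup>2))"
    by (intro sum_mono key) auto
  also have "\<dots> = (LINT s|M. (\<Sum>k\<le>N. indicator (D k) s * (S N s)\<^sup>2))"
    using intS by (intro Bochner_Integration.integral_sum[symmetric] integrable_mult_indicator[where 'b=real, simplified]) auto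
  also have "\<dots> \<le> (LINT s|M. (S N s)\<^sup>2)"
  proof (rule integral_mono)
    show "integrable M (\<lambda>s. \<Sum>k\<le>N. indicator (D k) s * (S N s)\<^sup>2)"
      using intS by (intro Bochner_Integration.integrable_sum integrable_mult_indicator[where 'b=real, simplified]) auto
    fix s
    have "(\<Sum>k\<le>N. indicator (D k) s :: real) = indicator (\<Union>k\<in>{..N}. D k) s"
      by (subst indicator_UN_disjoint[OF _ disj]) simp_all
    then show "(\<Sum>k\<le>N. indicator (D k) s * (S N s)\<^sup>2) \<le> (S N s)\<^sup>2"
      unfolding sum_distrib_right[symmetric] by (simp add: indicator_def)
  qed (rule intS)
  finally show ?thesis
    unfolding un ES using e by (simp add: field_simps)
qed

text \<open>
  Kolmogorov's inequality for the tails: almost surely the partial sums form a Cauchy sequence.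
\<close>

lemma convergent_indep_sums:
  fixes X :: "'i \<Rightarrow> 's \<Rightarrow> real" and A :: "nat \<Rightarrow> 'i set"
  assumes "prob_space M" and ind: "prob_space.indep_vars M (\<lambda>_. borel) X I"
    and int1: "\<And>n. n \<in> I \<Longrightarrow> integrable M (X n)" and int2: "\<And>n. n \<in> I \<Longrightarrow> integrable M (\<lambda>s. (X n s)\<^sup>2)"
    and mean: "\<And>n. n \<in> I \<Longrightarrow> (LINT s|M. X n s) = 0"
    and A: "mono A" "\<And>k. finite (A k)" "\<And>k. A k \<subseteq> I"
    and bdd: "\<And>N. (\<Sum>n\<in>A N. LINT s|M. (X n s)\<^sup>2) \<le> C"
  shows "AE s in M. convergent (\<lambda>N. \<Sum>n\<in>A N. X n s)"
proof -
  interpret prob_space M by fact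
  have X[measurable]: "random_variable borel (X i)" if "i \<in> I" for i
    using ind that unfolding indep_vars_def by auto
  define S where "S k s = (\<Sum>n\<in>A k. X n s)" for k s
  have S[measurable]: "S k \<in> borel_measurable M" for k
    unfolding S_def using A(3)[of k] by (intro borel_measurable_sum) auto
  define W where "W m = (\<Sum>n\<in>A m. LINT s|M. (X n s)\<^sup>2)" for m
  have "incseq W"
    unfolding W_def incseq_def using monoD[OF A(1)] A(2) by (auto intro!: sum_mono2)
  then obtain L where L: "W \<longlonglongrightarrow> L" "\<And>m. W m \<le> L"
    using incseq_convergent[of W C] bdd unfolding W_def[symmetric] by blast
  have Sdiff: "S (m + k) s - S m s = (\<Sum>n\<in>A (m + k) - A m. X n s)" for m k s
    unfolding S_def using sum.subset_diff[of "A m" "A (m + k)" "\<lambda>n. X n s"] monoD[OF A(1), of m "m+k"] A(2) by simp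
  have tail: "measure M {s\<in>space M. \<exists>k. \<epsilon> \<le> \<bar>S (m + k) s - S m s\<bar>} \<le> (L - W m) / \<epsilon>\<^sup>2" if e: "\<epsilon> > 0" for m \<epsilon>
  proof -
    let ?U = "\<lambda>N. {s\<in>space M. \<exists>k\<le>N. \<epsilon> \<le> \<bar>S (m + k) s - S m s\<bar>}"
    have "(\<lambda>N. measure M (?U N)) \<longlonglongrightarrow> measure M (\<Union>N. ?U N)"
      by (intro finite_Lim_measure_incseq) (auto simp: incseq_def intro: order_trans)
    moreover have "measure M (?U N) \<le> (L - W m) / \<epsilon>\<^sup>2" for N
    proof -
      have "measure M (?U N) \<le> (\<Sum>n\<in>A (m + N) - A m. LINT s|M. (X n s)\<^sup>2) / \<epsilon>\<^sup>2"
        unfolding Sdiff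
      proof (rule kolmogorov_maximal_inequality[OF \<open>prob_space M\<close> ind int1 int2 mean _ _ _ e])
        show "mono (\<lambda>k. A (m + k) - A m)" using monoD[OF A(1)] by (intro monoI Diff_mono) auto
        show "A (m + k) - A m \<subseteq> I" for k using A(3)[of "m+k"] by blast
      qed (use A(2) in auto)
      also have "(\<Sum>n\<in>A (m + N) - A m. LINT s|M. (X n s)\<^sup>2) = W (m + N) - W m"
        unfolding W_def using sum_diff[OF A(2) monoD[OF A(1), of m "m+N"]] by simp
      also have "(W (m + N) - W m) / \<epsilon>\<^sup>2 \<le> (L - W m) / \<epsilon>\<^sup>2"
        using L(2)[of "m+N"] by (intro divide_right_mono) auto
      finally show ?thesis .
    qed
    moreover have "(\<Union>N. ?U N) = {s\<in>space M. \<exists>k. \<epsilon> \<le> \<bar>S (m + k) s - S m s\<bar>}" by auto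
    ultimately show ?thesis by (auto intro: LIMSEQ_le_const2)
  qed
  have "AE s in M. \<exists>m. \<forall>k. \<bar>S (m + k) s - S m s\<bar> < \<epsilon>" if e: "\<epsilon> > 0" for \<epsilon>
  proof -
    let ?B = "{s\<in>space M. \<forall>m. \<exists>k. \<epsilon> \<le> \<bar>S (m + k) s - S m s\<bar>}"
    have "measure M ?B \<le> (L - W m) / \<epsilon>\<^sup>2" for m
      by (rule order_trans[OF finite_measure_mono tail[OF e, of m]]) auto
    moreover have "(\<lambda>m. (L - W m) / \<epsilon>\<^sup>2) \<longlonglongrightarrow> (L - L) / \<epsilon>\<^sup>2"
      using L(1) e by (intro tendsto_intros) auto
    ultimately have "measure M ?B \<le> 0" by (intro LIMSEQ_le_const[of "\<lambda>m. (L - W m) / \<epsilon>\<^sup>2"]) auto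
    then have "measure M ?B = 0" using measure_nonneg[of M ?B] by linarith
    then have "AE s in M. s \<notin> ?B" by (subst AE_iff_measurable[of ?B]) (auto simp: emeasure_eq_measure)
    then show ?thesis using AE_space by eventually_elim (auto simp: not_le)
  qed
  then have "AE s in M. \<forall>j::nat. \<exists>m. \<forall>k. \<bar>S (m + k) s - S m s\<bar> < 1 / real (Suc j)"
    by (subst AE_all_countable) auto
  then show ?thesis
  proof eventually_elim
    case (elim s)
    have "Cauchy (\<lambda>N. S N s)"
    proof (rule metric_CauchyI)
      fix e :: real assume "e > 0"
      then obtain j where j: "1 / real (Suc j) < e / 2" using nat_approx_posE[of "e/2"] by auto
      obtain m where m: "\<And>k. \<bar>S (m + k) s - S m s\<bar> < 1 / real (Suc j)" using elim by blast
      have "dist (S a s) (S b s) < e" if "a \<ge> m" "b \<ge> m" for a b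
        using m[of "a - m"] m[of "b - m"] j that by (simp add: dist_real_def)
      then show "\<exists>M. \<forall>a\<ge>M. \<forall>b\<ge>M. dist (S a s) (S b s) < e" by blast
    qed
    then show ?case by (simp add: S_def Cauchy_convergent_iff)
  qed
qed

lemma iid_std_normalD:
  assumes "prob_space M" "iid_std_normal M I a"
  shows "prob_space.indep_vars M (\<lambda>_. borel) a I"
    and "n \<in> I \<Longrightarrow> a n \<in> borel_measurable M"
    and "n \<in> I \<Longrightarrow> distr M borel (a n) = std_gauss"
proof -
  interpret prob_space M by fact
  show i: "indep_vars (\<lambda>_. borel) a I" using assms(2) by (simp add: iid_std_normal_def)
  show "n \<in> I \<Longrightarrow> a n \<in> borel_measurable M" using i unfolding indep_vars_def by auto
  assume "n \<in> I"
  then have "distr M lborel (a n) = std_gauss"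
    using assms(2) by (auto simp: iid_std_normal_def distributed_def)
  moreover have "distr M borel (a n) = distr M lborel (a n)" by (rule distr_cong) auto
  ultimately show "distr M borel (a n) = std_gauss" by simp
qed

lemma std_gauss_moments:
  assumes "prob_space M" "X \<in> borel_measurable M" "distr M borel X = std_gauss"
  shows "integrable M X" "(LINT s|M. X s) = 0" "integrable M (\<lambda>s. (X s)\<^sup>2)" "(LINT s|M. (X s)\<^sup>2) = 1"
proof -
  note [measurable] = assms(2)
  have i: "has_bochner_integral std_gauss (\<lambda>x. x) 0" "has_bochner_integral std_gauss (\<lambda>x. x\<^sup>2) 1"
    using std_normal_moment_odd[of 0] std_normal_moment_even[of 1]
    by (auto intro!: has_bochner_integral_density)
  have j: "has_bochner_integral (distr M borel X) (\<lambda>x. x) 0" "has_bochner_integral (distr M borel X) (\<lambda>x. x\<^sup>2) 1"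
    using i assms(3) by simp_all
  show "integrable M X" "(LINT s|M. X s) = 0" "integrable M (\<lambda>s. (X s)\<^sup>2)" "(LINT s|M. (X s)\<^sup>2) = 1"
    using j by (auto simp: has_bochner_integral_iff integrable_distr_eq integral_distr)
qed

lemma convergent_gaussian_series:
  fixes a :: "'i \<Rightarrow> 's \<Rightarrow> real" and A :: "nat \<Rightarrow> 'i set"
  assumes M: "prob_space M" and a: "iid_std_normal M I a"
    and A: "mono A" "\<And>k. finite (A k)" "\<And>k. A k \<subseteq> I"
    and bdd: "\<And>N. (\<Sum>n\<in>A N. (c n)\<^sup>2) \<le> C"
  shows "AE s in M. convergent (\<lambda>N. \<Sum>n\<in>A N. a n s * c n)"
proof (rule convergent_indep_sums[OF M _ _ _ _ A, where X = "\<lambda>n s. a n s * c n" and C = C])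
  interpret prob_space M by fact
  note i = iid_std_normalD[OF M a]
  show "indep_vars (\<lambda>_. borel) (\<lambda>n s. a n s * c n) I"
    by (rule indep_vars_compose2[OF i(1)]) measurable
  show "integrable M (\<lambda>s. a n s * c n)" "integrable M (\<lambda>s. (a n s * c n)\<^sup>2)" "(LINT s|M. a n s * c n) = 0" if "n \<in> I" for n
    using std_gauss_moments[OF M i(2,3)] that by (auto simp: power_mult_distrib)
  show "(\<Sum>n\<in>A N. LINT s|M. (a n s * c n)\<^sup>2) \<le> C" for N
  proof -
    have "(\<Sum>n\<in>A N. LINT s|M. (a n s * c n)\<^sup>2) = (\<Sum>n\<in>A N. (c n)\<^sup>2)"
      using std_gauss_moments[OF M i(2,3)] A(3)[of N] by (intro sum.cong) (auto simp: power_mult_distrib)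
    then show ?thesis using bdd by simp
  qed
qed

text \<open>
  Given the other variables, \<open>a n\<close> has a density, so it misses any prescribed value. The value is an extended
  real since it will be a supremum over a countable set.
\<close>

lemma AE_gauss_avoids:
  fixes a :: "'i \<Rightarrow> 's \<Rightarrow> real"
  assumes M: "prob_space M" and a: "iid_std_normal M I a"
    and n: "J \<subseteq> I" "n \<in> I" "n \<notin> J"
    and R[measurable]: "R \<in> borel_measurable (Pi\<^sub>M J (\<lambda>_. borel))"
  shows "AE s in M. ereal (a n s) \<noteq> R (restrict (\<lambda>i. a i s) J)"
proof -
  interpret prob_space M by fact
  interpret G: prob_space std_gauss by (rule prob_space_std_gauss)
  interpret MG: pair_sigma_finite M std_gauss ..
  note i = iid_std_normalD[OF M a]
  have [measurable]: "a n \<in> borel_measurable M" using i n by simp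
  have [measurable]: "(\<lambda>s. restrict (\<lambda>i. a i s) J) \<in> M \<rightarrow>\<^sub>M Pi\<^sub>M J (\<lambda>_. borel)"
    using n i by (intro measurable_restrict) auto
  define f :: "('i \<Rightarrow> real) \<times> real \<Rightarrow> ennreal" where "f p = (if ereal (snd p) = R (fst p) then 1 else 0)" for p
  have f[measurable]: "f \<in> borel_measurable (Pi\<^sub>M J (\<lambda>_. borel) \<Otimes>\<^sub>M borel)"
    unfolding f_def by measurable
  have "(\<integral>\<^sup>+s. f (restrict (\<lambda>i. a i s) J, a n s) \<partial>M)
    = (\<integral>\<^sup>+z. (\<integral>\<^sup>+s. f (restrict (\<lambda>i. a i s) J, z) \<partial>M) \<partial>std_gauss)"
    using indep_vars_nn_integral_split[OF M i(1) n f] i(3) n by simp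
  also have "\<dots> = (\<integral>\<^sup>+s. (\<integral>\<^sup>+z. f (restrict (\<lambda>i. a i s) J, z) \<partial>std_gauss) \<partial>M)"
    by (rule MG.Fubini') (simp cong: measurable_cong_sets)
  also have "\<dots> = (\<integral>\<^sup>+s. 0 \<partial>M)"
  proof (rule nn_integral_cong)
    fix s
    define e where "e = R (restrict (\<lambda>i. a i s) J)"
    have "AE z in lborel. z \<noteq> real_of_ereal e" by (rule AE_lborel_singleton)
    then have "AE z in lborel. ennreal (std_normal_density z) * (if ereal z = e then 1 else 0) = 0"
      by (rule AE_mp) (rule AE_I2, auto)
    then have "(\<integral>\<^sup>+z. (if ereal z = e then 1 else 0) \<partial>std_gauss) = 0"
      by (subst nn_integral_density) (auto simp: nn_integral_0_iff_AE)
    then show "(\<integral>\<^sup>+z. f (restrict (\<lambda>i. a i s) J, z) \<partial>std_gauss) = 0"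
      by (simp add: f_def e_def)
  qed
  finally have "(\<integral>\<^sup>+s. f (restrict (\<lambda>i. a i s) J, a n s) \<partial>M) = 0" by simp
  then have "AE s in M. f (restrict (\<lambda>i. a i s) J, a n s) = 0"
    by (subst (asm) nn_integral_0_iff_AE) auto
  then show ?thesis by eventually_elim (auto simp: f_def split: if_splits)
qed

section \<open>Sign changes along a mesh\<close>

definition mesh :: "real \<Rightarrow> real \<Rightarrow> nat \<Rightarrow> nat \<Rightarrow> real" where
  "mesh u v N i = u + (v - u) * real i / real N"

definition sign_changes :: "(real \<Rightarrow> real) \<Rightarrow> real \<Rightarrow> real \<Rightarrow> nat \<Rightarrow> nat set" where
  "sign_changes G u v N = {i. i < N \<and> G (mesh u v N i) * G (mesh u v N (Suc i)) < 0}"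

lemma mesh_mono:
  assumes "u < v" "N > 0"
  shows "i < j \<Longrightarrow> mesh u v N i < mesh u v N j" "i \<le> j \<Longrightarrow> mesh u v N i \<le> mesh u v N j"
  using assms by (auto simp: mesh_def divide_strict_right_mono divide_right_mono)

lemma mesh_end: "N > 0 \<Longrightarrow> mesh u v N 0 = u" "N > 0 \<Longrightarrow> mesh u v N N = v"
  by (auto simp: mesh_def)

lemma IVT_sign:
  fixes G :: "real \<Rightarrow> real"
  assumes "continuous_on UNIV G" "a < b" "G a * G b < 0"
  shows "\<exists>x. a < x \<and> x < b \<and> G x = 0"
proof -
  have c: "continuous_on {a..b} G" using assms(1) continuous_on_subset by blast
  have "\<exists>x\<ge>a. x \<le> b \<and> G x = 0"
  proof (cases "G a < 0")
    case True
    then show ?thesis using assms IVT'[of G a 0 b] c by (auto simp: mult_less_0_iff)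
  next
    case False
    then show ?thesis using assms IVT2'[of G b 0 a] c by (auto simp: mult_less_0_iff)
  qed
  then obtain x where "a \<le> x" "x \<le> b" "G x = 0" by blast
  moreover from this assms(3) have "x \<noteq> a" "x \<noteq> b" by auto
  ultimately show ?thesis by (intro exI[of _ x]) auto
qed

text \<open>
  Every sign change is witnessed by a zero in its own open mesh cell.
\<close>

lemma sign_changes_le_zeros:
  assumes G: "continuous_on UNIV G" and uv: "u < v"
  shows "of_nat (card (sign_changes G u v N)) \<le> emeasure (count_space UNIV) ({x. G x = 0} \<inter> {u<..<v})"
proof (cases "N = 0")
  case True then show ?thesis by (simp add: sign_changes_def)
next
  case False
  then have N: "N > 0" by simp
  have "\<forall>i\<in>sign_changes G u v N. \<exists>x. mesh u v N i < x \<and> x < mesh u v N (Suc i) \<and> G x = 0"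
    using IVT_sign[OF G] mesh_mono(1)[OF uv N] by (auto simp: sign_changes_def)
  then obtain z where z: "\<And>i. i \<in> sign_changes G u v N \<Longrightarrow> mesh u v N i < z i \<and> z i < mesh u v N (Suc i) \<and> G (z i) = 0"
    by metis
  have fin: "finite (sign_changes G u v N)" by (simp add: sign_changes_def)
  have lt: "z i < z j" if "i \<in> sign_changes G u v N" "j \<in> sign_changes G u v N" "i < j" for i j
    using z[OF that(1)] z[OF that(2)] mesh_mono(2)[OF uv N, of "Suc i" j] that(3) by linarith
  have inj: "inj_on z (sign_changes G u v N)"
    by (rule inj_onI) (metis lt linorder_neqE_nat less_irrefl)
  have sub: "z ` sign_changes G u v N \<subseteq> {x. G x = 0} \<inter> {u<..<v}"
  proof safe
    fix i assume i: "i \<in> sign_changes G u v N"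
    then have "Suc i \<le> N" by (auto simp: sign_changes_def)
    then show "z i \<in> {u<..<v}"
      using z[OF i] mesh_mono(2)[OF uv N, of 0 i] mesh_mono(2)[OF uv N, of "Suc i" N] mesh_end[OF N] by force
  qed (use z in auto)
  have "of_nat (card (sign_changes G u v N)) = emeasure (count_space UNIV) (z ` sign_changes G u v N)"
    using fin inj by (simp add: card_image)
  also have "\<dots> \<le> emeasure (count_space UNIV) ({x. G x = 0} \<inter> {u<..<v})"
    by (rule emeasure_mono[OF sub]) simp
  finally show ?thesis .
qed

lemma discrete_sign_change:
  fixes f :: "nat \<Rightarrow> real"
  assumes "p < q" "f p * f q < 0" "\<And>i. f i \<noteq> 0"
  shows "\<exists>i\<ge>p. i < q \<and> f i * f (Suc i) < 0"
  using assms(1,2)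
proof (induction "q - p" arbitrary: p rule: less_induct)
  case less
  show ?case
  proof (cases "f p * f (Suc p) < 0")
    case True then show ?thesis using less.prems by auto
  next
    case False
    then have *: "f (Suc p) * f q < 0"
      using less.prems assms(3)[of p] assms(3)[of "Suc p"] by (auto simp: mult_less_0_iff)
    then have "Suc p < q" using less.prems by (metis Suc_lessI less_asym mult_less_0_iff)
    then obtain i where "i \<ge> Suc p" "i < q" "f i * f (Suc i) < 0" using less.hyps[of "Suc p"] * less.prems by (metis diff_less_mono2 lessI)
    then show ?thesis by (intro exI[of _ i]) auto
  qed
qed

lemma mesh_approx:
  assumes "u < y" "y < v" "N > 0"
  shows "\<exists>i<N. \<bar>mesh u v N i - y\<bar> \<le> (v - u) / real N"
proof -
  define t where "t = (y - u) / (v - u) * real N"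
  have t: "0 \<le> t" "t < real N" using assms by (auto simp: t_def field_simps)
  define i where "i = nat \<lfloor>t\<rfloor>"
  have i: "real i \<le> t" "t < real i + 1" using t by (auto simp: i_def)
  have "i < N" using i t by linarith
  moreover have "y - mesh u v N i = (v - u) / real N * (t - real i)"
    using assms by (simp add: mesh_def t_def field_simps)
  moreover have "\<bar>(v - u) / real N * (t - real i)\<bar> \<le> (v - u) / real N * 1"
    unfolding abs_mult using i assms by (intro mult_mono) auto
  ultimately show ?thesis by (intro exI[of _ i]) (simp add: abs_minus_commute)
qed

text \<open>
  Both signs persist on small intervals around \<open>y\<close> and \<open>z\<close>, which a fine mesh cannot miss; somewhere between
  the two mesh points the sign has to change.
\<close>

lemma eventually_sign_change_near:
  assumes G: "continuous_on UNIV G" and uv: "u < v" and nz: "\<And>N i. G (mesh u v N i) \<noteq> 0"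
    and y: "u < y" "y < v" "\<bar>y - x\<bar> < \<delta>" "G y < 0" and z: "u < z" "z < v" "\<bar>z - x\<bar> < \<delta>" "G z > 0"
  shows "eventually (\<lambda>N. \<exists>i\<in>sign_changes G u v N. \<bar>mesh u v N i - x\<bar> < \<delta>) sequentially"
proof -
  have "open {t. \<bar>t - x\<bar> < \<delta> \<and> G t < 0}" "open {t. \<bar>t - x\<bar> < \<delta> \<and> G t > 0}"
    using G by (auto intro!: open_Collect_conj open_Collect_less continuous_intros)
  then obtain e1 e2 where e: "e1 > 0" "e2 > 0"
    "ball y e1 \<subseteq> {t. \<bar>t - x\<bar> < \<delta> \<and> G t < 0}" "ball z e2 \<subseteq> {t. \<bar>t - x\<bar> < \<delta> \<and> G t > 0}"
    using y z unfolding open_contains_ball by (metis (mono_tags, lifting) mem_Collect_eq)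
  have "((\<lambda>N. (v - u) / real N) \<longlongrightarrow> 0) sequentially" by real_asymp
  then have "eventually (\<lambda>N. (v - u) / real N < min e1 e2) sequentially"
    using e by (intro order_tendstoD) auto
  with eventually_gt_at_top[of 0] show ?thesis
  proof eventually_elim
    case (elim N)
    note m = mesh_mono[OF uv elim(1)]
    obtain p where p: "p < N" "\<bar>mesh u v N p - y\<bar> \<le> (v - u) / real N" using mesh_approx[OF y(1,2) elim(1)] by blast
    obtain q where q: "q < N" "\<bar>mesh u v N q - z\<bar> \<le> (v - u) / real N" using mesh_approx[OF z(1,2) elim(1)] by blast
    have "mesh u v N p \<in> ball y e1" "mesh u v N q \<in> ball z e2"
      using p q elim(2) by (auto simp: dist_real_def abs_minus_commute)
    then have P: "\<bar>mesh u v N p - x\<bar> < \<delta>" "G (mesh u v N p) < 0" "\<bar>mesh u v N q - x\<bar> < \<delta>" "G (mesh u v N q) > 0"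
      using e by auto
    have neg: "G (mesh u v N p) * G (mesh u v N q) < 0" using P by (simp add: mult_neg_pos)
    have "\<exists>i\<ge>min p q. i < max p q \<and> G (mesh u v N i) * G (mesh u v N (Suc i)) < 0"
    proof (rule discrete_sign_change)
      show "min p q < max p q" using P by (cases p q rule: linorder_cases) auto
      show "G (mesh u v N (min p q)) * G (mesh u v N (max p q)) < 0" using neg by (auto simp: min_def max_def mult.commute)
    qed (rule nz)
    then obtain i where i: "i \<ge> min p q" "i < max p q" "G (mesh u v N i) * G (mesh u v N (Suc i)) < 0" by blast
    have "mesh u v N (min p q) \<le> mesh u v N i" "mesh u v N i \<le> mesh u v N (max p q)" using m(2) i by auto
    moreover have "\<bar>mesh u v N (min p q) - x\<bar> < \<delta>" "\<bar>mesh u v N (max p q) - x\<bar> < \<delta>" using P by (auto simp: min_def max_def)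
    ultimately have "\<bar>mesh u v N i - x\<bar> < \<delta>" by linarith
    moreover have "i < N" using i(2) p(1) q(1) by linarith
    ultimately show ?case using i(3) by (auto simp: sign_changes_def intro!: bexI[of _ i])
  qed
qed

text \<open>
  Finitely many crossings have disjoint neighbourhoods, and a fine mesh sees a sign change in each of them.
  The argument for every finite set of zeros also covers an infinite zero set.
\<close>

lemma zeros_le_liminf_sign_changes:
  assumes G: "continuous_on UNIV G" and uv: "u < v" and nz: "\<And>N i. G (mesh u v N i) \<noteq> 0"
    and cross: "\<And>x \<delta>. G x = 0 \<Longrightarrow> \<delta> > 0 \<Longrightarrow> (\<exists>y. \<bar>y - x\<bar> < \<delta> \<and> G y < 0) \<and> (\<exists>z. \<bar>z - x\<bar> < \<delta> \<and> G z > 0)"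
  shows "emeasure (count_space UNIV) ({x. G x = 0} \<inter> {u<..<v}) \<le> liminf (\<lambda>N. of_nat (card (sign_changes G u v N)))"
    (is "emeasure _ ?Z \<le> ?L")
proof -
  have fin: "of_nat (card X) \<le> ?L" if X: "finite X" "X \<subseteq> ?Z" for X
  proof -
    obtain d where d: "d > 0" "\<And>x y. x \<in> X \<Longrightarrow> y \<in> X \<Longrightarrow> x \<noteq> y \<Longrightarrow> d \<le> \<bar>x - y\<bar>"
    proof (cases "\<exists>x\<in>X. \<exists>y\<in>X. x \<noteq> y")
      case True
      let ?D = "(\<lambda>(x,y). \<bar>x - y\<bar>) ` {p \<in> X \<times> X. fst p \<noteq> snd p}"
      have f: "finite ?D" "?D \<noteq> {}" using X True by auto
      have "Min ?D \<in> ?D" using Min_in[OF f] .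
      then have pos: "Min ?D > 0" by force
      have le: "Min ?D \<le> \<bar>x - y\<bar>" if "x \<in> X" "y \<in> X" "x \<noteq> y" for x y
        by (rule Min_le[OF f(1)]) (use that in force)
      show ?thesis by (rule that[OF pos le])
    next
      case False then show ?thesis using that[of 1] by auto
    qed
    have ev: "eventually (\<lambda>N. \<exists>i\<in>sign_changes G u v N. \<bar>mesh u v N i - x\<bar> < d / 2) sequentially" if x: "x \<in> X" for x
    proof -
      have x': "G x = 0" "u < x" "x < v" using x X by auto
      define e where "e = min (d/2) (min (x - u) (v - x))"
      have e: "e > 0" using d x' by (auto simp: e_def)
      obtain y z where "\<bar>y - x\<bar> < e" "G y < 0" "\<bar>z - x\<bar> < e" "G z > 0" using cross[OF x'(1) e] by blast
      then show ?thesis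
        by (intro eventually_sign_change_near[OF G uv nz, of y _ _ z]) (auto simp: e_def)
    qed
    have "eventually (\<lambda>N. \<forall>x\<in>X. \<exists>i\<in>sign_changes G u v N. \<bar>mesh u v N i - x\<bar> < d / 2) sequentially"
      using ev X(1) by (simp add: eventually_ball_finite)
    then have "eventually (\<lambda>N. of_nat (card X) \<le> (of_nat (card (sign_changes G u v N)) :: ennreal)) sequentially"
    proof eventually_elim
      case (elim N)
      then obtain f where f: "\<And>x. x \<in> X \<Longrightarrow> f x \<in> sign_changes G u v N" "\<And>x. x \<in> X \<Longrightarrow> \<bar>mesh u v N (f x) - x\<bar> < d / 2"
        by metis
      have "inj_on f X"
      proof (rule inj_onI, rule ccontr)
        fix x y assume xy: "x \<in> X" "y \<in> X" "f x = f y" "x \<noteq> y"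
        show False using f(2)[OF xy(1)] f(2)[OF xy(2)] d(2)[OF xy(1,2,4)] xy(3) by (auto simp: abs_if split: if_splits)
      qed
      then have "card X \<le> card (sign_changes G u v N)"
        using f(1) by (intro card_inj_on_le[of f]) (auto simp: sign_changes_def)
      then show ?case by simp
    qed
    then show ?thesis by (rule Liminf_bounded)
  qed
  show ?thesis
  proof (cases "finite ?Z")
    case True then show ?thesis using fin[OF True] by simp
  next
    case False
    have "of_nat k \<le> ?L" for k
      using infinite_arbitrarily_large[OF False, of k] fin by metis
    then have "?L = top" by (metis ennreal_SUP_of_nat_eq_top SUP_least top.extremum_uniqueI)
    then show ?thesis by simp
  qed
qed

section \<open>Zeros of a Gaussian series\<close>

text \<open>
  The maximum over an interval is not visibly measurable in a parameter, whereas the supremum over its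
  rational points is.
\<close>

lemma SUP_rationals_eq_max:
  fixes H :: "real \<Rightarrow> real"
  assumes x: "p < x" "x < q" and H: "continuous_on {p..q} H" and max: "\<And>t. t \<in> {p..q} \<Longrightarrow> H t \<le> H x"
  shows "(SUP t\<in>{p..q} \<inter> \<rat>. ereal (H t)) = ereal (H x)"
proof (rule antisym)
  show "(SUP t\<in>{p..q} \<inter> \<rat>. ereal (H t)) \<le> ereal (H x)"
    by (rule SUP_least) (use max in auto)
  show "ereal (H x) \<le> (SUP t\<in>{p..q} \<inter> \<rat>. ereal (H t))"
    unfolding le_SUP_iff
  proof (intro allI impI)
    fix y assume "y < ereal (H x)"
    then obtain c where c: "y \<le> ereal c" "c < H x"
    proof (cases y)
      case (real r) then show ?thesis using that[of r] \<open>y < ereal (H x)\<close> by simp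
    next
      case MInf then show ?thesis using that[of "H x - 1"] by simp
    qed (use \<open>y < ereal (H x)\<close> in simp)
    have "isCont H x" using x continuous_on_interior[OF H] by auto
    then have "eventually (\<lambda>t. c < H t) (at x)" using c(2) unfolding isCont_def by (rule order_tendstoD)
    then obtain e where e: "e > 0" "\<And>t. t \<noteq> x \<Longrightarrow> dist t x < e \<Longrightarrow> c < H t"
      unfolding eventually_at by auto
    obtain t where t: "t \<in> \<rat>" "max p (x - e) < t" "t < x"
      using Rats_dense_in_real[of "max p (x - e)" x] x e by auto
    have "c < H t" using t by (intro e(2)) (auto simp: dist_real_def)
    then show "\<exists>i\<in>{p..q} \<inter> \<rat>. y < ereal (H i)" using t x c by (intro bexI[of _ t]) (auto intro: le_less_trans)
  qed
qed

lemma INF_rationals_eq_min: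
  fixes H :: "real \<Rightarrow> real"
  assumes x: "p < x" "x < q" and H: "continuous_on {p..q} H" and min: "\<And>t. t \<in> {p..q} \<Longrightarrow> H x \<le> H t"
  shows "(INF t\<in>{p..q} \<inter> \<rat>. ereal (H t)) = ereal (H x)"
proof -
  have "(SUP t\<in>{p..q} \<inter> \<rat>. ereal (- H t)) = ereal (- H x)"
    by (rule SUP_rationals_eq_max[OF x]) (use H min in \<open>auto intro!: continuous_intros\<close>)
  moreover have "(SUP t\<in>{p..q} \<inter> \<rat>. ereal (- H t)) = - (INF t\<in>{p..q} \<inter> \<rat>. ereal (H t))"
    using ereal_SUP_uminus_eq[of "\<lambda>t. ereal (H t)"] by simp
  ultimately show ?thesis by (metis ereal_uminus_uminus uminus_ereal.simps(1))
qed

text \<open>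
  The series may converge only conditionally, so the index sets \<open>A N\<close> fix the order of summation. Each \<open>x\<close> needs some
  \<open>g n x \<noteq> 0\<close>, since otherwise \<open>x\<close> would be a zero almost surely.
\<close>

locale gaussian_series = prob_space M for M :: "'s measure" +
  fixes I :: "'i set" and a :: "'i \<Rightarrow> 's \<Rightarrow> real" and A :: "nat \<Rightarrow> 'i set" and g :: "'i \<Rightarrow> real \<Rightarrow> real"
  assumes iid: "iid_std_normal M I a"
    and A_mono: "mono A" and A_finite: "\<And>k. finite (A k)" and A_Union: "(\<Union>k. A k) = I"
    and g_cont: "\<And>n. n \<in> I \<Longrightarrow> continuous_on UNIV (g n)"
    and g_nonzero: "\<And>x. \<exists>n\<in>I. g n x \<noteq> 0"
    and continuous_sum: "AE s in M. (\<forall>x. convergent (\<lambda>N. \<Sum>n\<in>A N. a n s * g n x)) \<and>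
      continuous_on UNIV (\<lambda>x. lim (\<lambda>N. \<Sum>n\<in>A N. a n s * g n x))"
begin

definition F :: "'s \<Rightarrow> real \<Rightarrow> real" where
  "F s x = lim (\<lambda>N. \<Sum>n\<in>A N. a n s * g n x)"

text \<open>
  The series without its \<open>n\<close>-th term, as a function of the coefficients: evaluated at the \<open>a i\<close> with \<open>i \<noteq> n\<close> it is
  independent of \<open>a n\<close>.
\<close>

definition rest :: "'i \<Rightarrow> ('i \<Rightarrow> real) \<Rightarrow> real \<Rightarrow> real" where
  "rest n b x = lim (\<lambda>N. \<Sum>m\<in>A N - {n}. b m * g m x)"

lemma A_subset: "A k \<subseteq> I" using A_Union by blast

lemma countable_I: "countable I"
  unfolding A_Union[symmetric] by (intro countable_UN) (auto intro: countable_finite A_finite)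

lemma a_measurable [measurable]: "n \<in> I \<Longrightarrow> a n \<in> borel_measurable M"
  using iid_std_normalD(2)[OF prob_space_axioms iid] by blast

lemma partial_sum_measurable [measurable]: "(\<lambda>s. \<Sum>n\<in>A N. a n s * g n x) \<in> borel_measurable M"
proof (rule borel_measurable_sum)
  fix n assume "n \<in> A N"
  then have [measurable]: "a n \<in> borel_measurable M" using A_subset by (intro a_measurable) auto
  show "(\<lambda>s. a n s * g n x) \<in> borel_measurable M" by measurable
qed

lemma F_measurable [measurable]: "(\<lambda>s. F s x) \<in> borel_measurable M"
  unfolding F_def by (rule borel_measurable_lim_metric) measurable

lemma rest_measurable: "(\<lambda>b. rest n b x) \<in> borel_measurable (Pi\<^sub>M (I - {n}) (\<lambda>_. borel))"
  unfolding rest_def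
proof (rule borel_measurable_lim_metric, rule borel_measurable_sum)
  fix N m assume "m \<in> A N - {n}"
  then have "m \<in> I - {n}" using A_subset by auto
  then have [measurable]: "(\<lambda>b. b m) \<in> borel_measurable (Pi\<^sub>M (I - {n}) (\<lambda>_. borel :: real measure))"
    by (rule measurable_component_singleton)
  show "(\<lambda>b. b m * g m x) \<in> borel_measurable (Pi\<^sub>M (I - {n}) (\<lambda>_. borel))" by measurable
qed

lemma F_eq_rest:
  assumes conv: "convergent (\<lambda>N. \<Sum>n\<in>A N. a n s * g n x)" and n: "n \<in> I"
  shows "rest n (restrict (\<lambda>i. a i s) (I - {n})) x = F s x - a n s * g n x"
proof -
  obtain k where k: "n \<in> A k" using n A_Union by auto
  have "(\<lambda>N. \<Sum>m\<in>A N. a m s * g m x) \<longlonglongrightarrow> F s x"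
    unfolding F_def using conv by (simp add: convergent_LIMSEQ_iff)
  then have "(\<lambda>N. (\<Sum>m\<in>A N. a m s * g m x) - a n s * g n x) \<longlonglongrightarrow> F s x - a n s * g n x"
    by (intro tendsto_intros)
  moreover have "eventually (\<lambda>N. (\<Sum>m\<in>A N. a m s * g m x) - a n s * g n x
      = (\<Sum>m\<in>A N - {n}. restrict (\<lambda>i. a i s) (I - {n}) m * g m x)) sequentially"
    using eventually_ge_at_top[of k]
  proof eventually_elim
    case (elim N)
    then have "n \<in> A N" using k monoD[OF A_mono elim] by auto
    then have "(\<Sum>m\<in>A N. a m s * g m x) = a n s * g n x + (\<Sum>m\<in>A N - {n}. a m s * g m x)"
      by (rule sum.remove[OF A_finite])
    moreover have "(\<Sum>m\<in>A N - {n}. restrict (\<lambda>i. a i s) (I - {n}) m * g m x) = (\<Sum>m\<in>A N - {n}. a m s * g m x)"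
      using A_subset by (intro sum.cong) auto
    ultimately show ?case by simp
  qed
  ultimately have "(\<lambda>N. \<Sum>m\<in>A N - {n}. restrict (\<lambda>i. a i s) (I - {n}) m * g m x) \<longlonglongrightarrow> F s x - a n s * g n x"
    by (rule Lim_transform_eventually)
  then show ?thesis unfolding rest_def by (rule limI)
qed

lemma AE_F_nonzero: "AE s in M. F s x \<noteq> 0"
proof -
  obtain n where n: "n \<in> I" "g n x \<noteq> 0" using g_nonzero by blast
  have "AE s in M. ereal (a n s) \<noteq> (\<lambda>b. ereal (- rest n b x / g n x)) (restrict (\<lambda>i. a i s) (I - {n}))"
  proof (rule AE_gauss_avoids[OF prob_space_axioms iid])
    note [measurable] = rest_measurable
    show "(\<lambda>b. ereal (- rest n b x / g n x)) \<in> borel_measurable (Pi\<^sub>M (I - {n}) (\<lambda>_. borel))"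
      by measurable
  qed (use n in auto)
  with continuous_sum show ?thesis
  proof eventually_elim
    case (elim s)
    then show ?case using F_eq_rest[of s x n] n by auto
  qed
qed

text \<open>
  Near a zero at \<open>x\<close> choose \<open>n\<close> with \<open>g n x \<noteq> 0\<close>. There \<open>F / g n = a n - H\<close> with \<open>H\<close> independent of \<open>a n\<close>. If \<open>F\<close> does
  not change sign at \<open>x\<close>, then \<open>a n\<close> is the maximum or the minimum of \<open>H\<close> over some interval with rational
  end points, which has probability zero. There are countably many such intervals.
\<close>

lemma AE_no_touching:
  "AE s in M. \<forall>x \<delta>. F s x = 0 \<longrightarrow> \<delta> > 0 \<longrightarrow> (\<exists>y. \<bar>y - x\<bar> < \<delta> \<and> F s y < 0) \<and> (\<exists>z. \<bar>z - x\<bar> < \<delta> \<and> F s z > 0)"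
proof -
  define H where "H n b t = - rest n b t / g n t" for n b t
  have Hm: "(\<lambda>b. ereal (H n b t)) \<in> borel_measurable (Pi\<^sub>M (I - {n}) (\<lambda>_. borel))" for n t
  proof -
    note [measurable] = rest_measurable
    show ?thesis unfolding H_def by measurable
  qed
  have cr: "countable (S \<inter> \<rat>)" for S :: "real set" using countable_rat by blast
  have 1: "AE s in M. ereal (a n s) \<noteq> (\<lambda>b. SUP t\<in>{p..q} \<inter> \<rat>. ereal (H n b t)) (restrict (\<lambda>i. a i s) (I - {n}))"
    if "n \<in> I" for n p q
    by (rule AE_gauss_avoids[OF prob_space_axioms iid]) (use that in \<open>auto intro!: borel_measurable_SUP cr Hm\<close>)
  have 2: "AE s in M. ereal (a n s) \<noteq> (\<lambda>b. INF t\<in>{p..q} \<inter> \<rat>. ereal (H n b t)) (restrict (\<lambda>i. a i s) (I - {n}))"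
    if "n \<in> I" for n p q
    by (rule AE_gauss_avoids[OF prob_space_axioms iid]) (use that in \<open>auto intro!: borel_measurable_INF cr Hm\<close>)
  have "AE s in M. \<forall>n\<in>I. \<forall>p\<in>\<rat>. \<forall>q\<in>\<rat>.
      ereal (a n s) \<noteq> (SUP t\<in>{p..q} \<inter> \<rat>. ereal (H n (restrict (\<lambda>i. a i s) (I - {n})) t)) \<and>
      ereal (a n s) \<noteq> (INF t\<in>{p..q} \<inter> \<rat>. ereal (H n (restrict (\<lambda>i. a i s) (I - {n})) t))"
    using 1 2 by (simp add: AE_ball_countable countable_I countable_rat)
  with continuous_sum show ?thesis
  proof eventually_elim
    case (elim s)
    let ?b = "\<lambda>n. restrict (\<lambda>i. a i s) (I - {n})"
    have Fc: "continuous_on UNIV (F s)" using elim(1) by (simp add: F_def[abs_def])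
    have HE: "H n (?b n) t = a n s - F s t / g n t" if "n \<in> I" "g n t \<noteq> 0" for n t
      using F_eq_rest[of s t n] elim(1) that by (simp add: H_def field_simps)
    have main: "\<not> ((\<forall>y. \<bar>y - x\<bar> < \<delta> \<longrightarrow> 0 \<le> F s y) \<or> (\<forall>y. \<bar>y - x\<bar> < \<delta> \<longrightarrow> F s y \<le> 0))"
      if x: "F s x = 0" and \<delta>: "\<delta> > 0" for x \<delta>
    proof
      assume sg: "(\<forall>y. \<bar>y - x\<bar> < \<delta> \<longrightarrow> 0 \<le> F s y) \<or> (\<forall>y. \<bar>y - x\<bar> < \<delta> \<longrightarrow> F s y \<le> 0)"
      obtain n where n: "n \<in> I" "g n x \<noteq> 0" using g_nonzero by blast
      have "isCont (g n) x" using g_cont[OF n(1)] by (simp add: continuous_on_eq_continuous_at)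
      then have "((\<lambda>t. g n t * g n x) \<longlongrightarrow> g n x * g n x) (at x)" unfolding isCont_def by (intro tendsto_intros)
      moreover have "0 < g n x * g n x" using n by (auto simp: zero_less_mult_iff)
      ultimately have "eventually (\<lambda>t. 0 < g n t * g n x) (at x)" by (rule order_tendstoD)
      then obtain e where e: "e > 0" "\<And>t. t \<noteq> x \<Longrightarrow> dist t x < e \<Longrightarrow> 0 < g n t * g n x"
        unfolding eventually_at by auto
      have gs: "0 < g n t * g n x" if "\<bar>t - x\<bar> < e" for t
        using e(2)[of t] that n by (cases "t = x") (auto simp: dist_real_def zero_less_mult_iff)
      obtain p where p: "p \<in> \<rat>" "x - min \<delta> e < p" "p < x" using Rats_dense_in_real[of "x - min \<delta> e" x] e \<delta> by auto
      obtain q where q: "q \<in> \<rat>" "x < q" "q < x + min \<delta> e" using Rats_dense_in_real[of x "x + min \<delta> e"] e \<delta> by auto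
      have near: "\<bar>t - x\<bar> < \<delta>" "0 < g n t * g n x" "g n t \<noteq> 0" if "t \<in> {p..q}" for t
      proof -
        show "\<bar>t - x\<bar> < \<delta>" using that p q by auto
        have "\<bar>t - x\<bar> < e" using that p q by auto
        then show "0 < g n t * g n x" by (rule gs)
        then show "g n t \<noteq> 0" by auto
      qed
      have Hc: "continuous_on {p..q} (H n (?b n))"
      proof -
        have "continuous_on {p..q} (\<lambda>t. a n s - F s t / g n t)"
          using near(3) continuous_on_subset[OF Fc] continuous_on_subset[OF g_cont[OF n(1)]]
          by (intro continuous_intros) auto
        then show ?thesis by (rule continuous_on_eq) (use HE[OF n(1) near(3)] in simp)
      qed
      have Hx: "H n (?b n) x = a n s" using HE[OF n] x by simp
      have dich: "(\<forall>t\<in>{p..q}. 0 \<le> F s t / g n t) \<or> (\<forall>t\<in>{p..q}. F s t / g n t \<le> 0)"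
      proof (cases "g n x > 0")
        case True
        then have "\<And>t. t \<in> {p..q} \<Longrightarrow> g n t > 0" using near(2) by (metis zero_less_mult_pos2)
        then show ?thesis using sg near(1) by (meson divide_nonneg_pos divide_nonpos_pos)
      next
        case False
        then have "\<And>t. t \<in> {p..q} \<Longrightarrow> g n t < 0" using near(2) by (metis zero_less_mult_iff less_asym)
        then show ?thesis using sg near(1) by (meson divide_nonneg_neg divide_nonpos_neg)
      qed
      then show False
      proof
        assume "\<forall>t\<in>{p..q}. 0 \<le> F s t / g n t"
        then have "(SUP t\<in>{p..q} \<inter> \<rat>. ereal (H n (?b n) t)) = ereal (H n (?b n) x)"
          using HE[OF n(1) near(3)] Hx by (intro SUP_rationals_eq_max[OF p(3) q(2) Hc]) auto
        then show False using elim(2)[rule_format, OF n(1) p(1) q(1)] Hx by simp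
      next
        assume "\<forall>t\<in>{p..q}. F s t / g n t \<le> 0"
        then have "(INF t\<in>{p..q} \<inter> \<rat>. ereal (H n (?b n) t)) = ereal (H n (?b n) x)"
          using HE[OF n(1) near(3)] Hx by (intro INF_rationals_eq_min[OF p(3) q(2) Hc]) auto
        then show False using elim(2)[rule_format, OF n(1) p(1) q(1)] Hx by simp
      qed
    qed
    show ?case using main by (meson not_le)
  qed
qed

text \<open>
  Sheppard's formula for the partial sums passes to the limit by dominated convergence, because the sign of
  the product is continuous where the limit does not vanish, hence almost surely.
\<close>

lemma prob_opposite_signs:
  assumes cov: "\<And>x y. (\<lambda>N. \<Sum>n\<in>A N. g n x * g n y) \<longlonglongrightarrow> c x y"
    and pos: "\<And>x. c x x > 0"
  shows "(\<integral>\<^sup>+s. indicator {z. fst z * snd z < 0} (F s x, F s y) \<partial>M) = ennreal (arccos (c x y / sqrt (c x x * c y y)) / pi)"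
proof -
  let ?S = "\<lambda>N x s. \<Sum>n\<in>A N. a n s * g n x"
  let ?C = "\<lambda>N x y. \<Sum>n\<in>A N. g n x * g n y"
  let ?r = "\<lambda>N. ?C N x y / sqrt (?C N x x * ?C N y y)"
  note i = iid_std_normalD[OF prob_space_axioms iid]
  have d: "distr M borel (a n) = std_gauss" if "n \<in> I" for n using that by (rule i(3))
  have "(\<lambda>N. ?C N x x) \<longlonglongrightarrow> c x x" "(\<lambda>N. ?C N y y) \<longlonglongrightarrow> c y y" by (rule cov)+
  then have evpos: "eventually (\<lambda>N. ?C N x x > 0) sequentially" "eventually (\<lambda>N. ?C N y y > 0) sequentially"
    using pos by (auto intro: order_tendstoD)
  have fin: "eventually (\<lambda>N. -1 \<le> ?r N \<and> ?r N \<le> 1 \<and>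
      (\<integral>\<^sup>+s. indicator {z. fst z * snd z < 0} (?S N x s, ?S N y s) \<partial>M) = ennreal (arccos (?r N) / pi)) sequentially"
    using evpos
  proof eventually_elim
    case (elim N)
    obtain p q r where pqr: "0 \<le> p" "0 \<le> r" "p\<^sup>2 = (\<Sum>n\<in>A N. (g n x)\<^sup>2)" "p * q = ?C N x y" "q\<^sup>2 + r\<^sup>2 = (\<Sum>n\<in>A N. (g n y)\<^sup>2)"
      and law: "\<forall>h\<in>borel_measurable borel. (\<integral>\<^sup>+s. h (?S N x s, ?S N y s) \<partial>M)
       = (\<integral>\<^sup>+x. \<integral>\<^sup>+y. (h (p * x, q * x + r * y) :: ennreal) \<partial>std_gauss \<partial>std_gauss)"
      using gauss_pair_law[where J = "A N" and u = "\<lambda>n. g n x" and v = "\<lambda>n. g n y", OF prob_space_axioms i(1) d A_finite A_subset] by blast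
    have C: "p\<^sup>2 = ?C N x x" "q\<^sup>2 + r\<^sup>2 = ?C N y y" using pqr by (simp_all add: power2_eq_square)
    have p: "p > 0" using C(1) elim(1) pqr(1) by (metis less_le power_zero_numeral less_irrefl)
    have qr: "q\<^sup>2 + r\<^sup>2 > 0" using C elim by simp
    have m: "indicator {z :: real \<times> real. fst z * snd z < 0} \<in> borel_measurable (borel :: (real \<times> real) measure)"
      by (intro borel_measurable_indicator borel_open open_Collect_less continuous_intros)
    have r: "?r N = q / sqrt (q\<^sup>2 + r\<^sup>2)"
      unfolding C[symmetric] pqr(4)[symmetric] real_sqrt_mult using p by simp
    have "\<bar>q\<bar> \<le> sqrt (q\<^sup>2 + r\<^sup>2)" by (rule real_le_rsqrt) simp
    then have "\<bar>?r N\<bar> \<le> 1" unfolding r using qr by (simp add: abs_divide)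
    then have "-1 \<le> ?r N \<and> ?r N \<le> 1" by linarith
    moreover have "(\<integral>\<^sup>+s. indicator {z. fst z * snd z < 0} (?S N x s, ?S N y s) \<partial>M) = ennreal (arccos (?r N) / pi)"
      unfolding r bspec[OF law m] by (rule gauss_opposite_signs[OF p pqr(2) qr])
    ultimately show ?case by blast
  qed
  have rlim: "?r \<longlonglongrightarrow> c x y / sqrt (c x x * c y y)"
    using pos[of x] pos[of y] by (intro tendsto_intros cov) auto
  have rbound: "eventually (\<lambda>N. ?r N \<in> {-1..1}) sequentially" using fin by eventually_elim auto
  have rl: "c x y / sqrt (c x x * c y y) \<in> {-1..1}"
    by (rule Lim_in_closed_set[OF closed_atLeastAtMost rbound _ rlim]) simp
  have "(\<lambda>N. arccos (?r N)) \<longlonglongrightarrow> arccos (c x y / sqrt (c x x * c y y))"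
    by (rule continuous_on_tendsto_compose[OF continuous_on_arccos' rlim rl rbound])
  then have L1: "(\<lambda>N. ennreal (arccos (?r N) / pi)) \<longlonglongrightarrow> ennreal (arccos (c x y / sqrt (c x x * c y y)) / pi)"
    by (intro tendsto_intros) auto
  have L2: "(\<lambda>N. (\<integral>\<^sup>+s. indicator {z. fst z * snd z < 0} (?S N x s, ?S N y s) \<partial>M))
     \<longlonglongrightarrow> (\<integral>\<^sup>+s. indicator {z. fst z * snd z < 0} (F s x, F s y) \<partial>M)"
  proof (rule nn_integral_dominated_convergence[where w = "\<lambda>_. 1"])
    have ind: "(indicator {z. fst z * snd z < 0} (u, v) :: ennreal) = (if u * v < 0 then 1 else 0)" for u v :: real
      by simp
    show "(\<lambda>s. indicator {z. fst z * snd z < 0} (?S N x s, ?S N y s) :: ennreal) \<in> borel_measurable M" for N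
      unfolding ind by measurable
    show "(\<lambda>s. indicator {z. fst z * snd z < 0} (F s x, F s y) :: ennreal) \<in> borel_measurable M"
      unfolding ind by measurable
    show "AE s in M. (\<lambda>N. indicator {z. fst z * snd z < 0} (?S N x s, ?S N y s) :: ennreal)
        \<longlonglongrightarrow> indicator {z. fst z * snd z < 0} (F s x, F s y)"
      using continuous_sum AE_F_nonzero[of x] AE_F_nonzero[of y]
    proof eventually_elim
      case (elim s)
      have "(\<lambda>N. ?S N x s * ?S N y s) \<longlonglongrightarrow> F s x * F s y"
        unfolding F_def using elim(1) by (intro tendsto_mult) (auto simp: convergent_LIMSEQ_iff)
      moreover have "F s x * F s y < 0 \<or> F s x * F s y > 0" using elim by (metis linorder_neqE_linordered_idom mult_eq_0_iff)
      ultimately have "eventually (\<lambda>N. (?S N x s * ?S N y s < 0) = (F s x * F s y < 0)) sequentially"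
      proof (elim disjE)
        assume T: "(\<lambda>N. ?S N x s * ?S N y s) \<longlonglongrightarrow> F s x * F s y" and "F s x * F s y < 0"
        then show ?thesis using order_tendstoD(2)[OF T, of 0] by (auto elim: eventually_mono)
      next
        assume T: "(\<lambda>N. ?S N x s * ?S N y s) \<longlonglongrightarrow> F s x * F s y" and "F s x * F s y > 0"
        then show ?thesis using order_tendstoD(1)[OF T, of 0] by (auto elim: eventually_mono)
      qed
      then show ?case by (intro tendsto_eventually) (auto elim!: eventually_mono simp: ind)
    qed
  qed (auto simp: emeasure_space_1 split: split_indicator)
  have "eventually (\<lambda>N. ennreal (arccos (?r N) / pi) = (\<integral>\<^sup>+s. indicator {z. fst z * snd z < 0} (?S N x s, ?S N y s) \<partial>M)) sequentially"
    using fin by eventually_elim simp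
  from Lim_transform_eventually[OF L1 this] L2 show ?thesis by (rule LIMSEQ_unique[rotated])
qed

text \<open>
  The Cauchy--Schwarz inequality for the partial sums, which persists in the limit.
\<close>

lemma correlation_bounded:
  assumes cov: "\<And>x y. (\<lambda>N. \<Sum>n\<in>A N. g n x * g n y) \<longlonglongrightarrow> c x y" and pos: "\<And>x. c x x > 0"
  shows "\<bar>c x y / sqrt (c x x * c y y)\<bar> \<le> 1"
proof (rule LIMSEQ_le_const2)
  show "(\<lambda>N. \<bar>(\<Sum>n\<in>A N. g n x * g n y) / sqrt (c x x * c y y)\<bar>) \<longlonglongrightarrow> \<bar>c x y / sqrt (c x x * c y y)\<bar>"
    using pos[of x] pos[of y] by (intro tendsto_intros cov) auto
  have le: "(\<Sum>n\<in>A N. g n x * g n x) \<le> c x x" for N x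
  proof (rule incseq_le[OF _ cov])
    show "incseq (\<lambda>N. \<Sum>n\<in>A N. g n x * g n x)"
      unfolding incseq_def using monoD[OF A_mono] A_finite by (auto intro!: sum_mono2)
  qed
  have "\<bar>(\<Sum>n\<in>A N. g n x * g n y) / sqrt (c x x * c y y)\<bar> \<le> 1" for N
  proof -
    have "(\<Sum>n\<in>A N. g n x * g n y)\<^sup>2 \<le> (\<Sum>n\<in>A N. (g n x)\<^sup>2) * (\<Sum>n\<in>A N. (g n y)\<^sup>2)"
      by (rule Cauchy_Schwarz_ineq_sum)
    also have "\<dots> \<le> c x x * c y y"
      using le[of x N] le[of y N] pos[of x] by (intro mult_mono) (auto simp: power2_eq_square less_imp_le intro!: sum_nonneg)
    finally have "\<bar>\<Sum>n\<in>A N. g n x * g n y\<bar> \<le> sqrt (c x x * c y y)"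
      by (rule real_le_rsqrt[of "\<bar>_\<bar>", unfolded power2_abs])
    then show ?thesis using pos[of x] pos[of y] by (simp add: abs_divide abs_mult)
  qed
  then show "\<exists>N. \<forall>n\<ge>N. \<bar>(\<Sum>n\<in>A n. g n x * g n y) / sqrt (c x x * c y y)\<bar> \<le> 1" by blast
qed

text \<open>
  The lower limit of the sign change counts \<open>C N\<close> is the number of zeros, and each \<open>C N\<close> is at most this
  number. Fatou's lemma bounds the expectation from above by the limit of the expectations of \<open>C N\<close>, and the
  second fact bounds it from below. The number of zeros is known to be measurable only up to a null set,
  hence the representative \<open>f\<close>.
\<close>

lemma expected_zeros_interval:
  assumes cov: "\<And>x y. (\<lambda>N. \<Sum>n\<in>A N. g n x * g n y) \<longlonglongrightarrow> c x y" and pos: "\<And>x. c x x > 0"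
    and uv: "u < v"
    and L: "(\<lambda>N. ennreal (\<Sum>i<N. arccos (c (mesh u v N i) (mesh u v N (Suc i)) /
        sqrt (c (mesh u v N i) (mesh u v N i) * c (mesh u v N (Suc i)) (mesh u v N (Suc i)))) / pi)) \<longlonglongrightarrow> L"
  shows "\<exists>f\<in>borel_measurable M. (AE s in M. f s = emeasure (count_space UNIV) ({x. F s x = 0} \<inter> {u<..<v})) \<and> (\<integral>\<^sup>+s. f s \<partial>M) = L"
proof -
  define C :: "nat \<Rightarrow> 's \<Rightarrow> ennreal" where "C N s = of_nat (card (sign_changes (F s) u v N))" for N s
  let ?t = "mesh u v"
  have CE: "C N s = (\<Sum>i<N. indicator {z. fst z * snd z < 0} (F s (?t N i), F s (?t N (Suc i))))" for N s
  proof -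
    have "sign_changes (F s) u v N = {..<N} \<inter> {i. F s (?t N i) * F s (?t N (Suc i)) < 0}"
      by (auto simp: sign_changes_def)
    then show ?thesis by (simp add: C_def indicator_def sum.If_cases)
  qed
  have ind: "(indicator {z. fst z * snd z < 0} (u, v) :: ennreal) = (if u * v < 0 then 1 else 0)" for u v :: real
    by simp
  have im[measurable]: "(\<lambda>s. indicator {z. fst z * snd z < 0} (F s x, F s y) :: ennreal) \<in> borel_measurable M" for x y
    unfolding ind by measurable
  have Cm[measurable]: "C N \<in> borel_measurable M" for N
    unfolding CE[abs_def] by measurable
  have corr': "-1 \<le> c x y / sqrt (c x x * c y y)" "c x y / sqrt (c x x * c y y) \<le> 1" for x y
    using correlation_bounded[OF cov pos, of x y] by linarith+
  have EC: "(\<integral>\<^sup>+s. C N s \<partial>M) = ennreal (\<Sum>i<N. arccos (c (?t N i) (?t N (Suc i)) /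
        sqrt (c (?t N i) (?t N i) * c (?t N (Suc i)) (?t N (Suc i)))) / pi)" for N
  proof -
    have "(\<integral>\<^sup>+s. C N s \<partial>M) = (\<Sum>i<N. ennreal (arccos (c (?t N i) (?t N (Suc i)) /
        sqrt (c (?t N i) (?t N i) * c (?t N (Suc i)) (?t N (Suc i)))) / pi))"
      unfolding CE by (subst nn_integral_sum) (auto simp: prob_opposite_signs[OF cov pos] intro: im)
    also have "\<dots> = ennreal (\<Sum>i<N. arccos (c (?t N i) (?t N (Suc i)) /
        sqrt (c (?t N i) (?t N i) * c (?t N (Suc i)) (?t N (Suc i)))) / pi)"
      by (intro sum_ennreal divide_nonneg_pos arccos_lbound corr' pi_gt_zero)
    finally show ?thesis .
  qed
  let ?Z = "\<lambda>s. emeasure (count_space UNIV) ({x. F s x = 0} \<inter> {u<..<v})"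
  define f where "f s = liminf (\<lambda>N. C N s)" for s
  have [measurable]: "f \<in> borel_measurable M" unfolding f_def by measurable
  have "AE s in M. \<forall>N i. F s (?t N i) \<noteq> 0"
    using AE_F_nonzero by (simp add: AE_all_countable)
  with AE_no_touching continuous_sum have Z: "AE s in M. f s = ?Z s \<and> (\<forall>N. C N s \<le> ?Z s)"
  proof eventually_elim
    case (elim s)
    have Fc: "continuous_on UNIV (F s)" using elim(2) by (simp add: F_def[abs_def])
    have le: "C N s \<le> ?Z s" for N unfolding C_def by (rule sign_changes_le_zeros[OF Fc uv])
    have "?Z s \<le> f s" unfolding f_def C_def
      by (rule zeros_le_liminf_sign_changes[OF Fc uv]) (use elim in auto)
    moreover have "f s \<le> ?Z s"
      unfolding f_def by (rule order_trans[OF Liminf_le_Limsup Limsup_bounded]) (auto simp: le)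
    ultimately show ?case using le by (auto intro: antisym)
  qed
  have limEC: "(\<lambda>N. \<integral>\<^sup>+s. C N s \<partial>M) \<longlonglongrightarrow> L" unfolding EC by (rule L)
  have "(\<integral>\<^sup>+s. f s \<partial>M) \<le> liminf (\<lambda>N. \<integral>\<^sup>+s. C N s \<partial>M)"
    unfolding f_def by (rule nn_integral_liminf) measurable
  also have "\<dots> = L" using limEC by (intro lim_imp_Liminf) auto
  finally have "(\<integral>\<^sup>+s. f s \<partial>M) \<le> L" .
  moreover have "L \<le> (\<integral>\<^sup>+s. f s \<partial>M)"
  proof (rule LIMSEQ_le_const2[OF limEC])
    have "(\<integral>\<^sup>+s. C N s \<partial>M) \<le> (\<integral>\<^sup>+s. f s \<partial>M)" for N
      by (rule nn_integral_mono_AE) (use Z in \<open>eventually_elim, auto\<close>)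
    then show "\<exists>N. \<forall>n\<ge>N. (\<integral>\<^sup>+s. C n s \<partial>M) \<le> (\<integral>\<^sup>+s. f s \<partial>M)" by blast
  qed
  ultimately show ?thesis using Z by (intro bexI[of _ f]) (auto intro: antisym)
qed

end

section \<open>The angle between neighbouring kernels\<close>

text \<open>
  On the real line \<open>K(x, y) = |E(x)| |E(y)| phase_sinc \<phi> x y / \<pi>\<close>. The value at \<open>x = y\<close> is the continuous extension.
\<close>

definition phase_sinc :: "(real \<Rightarrow> real) \<Rightarrow> real \<Rightarrow> real \<Rightarrow> real" where
  "phase_sinc \<phi> x y = (if x = y then deriv \<phi> y else sin (\<phi> x - \<phi> y) / (x - y))"

text \<open>
  The correlation of the values of the GAF at \<open>x\<close> and \<open>y\<close>; the factors \<open>|E|\<close> and \<open>\<pi>\<close> cancel.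
\<close>

definition phase_corr :: "(real \<Rightarrow> real) \<Rightarrow> real \<Rightarrow> real \<Rightarrow> real" where
  "phase_corr \<phi> x y = phase_sinc \<phi> x y / sqrt (deriv \<phi> x * deriv \<phi> y)"

definition smooth :: "(real \<Rightarrow> real) \<Rightarrow> bool" where
  "smooth f \<longleftrightarrow> (\<forall>n. (deriv ^^ n) f differentiable_on UNIV)"

lemma smooth_deriv: "smooth f \<Longrightarrow> ((deriv ^^ n) f has_real_derivative (deriv ^^ Suc n) f x) (at x)"
  by (auto simp: smooth_def differentiable_on_def DERIV_deriv_iff_real_differentiable)

lemma smooth_cont: "smooth f \<Longrightarrow> continuous_on UNIV ((deriv ^^ n) f)"
  by (auto simp: smooth_def intro: differentiable_imp_continuous_on)

text \<open>
  The fourth derivative in \<open>t\<close> of \<open>t\<^sup>2 \<phi>'(x) \<phi>'(x + t) - sin\<^sup>2 (\<phi>(x + t) - \<phi>(x))\<close>. This difference is the numerator of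
  \<open>1 - c\<^sup>2\<close>, where \<open>c\<close> is the correlation at \<open>x\<close> and \<open>x + t\<close>.
\<close>

definition taylor_defect :: "(real \<Rightarrow> real) \<Rightarrow> real \<Rightarrow> real \<Rightarrow> real" where
  "taylor_defect \<phi> x t = (let f = (\<lambda>k. (deriv ^^ k) \<phi> (x + t)); d = 2 * (\<phi> (x + t) - \<phi> x) in
     deriv \<phi> x * (12 * f 3 + 8 * t * f 4 + t\<^sup>2 * f 5)
     - (- 8 * cos d * f 1 ^ 4 - 24 * sin d * (f 1)\<^sup>2 * f 2 + 6 * cos d * (f 2)\<^sup>2 + 8 * cos d * f 1 * f 3 + sin d * f 4))"

text \<open>
  The difference vanishes at \<open>h = 0\<close> together with its first three derivatives, so the Lagrange remainder of
  order four is all that is left. It is jointly continuous in \<open>x\<close> and \<open>t\<close>, which makes the asymptotics uniform.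
\<close>

lemma defect_taylor:
  assumes \<phi>: "smooth \<phi>" and h: "h > 0"
  shows "\<exists>t. 0 < t \<and> t < h \<and>
    h\<^sup>2 * (deriv \<phi> x * deriv \<phi> (x + h)) - (sin (\<phi> (x + h) - \<phi> x))\<^sup>2 = taylor_defect \<phi> x t / 24 * h ^ 4"
proof -
  define f where "f k t = (deriv ^^ k) \<phi> (x + t)" for k t
  define p where "p = deriv \<phi> x"
  define d where "d t = 2 * (\<phi> (x + t) - \<phi> x)" for t
  have f: "(f k has_real_derivative f (Suc k) t) (at t)" for k t
  proof -
    have "((\<lambda>t. (deriv ^^ k) \<phi> (x + t)) has_real_derivative (deriv ^^ Suc k) \<phi> (x + t) * (0 + 1)) (at t)"
      by (rule DERIV_chain2[OF smooth_deriv[OF \<phi>]]) (auto intro!: derivative_eq_intros)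
    then show ?thesis by (simp add: f_def[abs_def])
  qed
  have f0: "(\<phi> (x + t)) = f 0 t" for t by (simp add: f_def)
  define g0 g1 g2 g3 g4 g5 where g: "g0 = f 0" "g1 = f 1" "g2 = f 2" "g3 = f 3" "g4 = f 4" "g5 = f 5"
  have f': "(g0 has_real_derivative g1 t) (at t)" "(g1 has_real_derivative g2 t) (at t)"
    "(g2 has_real_derivative g3 t) (at t)" "(g3 has_real_derivative g4 t) (at t)" "(g4 has_real_derivative g5 t) (at t)" for t
    using f[of 0 t] f[of 1 t] f[of 2 t] f[of 3 t] f[of 4 t] by (simp_all add: g numeral_eq_Suc)
  have d: "(d has_real_derivative 2 * g1 t) (at t)" for t
    using DERIV_cmult[OF DERIV_diff[OF f'(1)[of t] DERIV_const[of "\<phi> x"]], of 2]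
    unfolding d_def[abs_def] f0 g(1)[symmetric] diff_0_right by assumption
  define D0 where "D0 t = t\<^sup>2 * (p * g1 t) - (1 - cos (d t)) / 2" for t
  define D1 where "D1 t = p * (2 * t * g1 t + t\<^sup>2 * g2 t) - sin (d t) * g1 t" for t
  define D2 where "D2 t = p * (2 * g1 t + 4 * t * g2 t + t\<^sup>2 * g3 t) - (2 * cos (d t) * (g1 t)\<^sup>2 + sin (d t) * g2 t)" for t
  define D3 where "D3 t = p * (6 * g2 t + 6 * t * g3 t + t\<^sup>2 * g4 t)
      - (- 4 * sin (d t) * g1 t ^ 3 + 6 * cos (d t) * g1 t * g2 t + sin (d t) * g3 t)" for t
  define D4 where "D4 t = p * (12 * g3 t + 8 * t * g4 t + t\<^sup>2 * g5 t)
     - (- 8 * cos (d t) * g1 t ^ 4 - 24 * sin (d t) * (g1 t)\<^sup>2 * g2 t + 6 * cos (d t) * (g2 t)\<^sup>2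
        + 8 * cos (d t) * g1 t * g3 t + sin (d t) * g4 t)" for t
  have 0: "(D0 has_real_derivative D1 t) (at t)" for t
    unfolding D0_def[abs_def] D1_def by (auto intro!: derivative_eq_intros f' d simp: field_simps)
  have 1: "(D1 has_real_derivative D2 t) (at t)" for t
    unfolding D1_def[abs_def] D2_def by (auto intro!: derivative_eq_intros f' d) (simp add: algebra_simps power2_eq_square)
  have 2: "(D2 has_real_derivative D3 t) (at t)" for t
    unfolding D2_def[abs_def] D3_def by (auto intro!: derivative_eq_intros f' d) (simp add: algebra_simps eval_nat_numeral)
  have 3: "(D3 has_real_derivative D4 t) (at t)" for t
    unfolding D3_def[abs_def] D4_def by (auto intro!: derivative_eq_intros f' d) (simp add: algebra_simps eval_nat_numeral)
  define diff where "diff m = (if m = 0 then D0 else if m = 1 then D1 else if m = 2 then D2 else if m = 3 then D3 else D4)" for m :: nat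
  have "\<exists>t>0. t < h \<and> D0 h = (\<Sum>m<4. diff m 0 / fact m * h ^ m) + diff 4 t / fact 4 * h ^ 4"
  proof (rule Maclaurin[OF h])
    show "\<forall>m t. m < 4 \<and> 0 \<le> t \<and> t \<le> h \<longrightarrow> (diff m has_real_derivative diff (Suc m) t) (at t)"
      using 0 1 2 3 by (auto simp: diff_def less_Suc_eq numeral_eq_Suc)
  qed (auto simp: diff_def)
  then obtain t where t: "t > 0" "t < h" "D0 h = (\<Sum>m<4. diff m 0 / fact m * h ^ m) + diff 4 t / fact 4 * h ^ 4" by blast
  have p: "g1 0 = p" "d 0 = 0" by (auto simp: g f_def p_def d_def)
  have "(\<Sum>m<4. diff m 0 / fact m * h ^ m) = 0"
    by (simp add: diff_def eval_nat_numeral D0_def D1_def D2_def D3_def p)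
  then have "D0 h = D4 t / 24 * h ^ 4" using t(3) by (simp add: diff_def fact_numeral)
  moreover have "D4 t = taylor_defect \<phi> x t" by (simp add: D4_def taylor_defect_def g f_def p_def d_def Let_def)
  moreover have "D0 h = h\<^sup>2 * (deriv \<phi> x * deriv \<phi> (x + h)) - (sin (\<phi> (x + h) - \<phi> x))\<^sup>2"
  proof -
    have "(1 - cos (d h)) / 2 = (sin (\<phi> (x + h) - \<phi> x))\<^sup>2"
      unfolding d_def cos_double_sin by simp
    then show ?thesis by (simp add: D0_def g p_def f_def)
  qed
  ultimately show ?thesis using t by auto
qed

text \<open>
  The Schwarzian derivative arises here: with \<open>f\<^sub>k\<close> for the \<open>k\<close>-th derivative of the phase at \<open>x\<close>, the value of the
  fourth derivative at \<open>t = 0\<close> is \<open>8 f\<^sub>1\<^sup>4 + 4 f\<^sub>1 f\<^sub>3 - 6 f\<^sub>2\<^sup>2\<close>.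
\<close>

lemma taylor_defect_schwarzian:
  assumes \<phi>: "smooth \<phi>" and pos: "deriv \<phi> x > 0"
  shows "taylor_defect \<phi> x 0 / (24 * (deriv \<phi> x)\<^sup>2) = (deriv \<phi> x)\<^sup>2 / 3 + schwarzian \<phi> x / 6"
proof -
  define f where "f k = (deriv ^^ k) \<phi> x" for k
  have f1: "deriv \<phi> x = f 1" by (simp add: f_def)
  have f2: "deriv (deriv \<phi>) x = f 2" by (simp add: f_def eval_nat_numeral)
  have "((\<lambda>t. deriv (deriv \<phi>) t / deriv \<phi> t) has_real_derivative (f 3 * f 1 - f 2 * f 2) / (f 1 * f 1)) (at x)"
    using smooth_deriv[OF \<phi>, of 2 x] smooth_deriv[OF \<phi>, of 1 x] pos
    by (auto intro!: derivative_eq_intros simp: f_def eval_nat_numeral)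
  then have S: "schwarzian \<phi> x = (f 3 * f 1 - f 2 * f 2) / (f 1 * f 1) - 1 / 2 * (f 2 / f 1)\<^sup>2"
    unfolding schwarzian_def f2 f1 by (simp add: DERIV_imp_deriv)
  have T: "taylor_defect \<phi> x 0 = 12 * f 1 * f 3 + 8 * f 1 ^ 4 - 6 * (f 2)\<^sup>2 - 8 * f 1 * f 3"
    by (simp add: taylor_defect_def f1 f_def[symmetric] Let_def)
  show ?thesis
    unfolding S T f1 using pos[unfolded f1] by (simp add: field_simps eval_nat_numeral)
qed

text \<open>
  The speed of the curve of normalized kernels on the unit sphere.
\<close>

definition angular_speed :: "(real \<Rightarrow> real) \<Rightarrow> real \<Rightarrow> real" where
  "angular_speed \<phi> x = sqrt ((deriv \<phi> x)\<^sup>2 / 3 + schwarzian \<phi> x / 6)"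

lemma mult_cos_le_sin:
  fixes x :: real
  assumes "0 \<le> x" "x \<le> pi / 2"
  shows "x * cos x \<le> sin x"
proof -
  have "sin 0 - 0 * cos 0 \<le> sin x - x * cos x"
  proof (rule DERIV_nonneg_imp_nondecreasing[OF assms(1), of "\<lambda>x. sin x - x * cos x"])
    fix y assume y: "0 \<le> y" "y \<le> x"
    have "((\<lambda>x. sin x - x * cos x) has_real_derivative y * sin y) (at y)"
      by (auto intro!: derivative_eq_intros)
    moreover have "y * sin y \<ge> 0" using y assms by (intro mult_nonneg_nonneg sin_ge_zero) auto
    ultimately show "\<exists>z. ((\<lambda>x. sin x - x * cos x) has_real_derivative z) (at y) \<and> 0 \<le> z" by blast
  qed
  then show ?thesis by simp
qed

text \<open>
  With \<open>\<theta> = arccos c\<close> this is \<open>sin \<theta> \<le> \<theta> \<le> tan \<theta>\<close>.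
\<close>

lemma arccos_sandwich:
  assumes "0 \<le> c" "c \<le> 1"
  shows "sqrt (1 - c\<^sup>2) \<le> arccos c" "c * arccos c \<le> sqrt (1 - c\<^sup>2)"
proof -
  have b: "0 \<le> arccos c" "arccos c \<le> pi / 2" using assms arccos_lbound[of c] arccos_le_pi2[of c] by auto
  have s: "sin (arccos c) = sqrt (1 - c\<^sup>2)" using assms by (simp add: sin_arccos)
  show "sqrt (1 - c\<^sup>2) \<le> arccos c" unfolding s[symmetric] by (rule sin_x_le_x[OF b(1)])
  show "c * arccos c \<le> sqrt (1 - c\<^sup>2)"
    unfolding s[symmetric] using mult_cos_le_sin[OF b] assms by (simp add: mult.commute)
qed

text \<open>
  By the Taylor expansion \<open>sqrt (1 - c\<^sup>2) = h V (x, t, h)\<close> for some \<open>t\<close> between \<open>0\<close> and \<open>h\<close>, with a continuous function \<open>V\<close>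
  whose value at \<open>(x, 0, 0)\<close> is the angular speed. On a compact set \<open>V\<close> is bounded and uniformly continuous, and
  \<open>arccos c\<close> differs from \<open>h V\<close> by \<open>O(h\<^sup>3)\<close>.
\<close>

lemma arccos_phase_corr_uniform:
  assumes \<phi>: "smooth \<phi>" and mono: "strict_mono \<phi>" and pos: "\<And>x. deriv \<phi> x > 0"
    and bound: "\<And>x y. (phase_corr \<phi> x y)\<^sup>2 \<le> 1" and \<epsilon>: "\<epsilon> > 0"
  shows "\<exists>\<delta>>0. \<forall>x\<in>{u..v}. \<forall>h. 0 < h \<and> h < \<delta> \<longrightarrow>
    \<bar>arccos (phase_corr \<phi> x (x + h)) - h * angular_speed \<phi> x\<bar> \<le> \<epsilon> * h"
proof -
  define p where "p = deriv \<phi>"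
  define V where "V = (\<lambda>(x,t,h). sqrt (taylor_defect \<phi> x t / (24 * (p x * p (x + h)))))"
  let ?K = "{u..v} \<times> {0..1::real} \<times> {0..1::real}"
  have ck: "continuous_on S (\<lambda>z. (deriv ^^ k) \<phi> (g z))" if "continuous_on S g" for S k and g :: "real \<times> real \<times> real \<Rightarrow> real"
    by (rule continuous_on_compose2[OF smooth_cont[OF \<phi>] that]) auto
  have c0: "continuous_on S (\<lambda>z. \<phi> (g z))" if "continuous_on S g" for S and g :: "real \<times> real \<times> real \<Rightarrow> real"
    using ck[OF that, of 0] by simp
  have c1: "continuous_on S (\<lambda>z. deriv \<phi> (g z))" if "continuous_on S g" for S and g :: "real \<times> real \<times> real \<Rightarrow> real"
    using ck[OF that, of 1] by simp
  have "p x > 0" for x using pos by (simp add: p_def)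
  then have V: "continuous_on ?K V"
    unfolding V_def taylor_defect_def Let_def p_def case_prod_beta
    by (intro continuous_intros ck c0 c1) (auto simp: less_imp_neq[OF pos, symmetric])
  have comp: "compact ?K" by (intro compact_Times compact_Icc)
  have "uniformly_continuous_on ?K V" by (rule compact_uniformly_continuous[OF V comp])
  then obtain d1 where d1: "d1 > 0" "\<And>a b. a \<in> ?K \<Longrightarrow> b \<in> ?K \<Longrightarrow> dist b a < d1 \<Longrightarrow> dist (V b) (V a) < \<epsilon> / 2"
    unfolding uniformly_continuous_on_def using \<epsilon> by (meson half_gt_zero)
  have "bounded (V ` ?K)" by (intro compact_imp_bounded compact_continuous_image V comp)
  then obtain B0 where B0: "\<And>z. z \<in> ?K \<Longrightarrow> \<bar>V z\<bar> \<le> B0" unfolding bounded_iff by auto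
  define B where "B = max 1 B0"
  have B: "B \<ge> 1" "\<And>z. z \<in> ?K \<Longrightarrow> \<bar>V z\<bar> \<le> B" using B0 by (auto simp: B_def intro: order_trans max.coboundedI2)
  have "continuous_on {u..v+1} \<phi>" using smooth_cont[OF \<phi>, of 0] continuous_on_subset by auto
  then have "uniformly_continuous_on {u..v+1} \<phi>" by (rule compact_uniformly_continuous) simp
  then obtain d2 where d2: "d2 > 0" "\<And>a b. a \<in> {u..v+1} \<Longrightarrow> b \<in> {u..v+1} \<Longrightarrow> dist b a < d2 \<Longrightarrow> dist (\<phi> b) (\<phi> a) < pi"
    unfolding uniformly_continuous_on_def using pi_gt_zero by meson
  \<comment> \<open>The four bounds make \<open>V\<close> vary by less than \<open>\<epsilon> / 2\<close>, the phase by less than \<open>\<pi>\<close> (so that \<open>c > 0\<close>), ensure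
    \<open>c \<ge> 1/2\<close>, and keep the cubic error of \<open>arccos\<close> below \<open>\<epsilon> h / 2\<close>.\<close>
  define \<delta> where "\<delta> = min (min (d1/2) d2) (min (1 / (2*B)) (\<epsilon> / (4 * B ^ 3)))"
  have "\<delta> > 0" using d1 d2 B \<epsilon> by (auto simp: \<delta>_def)
  moreover have "\<bar>arccos (phase_corr \<phi> x (x + h)) - h * angular_speed \<phi> x\<bar> \<le> \<epsilon> * h"
    if x: "x \<in> {u..v}" and h: "0 < h" "h < \<delta>" for x h
  proof -
    have hB: "h * B < 1/2" and hB3: "2 * (h * B ^ 3) < \<epsilon> / 2"
      using h B(1) by (auto simp: \<delta>_def field_simps)
    have h1: "h < 1" using mult_left_mono[OF B(1), of h] hB h(1) by linarith
    obtain t where t: "0 < t" "t < h" and def: "h\<^sup>2 * (p x * p (x + h)) - (sin (\<phi> (x + h) - \<phi> x))\<^sup>2 = taylor_defect \<phi> x t / 24 * h ^ 4"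
      using defect_taylor[OF \<phi> h(1), of x] by (auto simp: p_def)
    have K: "(x,t,h) \<in> ?K" "(x,0,0) \<in> ?K" using x t h1 h by auto
    define c where "c = phase_corr \<phi> x (x + h)"
    have pp: "p x * p (x + h) > 0" using pos by (simp add: p_def)
    have pn: "p x \<noteq> 0" "p (x + h) \<noteq> 0" using pp by auto
    have cE: "c = sin (\<phi> (x + h) - \<phi> x) / (h * sqrt (p x * p (x + h)))"
    proof -
      have "sin (\<phi> x - \<phi> (x + h)) = - sin (\<phi> (x + h) - \<phi> x)" by (metis minus_diff_eq sin_minus)
      then show ?thesis using h by (simp add: c_def phase_corr_def phase_sinc_def p_def)
    qed
    have c2: "c\<^sup>2 = (sin (\<phi> (x + h) - \<phi> x))\<^sup>2 / (h\<^sup>2 * (p x * p (x + h)))"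
      unfolding cE power_divide power_mult_distrib using pp by (simp only: real_sqrt_pow2 less_imp_le)
    define v1 where "v1 = V (x,t,h)"
    have "1 - c\<^sup>2 = (h\<^sup>2 * (p x * p (x + h)) - (sin (\<phi> (x + h) - \<phi> x))\<^sup>2) / (h\<^sup>2 * (p x * p (x + h)))"
      unfolding c2 diff_divide_distrib using pn h by simp
    also have "\<dots> = h\<^sup>2 * (taylor_defect \<phi> x t / (24 * (p x * p (x + h))))"
      unfolding def using h pn by (simp add: field_simps eval_nat_numeral)
    finally have 1: "1 - c\<^sup>2 = h\<^sup>2 * (taylor_defect \<phi> x t / (24 * (p x * p (x + h))))" .
    have \<sigma>: "sqrt (1 - c\<^sup>2) = h * v1"
      unfolding 1 real_sqrt_mult using h by (simp add: v1_def V_def)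
    have "c\<^sup>2 \<le> 1" unfolding c_def by (rule bound)
    then have v10: "v1 \<ge> 0" using \<sigma> h real_sqrt_ge_zero[of "1 - c\<^sup>2"] by (simp add: zero_le_mult_iff)
    have v1B: "v1 \<le> B" using B(2)[OF K(1)] by (simp add: v1_def)
    have 2: "1 - c\<^sup>2 = (h * v1)\<^sup>2" unfolding \<sigma>[symmetric] using \<open>c\<^sup>2 \<le> 1\<close> by simp
    have "h * v1 \<le> h * B" using v1B h by simp
    then have "(h * v1)\<^sup>2 \<le> (h * B)\<^sup>2" using h v10 by (intro power_mono) auto
    also have "\<dots> \<le> (1/2)\<^sup>2" using hB h B by (intro power_mono) auto
    finally have "c\<^sup>2 \<ge> (1/2)\<^sup>2" using 2 by (simp add: power2_eq_square)
    have "h < d2" using h by (simp add: \<delta>_def)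
    then have "dist (\<phi> (x + h)) (\<phi> x) < pi"
      by (intro d2(2)) (use x h(1) h1 in \<open>auto simp: dist_real_def\<close>)
    moreover have "\<phi> x < \<phi> (x + h)" using mono h by (simp add: strict_mono_def)
    ultimately have "sin (\<phi> (x + h) - \<phi> x) > 0" by (intro sin_gt_zero) (auto simp: dist_real_def)
    then have "c > 0" unfolding cE using h pp by simp
    then have chalf: "c \<ge> 1/2" using power2_le_imp_le[OF \<open>c\<^sup>2 \<ge> (1/2)\<^sup>2\<close>] by simp
    have c1: "c \<le> 1" using \<open>c\<^sup>2 \<le> 1\<close> power2_le_imp_le[of c 1] by simp
    define \<theta> where "\<theta> = arccos c"
    have \<theta>: "h * v1 \<le> \<theta>" "c * \<theta> \<le> h * v1"
      using arccos_sandwich[of c] \<open>c > 0\<close> c1 unfolding \<theta>_def \<sigma> by auto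
    have \<theta>0: "\<theta> \<ge> 0" using \<theta>(1) v10 h by (meson mult_nonneg_nonneg order_less_imp_le order_trans)
    have \<theta>2: "\<theta> \<le> 2 * (h * v1)"
    proof -
      have "1/2 * \<theta> \<le> c * \<theta>" using chalf \<theta>0 by (intro mult_right_mono)
      then show ?thesis using \<theta>(2) by simp
    qed
    have "1 - c \<le> 1 - c\<^sup>2" using \<open>c > 0\<close> c1 by (simp add: power2_eq_square mult_left_le)
    then have c3: "1 - c \<le> (h * v1)\<^sup>2" using 2 by simp
    have "\<theta> - h * v1 \<le> \<theta> - c * \<theta>" using \<theta>(2) by simp
    also have "\<dots> = \<theta> * (1 - c)" by (simp add: algebra_simps)
    also have "\<dots> \<le> (2 * (h * v1)) * (h * v1)\<^sup>2"
      using \<theta>2 c3 \<theta>0 c1 by (intro mult_mono) (auto simp: h(1) v10 less_imp_le)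
    also have "\<dots> = 2 * (h * v1) ^ 3" by (simp add: eval_nat_numeral)
    also have "\<dots> \<le> 2 * (h * B) ^ 3"
      using \<open>h * v1 \<le> h * B\<close> h v10 by (intro mult_left_mono power_mono) auto
    also have "\<dots> = (h * h) * (2 * (h * B ^ 3))" by (simp add: eval_nat_numeral)
    also have "\<dots> \<le> h * (\<epsilon> / 2)" using h h1 hB3 B \<epsilon> by (intro mult_mono) (auto simp: mult_left_le)
    finally have A: "\<bar>\<theta> - h * v1\<bar> \<le> h * (\<epsilon> / 2)" using \<theta>(1) by simp
    have "dist (x,t,h) (x,0,0) \<le> \<bar>t\<bar> + \<bar>h\<bar>"
      by (simp add: dist_Pair_Pair dist_real_def sqrt_sum_squares_le_sum_abs)
    also have "\<dots> < d1" using t h by (auto simp: \<delta>_def)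
    finally have "\<bar>v1 - V (x,0,0)\<bar> < \<epsilon> / 2"
      using d1(2)[OF K(2) K(1)] by (simp add: v1_def dist_real_def)
    moreover have "V (x,0,0) = angular_speed \<phi> x"
      using taylor_defect_schwarzian[OF \<phi> pos, of x] by (simp add: V_def angular_speed_def p_def power2_eq_square)
    ultimately have "\<bar>h * v1 - h * angular_speed \<phi> x\<bar> \<le> h * (\<epsilon> / 2)"
      using h by (simp add: right_diff_distrib[symmetric] abs_mult)
    moreover have "h * (\<epsilon> / 2) = \<epsilon> * h / 2" by simp
    ultimately show ?thesis using A unfolding c_def[symmetric] \<theta>_def[symmetric] by linarith
  qed
  ultimately show ?thesis by blast
qed

text \<open>
  The radicand is nonnegative because the speed is a limit of angles divided by step widths.
\<close>

lemma angular_speed_nonneg: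
  assumes "smooth \<phi>" "strict_mono \<phi>" "\<And>x. deriv \<phi> x > 0" "\<And>x y. (phase_corr \<phi> x y)\<^sup>2 \<le> 1"
  shows "0 \<le> angular_speed \<phi> x"
proof (rule field_le_epsilon)
  fix e :: real assume "e > 0"
  from arccos_phase_corr_uniform[OF assms this, of x x] obtain \<delta> where
    "\<delta> > 0" "\<forall>h. 0 < h \<and> h < \<delta> \<longrightarrow> \<bar>arccos (phase_corr \<phi> x (x + h)) - h * angular_speed \<phi> x\<bar> \<le> e * h" by auto
  then have *: "\<bar>arccos (phase_corr \<phi> x (x + \<delta>/2)) - (\<delta>/2) * angular_speed \<phi> x\<bar> \<le> e * (\<delta>/2)"
    by (metis field_sum_of_halves half_gt_zero less_add_same_cancel1)
  have "\<bar>phase_corr \<phi> x (x + \<delta>/2)\<bar> \<le> 1" using assms(4)[of x "x + \<delta>/2"] by (simp add: abs_square_le_1)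
  then have "0 \<le> arccos (phase_corr \<phi> x (x + \<delta>/2))" by (intro arccos_lbound) auto
  moreover have "(\<delta>/2) * (angular_speed \<phi> x + e) = (\<delta>/2) * angular_speed \<phi> x + e * (\<delta>/2)"
    by (simp add: algebra_simps)
  ultimately have "0 \<le> (\<delta>/2) * (angular_speed \<phi> x + e)" using * by linarith
  then show "0 \<le> angular_speed \<phi> x + e" using \<open>\<delta> > 0\<close> by (simp add: zero_le_mult_iff)
qed

lemma continuous_angular_speed:
  assumes \<phi>: "smooth \<phi>" and pos: "\<And>x. deriv \<phi> x > 0"
  shows "continuous_on UNIV (angular_speed \<phi>)"
proof -
  have "angular_speed \<phi> x = sqrt (taylor_defect \<phi> x 0 / (24 * (deriv \<phi> x)\<^sup>2))" for x
    using taylor_defect_schwarzian[OF \<phi> pos, of x] by (simp add: angular_speed_def)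
  moreover have "continuous_on UNIV (\<lambda>x. sqrt (taylor_defect \<phi> x 0 / (24 * (deriv \<phi> x)\<^sup>2)))"
    unfolding taylor_defect_def Let_def
    using smooth_cont[OF \<phi>, of 0] smooth_cont[OF \<phi>, of 1] smooth_cont[OF \<phi>]
    by (intro continuous_intros) (auto simp: less_imp_neq[OF pos, symmetric])
  ultimately show ?thesis by (simp add: fun_eq_iff[symmetric] cong: continuous_on_cong)
qed

text \<open>
  Riemann sums whose terms are linear in the step width only asymptotically: on each cell, \<open>g\<close> and the increment
  of the primitive both differ from \<open>h \<psi>\<close> by at most \<open>\<epsilon> h\<close>.
\<close>

lemma mesh_sum_tendsto:
  fixes g :: "real \<Rightarrow> real \<Rightarrow> real"
  assumes uv: "u < v" and \<psi>: "continuous_on {u..v} \<psi>"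
    and \<Psi>: "\<And>x. x \<in> {u..v} \<Longrightarrow> (\<Psi> has_real_derivative \<psi> x) (at x)"
    and g: "\<And>\<epsilon>. \<epsilon> > 0 \<Longrightarrow> \<exists>\<delta>>0. \<forall>x\<in>{u..v}. \<forall>h. 0 < h \<and> h < \<delta> \<longrightarrow> \<bar>g x (x + h) - h * \<psi> x\<bar> \<le> \<epsilon> * h"
  shows "(\<lambda>N. \<Sum>i<N. g (mesh u v N i) (mesh u v N (Suc i))) \<longlonglongrightarrow> \<Psi> v - \<Psi> u"
proof (rule LIMSEQ_I)
  fix r :: real assume r: "r > 0"
  define w where "w = v - u"
  have w: "w > 0" using uv by (simp add: w_def)
  define \<epsilon> where "\<epsilon> = r / (4 * w)"
  have \<epsilon>: "\<epsilon> > 0" using r w by (simp add: \<epsilon>_def)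
  obtain d1 where d1: "d1 > 0" "\<And>x h. x \<in> {u..v} \<Longrightarrow> 0 < h \<Longrightarrow> h < d1 \<Longrightarrow> \<bar>g x (x + h) - h * \<psi> x\<bar> \<le> \<epsilon> * h"
    using g[OF \<epsilon>] by blast
  have "uniformly_continuous_on {u..v} \<psi>" by (rule compact_uniformly_continuous[OF \<psi>]) simp
  then obtain d2 where d2: "d2 > 0" "\<And>a b. a \<in> {u..v} \<Longrightarrow> b \<in> {u..v} \<Longrightarrow> dist b a < d2 \<Longrightarrow> dist (\<psi> b) (\<psi> a) < \<epsilon>"
    unfolding uniformly_continuous_on_def using \<epsilon> by meson
  have "((\<lambda>N. (v - u) / real N) \<longlongrightarrow> 0) sequentially" by real_asymp
  then have "eventually (\<lambda>N. (v - u) / real N < min d1 d2) sequentially"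
    using d1 d2 by (intro order_tendstoD) auto
  with eventually_gt_at_top[of 0] have "eventually (\<lambda>N. norm ((\<Sum>i<N. g (mesh u v N i) (mesh u v N (Suc i))) - (\<Psi> v - \<Psi> u)) < r) sequentially"
  proof eventually_elim
    case (elim N)
    define h where "h = (v - u) / real N"
    have h: "h > 0" "h < d1" "h < d2" using elim uv by (auto simp: h_def)
    define t where "t i = mesh u v N i" for i
    have tS: "t (Suc i) = t i + h" for i by (simp add: t_def mesh_def h_def add_divide_distrib distrib_left)
    have b: "\<bar>g (t i) (t (Suc i)) - (\<Psi> (t (Suc i)) - \<Psi> (t i))\<bar> \<le> 2 * \<epsilon> * h" if i: "i < N" for i
    proof -
      have I: "u \<le> t i" "t (Suc i) \<le> v"
        using mesh_mono(2)[OF uv elim(1), of 0 i] mesh_mono(2)[OF uv elim(1), of "Suc i" N] mesh_end[OF elim(1)] i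
        by (auto simp: t_def)
      have lt: "t i < t (Suc i)" using tS h by simp
      have "\<exists>z. t i < z \<and> z < t (Suc i) \<and> \<Psi> (t (Suc i)) - \<Psi> (t i) = (t (Suc i) - t i) * \<psi> z"
        using lt by (rule MVT2) (use I \<Psi> in auto)
      then obtain z where z: "t i < z" "z < t (Suc i)" "\<Psi> (t (Suc i)) - \<Psi> (t i) = h * \<psi> z" by (auto simp: tS)
      have "dist (\<psi> z) (\<psi> (t i)) < \<epsilon>" by (rule d2(2)) (use I z tS h lt in \<open>auto simp: dist_real_def\<close>)
      then have "\<bar>h * \<psi> z - h * \<psi> (t i)\<bar> \<le> \<epsilon> * h"
        using h by (simp add: right_diff_distrib[symmetric] abs_mult dist_real_def mult.commute[of \<epsilon>])
      moreover have "\<bar>g (t i) (t (Suc i)) - h * \<psi> (t i)\<bar> \<le> \<epsilon> * h"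
        unfolding tS by (rule d1(2)) (use I lt h in auto)
      ultimately show ?thesis unfolding z(3) by linarith
    qed
    have "\<Psi> v - \<Psi> u = (\<Sum>i<N. \<Psi> (t (Suc i)) - \<Psi> (t i))"
      using sum_lessThan_telescope[of "\<lambda>i. \<Psi> (t i)" N] mesh_end[OF elim(1)] by (simp only: t_def)
    then have "\<bar>(\<Sum>i<N. g (t i) (t (Suc i))) - (\<Psi> v - \<Psi> u)\<bar> = \<bar>\<Sum>i<N. g (t i) (t (Suc i)) - (\<Psi> (t (Suc i)) - \<Psi> (t i))\<bar>"
      by (simp add: sum_subtractf)
    also have "\<dots> \<le> (\<Sum>i<N. 2 * \<epsilon> * h)"
      by (rule order_trans[OF sum_abs sum_mono]) (use b in auto)
    also have "\<dots> = 2 * \<epsilon> * w" unfolding w_def using elim(1) by (simp add: h_def)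
    also have "\<dots> = r / 2" using w by (simp add: \<epsilon>_def)
    finally show ?case using r by (simp add: t_def)
  qed
  then show "\<exists>no. \<forall>N\<ge>no. norm ((\<Sum>i<N. g (mesh u v N i) (mesh u v N (Suc i))) - (\<Psi> v - \<Psi> u)) < r"
    by (simp add: eventually_sequentially)
qed

lemma sum_arccos_tendsto:
  assumes \<phi>: "smooth \<phi>" "strict_mono \<phi>" "\<And>x. deriv \<phi> x > 0" "\<And>x y. (phase_corr \<phi> x y)\<^sup>2 \<le> 1"
    and uv: "u < v"
  shows "(\<lambda>N. ennreal (\<Sum>i<N. arccos (phase_corr \<phi> (mesh u v N i) (mesh u v N (Suc i))) / pi))
    \<longlonglongrightarrow> (\<integral>\<^sup>+x\<in>{u<..<v}. ennreal (1 / pi * angular_speed \<phi> x) \<partial>lborel)"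
proof -
  let ?\<psi> = "\<lambda>x. 1 / pi * angular_speed \<phi> x"
  note cont = continuous_angular_speed[OF \<phi>(1,3)]
  have c: "continuous_on S ?\<psi>" for S
    using continuous_on_subset[OF cont] by (intro continuous_intros) auto
  obtain \<Psi> where \<Psi>: "\<And>x. x \<in> {u-1..v+1} \<Longrightarrow> (\<Psi> has_vector_derivative ?\<psi> x) (at x within {u-1..v+1})"
    using antiderivative_continuous[OF c] by metis
  have \<Psi>': "(\<Psi> has_real_derivative ?\<psi> x) (at x)" if "x \<in> {u..v}" for x
  proof -
    have "x \<in> interior {u-1..v+1}" using that by (auto simp: interior_atLeastAtMost_real)
    then have "at x within {u-1..v+1} = at x" by (rule at_within_interior)
    moreover have "(\<Psi> has_vector_derivative ?\<psi> x) (at x within {u-1..v+1})" using that by (intro \<Psi>) auto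
    ultimately show ?thesis by (simp only: has_real_derivative_iff_has_vector_derivative)
  qed
  have "(\<lambda>N. \<Sum>i<N. arccos (phase_corr \<phi> (mesh u v N i) (mesh u v N (Suc i))) / pi) \<longlonglongrightarrow> \<Psi> v - \<Psi> u"
  proof (rule mesh_sum_tendsto[OF uv c \<Psi>'])
    fix \<epsilon> :: real assume "\<epsilon> > 0"
    then have "\<epsilon> * pi > 0" by simp
    from arccos_phase_corr_uniform[OF \<phi> this, of u v] obtain \<delta> where
      d: "\<delta> > 0" "\<forall>x\<in>{u..v}. \<forall>h. 0 < h \<and> h < \<delta> \<longrightarrow> \<bar>arccos (phase_corr \<phi> x (x + h)) - h * angular_speed \<phi> x\<bar> \<le> \<epsilon> * pi * h"
      by blast
    have "\<bar>arccos (phase_corr \<phi> x (x + h)) / pi - h * ?\<psi> x\<bar> \<le> \<epsilon> * h" if "x \<in> {u..v}" "0 < h" "h < \<delta>" for x h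
    proof -
      have "\<bar>arccos (phase_corr \<phi> x (x + h)) - h * angular_speed \<phi> x\<bar> / pi \<le> \<epsilon> * pi * h / pi"
        using d(2) that by (intro divide_right_mono) auto
      also have "\<bar>arccos (phase_corr \<phi> x (x + h)) - h * angular_speed \<phi> x\<bar> / pi = \<bar>(arccos (phase_corr \<phi> x (x + h)) - h * angular_speed \<phi> x) / pi\<bar>"
        by simp
      finally show ?thesis by (simp add: diff_divide_distrib)
    qed
    with d(1) show "\<exists>\<delta>>0. \<forall>x\<in>{u..v}. \<forall>h. 0 < h \<and> h < \<delta> \<longrightarrow>
         \<bar>arccos (phase_corr \<phi> x (x + h)) / pi - h * ?\<psi> x\<bar> \<le> \<epsilon> * h" by blast
  qed auto
  moreover have "(\<integral>\<^sup>+x\<in>{u<..<v}. ennreal (?\<psi> x) \<partial>lborel) = ennreal (\<Psi> v - \<Psi> u)"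
  proof -
    have "(\<integral>\<^sup>+x. ennreal (?\<psi> x) * indicator {u<..<v} x \<partial>lborel) = (\<integral>\<^sup>+x. ennreal (?\<psi> x) * indicator {u..v} x \<partial>lborel)"
      by (rule nn_integral_cong_AE, rule AE_mp[OF AE_lborel_singleton[of u]], rule AE_mp[OF AE_lborel_singleton[of v]], rule AE_I2)
         (auto simp: indicator_def)
    also have "\<dots> = ennreal (\<Psi> v - \<Psi> u)"
      using angular_speed_nonneg[OF \<phi>] \<Psi>' uv
      by (intro nn_integral_FTC_Icc borel_measurable_continuous_onI c) (auto simp: has_field_derivative_at_within)
    finally show ?thesis .
  qed
  ultimately show ?thesis by (simp add: tendsto_ennrealI)
qed

section \<open>From intervals to Borel sets\<close>

lemma sets_borel_Ioo: "sets borel = sigma_sets UNIV (range (\<lambda>(a, b). {a<..<b::real}))"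
proof -
  have "(borel :: real measure) = sigma UNIV (range (\<lambda>(a, b). {a<..<b}))"
    using borel_eq_box[where 'a = real] by (simp add: box_real)
  then have "sets (borel :: real measure) = sets (sigma UNIV (range (\<lambda>(a, b). {a<..<b::real})))" by (rule arg_cong)
  then show ?thesis by simp
qed

text \<open>
  The counts are measurable only up to null sets, so the Dynkin argument carries a measurable representative
  along with the identity (\<open>good\<close>). Passing to complements subtracts totals, which are finite inside the bounded
  windows \<open>W n\<close>; monotone convergence removes the windows.
\<close>

lemma expected_count_eq_density:
  fixes Z :: "'s \<Rightarrow> real set" and \<rho> :: "real \<Rightarrow> real"
  assumes \<rho>: "continuous_on UNIV \<rho>"
    and int: "\<And>u v. u < v \<Longrightarrow> \<exists>f\<in>borel_measurable M. (AE s in M. f s = emeasure (count_space UNIV) (Z s \<inter> {u<..<v})) \<and>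
        (\<integral>\<^sup>+s. f s \<partial>M) = (\<integral>\<^sup>+x\<in>{u<..<v}. ennreal (\<rho> x) \<partial>lborel)"
    and D: "D \<in> sets borel"
  shows "(\<integral>\<^sup>+s. emeasure (count_space UNIV) (Z s \<inter> D) \<partial>M) = (\<integral>\<^sup>+x\<in>D. ennreal (\<rho> x) \<partial>lborel)"
proof -
  have [measurable]: "\<rho> \<in> borel_measurable borel" using \<rho> by (rule borel_measurable_continuous_onI)
  define R where "R = density lborel (\<lambda>x. ennreal (\<rho> x))"
  have R: "emeasure R B = (\<integral>\<^sup>+x\<in>B. ennreal (\<rho> x) \<partial>lborel)" if "B \<in> sets borel" for B
    unfolding R_def using that by (subst emeasure_density) auto
  have setsR: "sets R = sets borel" by (simp add: R_def)
  let ?c = "\<lambda>B s. emeasure (count_space UNIV) (Z s \<inter> B)"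
  define good where "good B \<longleftrightarrow> (\<exists>f\<in>borel_measurable M. (AE s in M. f s = ?c B s) \<and> (\<integral>\<^sup>+s. f s \<partial>M) = emeasure R B)" for B
  define W where "W n = {- real n<..<real n}" for n :: nat
  have Wb: "W n \<in> sets borel" for n by (simp add: W_def)
  have good_empty: "good {}" unfolding good_def by (intro bexI[of _ "\<lambda>_. 0"]) auto
  have good_Ioo: "good {u<..<v}" for u v
  proof (cases "u < v")
    case True then show ?thesis using int[OF True] R[of "{u<..<v}"] unfolding good_def by simp
  next
    case False then show ?thesis using good_empty by simp
  qed
  have Wfin: "emeasure R (W n) < \<infinity>" for n
  proof -
    have "compact (\<rho> ` {- real n..real n})"
      using continuous_on_subset[OF \<rho>] by (intro compact_continuous_image) auto
    then obtain b where b: "\<And>x. x \<in> {- real n..real n} \<Longrightarrow> \<rho> x \<le> b"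
      using compact_imp_bounded bounded_iff by (metis abs_le_D1 imageI real_norm_def)
    have "emeasure R (W n) \<le> (\<integral>\<^sup>+x. ennreal b * indicator {- real n..real n} x \<partial>lborel)"
      unfolding R[OF Wb] by (intro nn_integral_mono) (auto simp: indicator_def W_def intro!: ennreal_leI b)
    also have "\<dots> = ennreal b * emeasure lborel {- real n..real n}" by (rule nn_integral_cmult_indicator) simp
    also have "\<dots> < \<infinity>" by (simp add: ennreal_mult_less_top less_top)
    finally show ?thesis .
  qed
  have gW: "good (B \<inter> W n)" if B: "B \<in> sets borel" for B n
  proof -
    have "Int_stable (range (\<lambda>(a, b). {a<..<b::real}))"
    proof (rule Int_stableI)
      fix a b assume "a \<in> range (\<lambda>(a, b). {a<..<b::real})" "b \<in> range (\<lambda>(a, b). {a<..<b::real})"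
      then obtain p q r t where "a = {p<..<q}" "b = {r<..<t}" by auto
      then have "a \<inter> b = {max p r<..<min q t}" by auto
      then show "a \<inter> b \<in> range (\<lambda>(a, b). {a<..<b::real})" by auto
    qed
    moreover have "range (\<lambda>(a, b). {a<..<b::real}) \<subseteq> Pow UNIV" by simp
    moreover have "B \<in> sigma_sets UNIV (range (\<lambda>(a, b). {a<..<b::real}))"
    proof -
      show ?thesis using B by (simp add: sets_borel_Ioo)
    qed
    ultimately show ?thesis
    proof (induction rule: sigma_sets_induct_disjoint)
      case (basic A)
      then obtain p q where "A = {p<..<q}" by auto
      then have "A \<inter> W n = {max p (- real n)<..<min q (real n)}" by (auto simp: W_def)
      then show ?case using good_Ioo by simp
    next
      case empty then show ?case using good_empty by simp
    next
      case (compl A)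
      obtain fW where fW: "fW \<in> borel_measurable M" "AE s in M. fW s = ?c (W n) s" "(\<integral>\<^sup>+s. fW s \<partial>M) = emeasure R (W n)"
        using good_Ioo[of "- real n" "real n"] unfolding good_def W_def by blast
      obtain fA where fA: "fA \<in> borel_measurable M" "AE s in M. fA s = ?c (A \<inter> W n) s" "(\<integral>\<^sup>+s. fA s \<partial>M) = emeasure R (A \<inter> W n)"
        using compl.IH unfolding good_def by blast
      have Ab: "A \<in> sets borel"
        using compl.hyps by (simp add: sets_borel_Ioo)
      have split: "?c (W n) s = ?c (A \<inter> W n) s + ?c ((UNIV - A) \<inter> W n) s" for s
        by (subst plus_emeasure) (auto intro!: arg_cong[where f="emeasure _"])
      have "AE s in M. fW s \<noteq> \<infinity>"
        by (rule nn_integral_PInf_AE[OF fW(1)]) (use Wfin[of n] fW(3) in auto)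
      with fW(2) fA(2) have AE: "AE s in M. fW s - fA s = ?c ((UNIV - A) \<inter> W n) s \<and> fA s \<le> fW s"
      proof eventually_elim
        case (elim s)
        have "fW s = fA s + ?c ((UNIV - A) \<inter> W n) s" using split[of s] elim by simp
        moreover from this have "fA s \<noteq> top" using elim by auto
        ultimately show ?case by simp
      qed
      have Rfin: "emeasure R (A \<inter> W n) \<noteq> \<infinity>"
        using Wfin[of n] emeasure_mono[of "A \<inter> W n" "W n" R] Wb setsR by (auto simp: less_top)
      have "(\<integral>\<^sup>+s. fW s - fA s \<partial>M) = emeasure R (W n) - emeasure R (A \<inter> W n)"
        using fA fW Rfin AE by (subst nn_integral_diff) auto
      also have "\<dots> = emeasure R (W n - A \<inter> W n)"
        using Wb Ab setsR Rfin by (subst emeasure_Diff) auto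
      also have "W n - A \<inter> W n = (UNIV - A) \<inter> W n" by auto
      finally show ?case unfolding good_def using AE fA(1) fW(1)
        by (intro bexI[of _ "\<lambda>s. fW s - fA s"]) auto
    next
      case (union A)
      then have "\<forall>i. \<exists>f. f \<in> borel_measurable M \<and> (AE s in M. f s = ?c (A i \<inter> W n) s) \<and> (\<integral>\<^sup>+s. f s \<partial>M) = emeasure R (A i \<inter> W n)"
        unfolding good_def by blast
      then obtain f where f: "\<And>i. f i \<in> borel_measurable M" "\<And>i. AE s in M. f i s = ?c (A i \<inter> W n) s"
        "\<And>i. (\<integral>\<^sup>+s. f i s \<partial>M) = emeasure R (A i \<inter> W n)" by metis
      have Ab: "A i \<in> sets borel" for i
        using union.hyps(2) by (auto simp: sets_borel_Ioo)
      have disj: "disjoint_family (\<lambda>i. A i \<inter> W n)" using union.hyps(1) by (auto simp: disjoint_family_on_def)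
      have un: "\<Union> (range A) \<inter> W n = (\<Union>i. A i \<inter> W n)" by auto
      have "AE s in M. \<forall>i. f i s = ?c (A i \<inter> W n) s" using f(2) by (simp add: AE_all_countable)
      then have "AE s in M. (\<Sum>i. f i s) = ?c (\<Union> (range A) \<inter> W n) s"
      proof eventually_elim
        case (elim s)
        have "(\<Sum>i. ?c (A i \<inter> W n) s) = emeasure (count_space UNIV) (\<Union>i. Z s \<inter> (A i \<inter> W n))"
          by (rule suminf_emeasure) (use disj in \<open>auto simp: disjoint_family_on_def\<close>)
        also have "(\<Union>i. Z s \<inter> (A i \<inter> W n)) = Z s \<inter> (\<Union> (range A) \<inter> W n)" by auto
        finally show ?case using elim by simp
      qed
      moreover have "(\<integral>\<^sup>+s. (\<Sum>i. f i s) \<partial>M) = emeasure R (\<Union> (range A) \<inter> W n)"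
        unfolding un nn_integral_suminf[OF f(1)] f(3)
        by (rule suminf_emeasure) (use Ab Wb setsR disj in auto)
      ultimately show ?case unfolding good_def using f(1)
        by (intro bexI[of _ "\<lambda>s. \<Sum>i. f i s"]) auto
    qed
  qed
  then have "\<forall>n. \<exists>f. f \<in> borel_measurable M \<and> (AE s in M. f s = ?c (D \<inter> W n) s) \<and> (\<integral>\<^sup>+s. f s \<partial>M) = emeasure R (D \<inter> W n)"
    using D unfolding good_def by blast
  then obtain f where f: "\<And>n. f n \<in> borel_measurable M" "\<And>n. AE s in M. f n s = ?c (D \<inter> W n) s"
    "\<And>n. (\<integral>\<^sup>+s. f n s \<partial>M) = emeasure R (D \<inter> W n)" by metis
  have incW: "incseq (\<lambda>n. B \<inter> W n)" for B by (auto simp: incseq_def W_def)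
  have unW: "(\<Union>n. B \<inter> W n) = B" for B
  proof -
    have "\<exists>n. x \<in> W n" for x
    proof -
      obtain n where "\<bar>x\<bar> < real n" using reals_Archimedean2 by blast
      then show ?thesis by (auto simp: W_def intro!: exI[of _ n])
    qed
    then show ?thesis by auto
  qed
  have all: "AE s in M. \<forall>n. f n s = ?c (D \<inter> W n) s" using f(2) by (simp add: AE_all_countable)
  have "(\<integral>\<^sup>+s. ?c D s \<partial>M) = (\<integral>\<^sup>+s. (SUP n. f n s) \<partial>M)"
  proof (rule nn_integral_cong_AE, use all in eventually_elim)
    case (elim s)
    have "(SUP n. emeasure (count_space UNIV) (Z s \<inter> D \<inter> W n)) = emeasure (count_space UNIV) (\<Union>n. Z s \<inter> D \<inter> W n)"
      by (rule SUP_emeasure_incseq) (use incW in auto)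
    then show ?case using elim unW[of "Z s \<inter> D"] by (simp add: Int_assoc)
  qed
  also have "\<dots> = (SUP n. \<integral>\<^sup>+s. f n s \<partial>M)"
  proof (rule nn_integral_monotone_convergence_SUP_AE)
    fix n show "AE s in M. f n s \<le> f (Suc n) s"
      using all by eventually_elim (auto intro!: emeasure_mono simp: W_def)
  qed (rule f(1))
  also have "\<dots> = (SUP n. emeasure R (D \<inter> W n))" by (simp add: f(3))
  also have "\<dots> = emeasure R (\<Union>n. D \<inter> W n)"
    by (rule SUP_emeasure_incseq) (use incW D Wb setsR in auto)
  also have "\<dots> = (\<integral>\<^sup>+x\<in>D. ennreal (\<rho> x) \<partial>lborel)" unfolding unW by (rule R[OF D])
  finally show ?thesis .
qed

text \<open>
  Equal densities agree almost everywhere, and a nonempty open set is not a null set.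
\<close>

lemma continuous_density_unique:
  fixes f g :: "real \<Rightarrow> real"
  assumes f: "continuous_on UNIV f" "\<And>x. 0 \<le> f x" and g: "continuous_on UNIV g" "\<And>x. 0 \<le> g x"
    and eq: "\<And>D. D \<in> sets borel \<Longrightarrow> (\<integral>\<^sup>+x\<in>D. ennreal (f x) \<partial>lborel) = (\<integral>\<^sup>+x\<in>D. ennreal (g x) \<partial>lborel)"
  shows "f = g"
proof -
  have [measurable]: "f \<in> borel_measurable borel" "g \<in> borel_measurable borel"
    using f g by (auto intro: borel_measurable_continuous_onI)
  have "density lborel (\<lambda>x. ennreal (f x)) = density lborel (\<lambda>x. ennreal (g x))"
    by (rule measure_eqI) (auto simp: emeasure_density eq)
  then have "AE x in lborel. ennreal (f x) = ennreal (g x)"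
    by (subst (asm) sigma_finite_measure.density_unique_iff[OF lborel.sigma_finite_measure_axioms]) auto
  then have AE: "AE x in lborel. f x = g x" by eventually_elim (use f g in simp)
  have op: "open {x. f x \<noteq> g x}"
    using open_Collect_neq[OF f(1) g(1)] .
  have "{x. f x \<noteq> g x} \<in> null_sets lborel"
    using AE by (subst AE_iff_null_sets) (use op in auto)
  then have "negligible {x. f x \<noteq> g x}"
    by (simp add: negligible_iff_null_sets null_sets_completionI)
  then have "{x. f x \<noteq> g x} = {}" using open_not_negligible[OF op] by blast
  then show ?thesis by auto
qed

section \<open>Monotonicity of the phase\<close>

text \<open>
  For \<open>n \<ge> 2\<close> the powers \<open>\<zeta>\<^sup>n\<close> of unit vectors in the upper half-plane leave out at most the direction of \<open>1\<close>. Unless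
  \<open>c > 0\<close>, one can thus have \<open>c \<zeta>\<^sup>n > 0\<close>; if \<open>c > 0\<close>, a power close to \<open>1\<close> will do.
\<close>

lemma unit_direction_in_upper_half_plane:
  fixes c :: complex and n :: nat
  assumes "c \<noteq> 0" "n \<ge> 2"
  shows "\<exists>\<zeta>. cmod \<zeta> = 1 \<and> Im \<zeta> > 0 \<and> Re (c * \<zeta> ^ n) > 0"
proof -
  have n: "real n \<ge> 2" using assms(2) by simp
  define \<beta> where "\<beta> = Arg c"
  have \<beta>: "-pi < \<beta>" "\<beta> \<le> pi" using Arg_bounded[of c] by (auto simp: \<beta>_def)
  obtain \<theta> where \<theta>: "0 < \<theta>" "\<theta> < pi" "cos (\<beta> + real n * \<theta>) > 0"
  proof (cases "\<beta> = 0")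
    case True
    show ?thesis
    proof (rule that[of "pi / (4 * real n)"])
      have "pi / (4 * real n) < pi / 1" using n by (intro divide_strict_left_mono) auto
      then show "pi / (4 * real n) < pi" by simp
      show "cos (\<beta> + real n * (pi / (4 * real n))) > 0" using True n by (simp add: cos_45)
    qed (use n in auto)
  next
    case False
    \<comment> \<open>Then \<open>2 \<pi> k - \<beta>\<close> lies strictly between \<open>0\<close> and \<open>2 \<pi>\<close>.\<close>
    define k :: int where "k = (if \<beta> < 0 then 0 else 1)"
    have k: "2 * pi * k - \<beta> > 0" "2 * pi * k - \<beta> < 2 * pi" using \<beta> False by (auto simp: k_def)
    show ?thesis
    proof (rule that[of "(2 * pi * k - \<beta>) / real n"])
      show "0 < (2 * pi * k - \<beta>) / real n" using k n by simp
      have "2 * pi \<le> real n * pi" using n by simp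
      then have "2 * pi * k - \<beta> < real n * pi" using k(2) by linarith
      then show "(2 * pi * k - \<beta>) / real n < pi" using n by (simp add: pos_divide_less_eq mult.commute)
      have "\<beta> + real n * ((2 * pi * k - \<beta>) / real n) = 2 * pi * k" using n by simp
      then show "cos (\<beta> + real n * ((2 * pi * k - \<beta>) / real n)) > 0" by (simp add: k_def)
    qed
  qed
  define R where "R = complex_of_real (cmod c)"
  have c: "c = R * cis \<beta>"
    using rcis_cmod_Arg[of c] by (simp add: rcis_def \<beta>_def R_def)
  have "c * cis \<theta> ^ n = R * cis (\<beta> + real n * \<theta>)"
  proof -
    have D: "cis \<theta> ^ n = cis (real n * \<theta>)" by (rule Complex.DeMoivre)
    have "c * cis \<theta> ^ n = R * (cis \<beta> * cis (real n * \<theta>))" by (simp only: c D mult.assoc)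
    also have "cis \<beta> * cis (real n * \<theta>) = cis (\<beta> + real n * \<theta>)" by (rule cis_mult)
    finally show ?thesis .
  qed
  then have "Re (c * cis \<theta> ^ n) = cmod c * cos (\<beta> + real n * \<theta>)" by (simp add: R_def)
  then have "Re (c * cis \<theta> ^ n) > 0" using \<theta>(3) assms(1) by simp
  then show ?thesis using \<theta> by (intro exI[of _ "cis \<theta>"]) (auto simp: sin_gt_zero)
qed

text \<open>
  If the derivative vanished, then \<open>f - f(x)\<close> would have a zero of order \<open>n \<ge> 2\<close> at \<open>x\<close>. In a suitable direction
  \<open>\<zeta>\<close> of the upper half-plane the leading term would then push \<open>|f|\<close> above \<open>|f(x)| = 1\<close>.
\<close>

lemma inner_function_boundary_deriv_nonzero:
  assumes hol: "f holomorphic_on S" and S: "open S" "of_real x \<in> S"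
    and bdd: "\<And>z. z \<in> S \<Longrightarrow> Im z > 0 \<Longrightarrow> cmod (f z) < 1" and unit: "cmod (f (of_real x)) = 1"
  shows "deriv f (of_real x) \<noteq> 0"
proof
  assume d0: "deriv f (of_real x) = 0"
  let ?x = "of_real x :: complex"
  obtain r0 where r0: "r0 > 0" "ball ?x r0 \<subseteq> S" using S open_contains_ball by blast
  have "\<exists>n>0. (deriv ^^ n) f ?x \<noteq> 0"
  proof (rule ccontr)
    assume "\<not> ?thesis"
    then have z: "\<And>n. 0 < n \<Longrightarrow> (deriv ^^ n) f ?x = 0" by blast
    let ?w = "?x + \<i> * of_real (r0 / 2)"
    have w: "?w \<in> ball ?x r0" using r0 by (simp add: dist_norm norm_mult)
    have "f ?w = f ?x"
      by (rule holomorphic_fun_eq_const_on_connected[OF holomorphic_on_subset[OF hol r0(2)] open_ball connected_ball z _ w])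
         (use r0 in auto)
    moreover have "cmod (f ?w) < 1" using w r0 by (intro bdd) auto
    ultimately show False using unit by simp
  qed
  then obtain n where n: "n > 0" "(deriv ^^ n) f ?x \<noteq> 0" "\<And>i. 0 < i \<Longrightarrow> i < n \<Longrightarrow> (deriv ^^ i) f ?x = 0"
    using exists_least_iff[of "\<lambda>n. n > 0 \<and> (deriv ^^ n) f ?x \<noteq> 0"] by auto
  have "n \<noteq> 1" using n(2) d0 by auto
  then have n2: "n \<ge> 2" using n(1) by simp
  obtain g r where g: "0 < r" "g holomorphic_on ball ?x r" "\<And>w. w \<in> ball ?x r \<Longrightarrow> f w - f ?x = (w - ?x) ^ n * g w"
    "\<And>w. w \<in> ball ?x r \<Longrightarrow> g w \<noteq> 0"
    using holomorphic_factor_order_of_zero[OF hol S n] by metis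
  have g0: "cnj (f ?x) * g ?x \<noteq> 0" using unit g(1,4) by auto
  obtain \<zeta> where \<zeta>: "cmod \<zeta> = 1" "Im \<zeta> > 0" "Re (cnj (f ?x) * g ?x * \<zeta> ^ n) > 0"
    using unit_direction_in_upper_half_plane[OF g0 n2] by blast
  let ?w = "\<lambda>t::real. ?x + of_real t * \<zeta>"
  have "isCont g ?x"
    using g(1,2) by (meson centre_in_ball continuous_on_eq_continuous_at holomorphic_on_imp_continuous_on open_ball)
  then have "((\<lambda>t. g (?w t)) \<longlongrightarrow> g ?x) (at_right 0)"
    by (rule isCont_tendsto_compose) (auto intro!: tendsto_eq_intros)
  then have "((\<lambda>t. Re (cnj (f ?x) * g (?w t) * \<zeta> ^ n)) \<longlongrightarrow> Re (cnj (f ?x) * g ?x * \<zeta> ^ n)) (at_right 0)"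
    by (intro tendsto_intros)
  then have "eventually (\<lambda>t. Re (cnj (f ?x) * g (?w t) * \<zeta> ^ n) > 0) (at_right 0)"
    using \<zeta>(3) by (rule order_tendstoD)
  moreover have "eventually (\<lambda>t. 0 < t \<and> t < min r r0) (at_right 0)"
    using g(1) r0(1) by (auto simp: eventually_at_right_field intro!: exI[of _ "min r r0"])
  ultimately have "eventually (\<lambda>t. Re (cnj (f ?x) * g (?w t) * \<zeta> ^ n) > 0 \<and> 0 < t \<and> t < min r r0) (at_right 0)"
    by eventually_elim auto
  then obtain t where t: "Re (cnj (f ?x) * g (?w t) * \<zeta> ^ n) > 0" "0 < t" "t < min r r0"
    using eventually_happens trivial_limit_at_right_real by blast
  have wr: "?w t \<in> ball ?x r" "?w t \<in> S" using t \<zeta>(1) r0(2) by (auto simp: dist_norm norm_mult intro!: subsetD[OF r0(2)])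
  have "cnj (f ?x) * f (?w t) = cnj (f ?x) * f ?x + of_real (t ^ n) * (cnj (f ?x) * g (?w t) * \<zeta> ^ n)"
  proof -
    have "f (?w t) = f ?x + (of_real t * \<zeta>) ^ n * g (?w t)" using g(3)[OF wr(1)] by (simp add: algebra_simps)
    then show ?thesis by (simp add: algebra_simps power_mult_distrib)
  qed
  moreover have "cnj (f ?x) * f ?x = 1" using unit by (metis complex_norm_square mult.commute of_real_1 one_power2)
  ultimately have "Re (cnj (f ?x) * f (?w t)) = 1 + t ^ n * Re (cnj (f ?x) * g (?w t) * \<zeta> ^ n)" by simp
  then have "Re (cnj (f ?x) * f (?w t)) > 1" using t by simp
  moreover have "Re (cnj (f ?x) * f (?w t)) \<le> cmod (f (?w t))"
    using complex_Re_le_cmod[of "cnj (f ?x) * f (?w t)"] unit by (simp add: norm_mult)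
  moreover have "cmod (f (?w t)) < 1" using wr(2) t \<zeta>(2) by (intro bdd) auto
  ultimately show False by simp
qed

lemma holomorphic_conj_star: "E holomorphic_on UNIV \<Longrightarrow> conj_star E holomorphic_on UNIV"
  using holomorphic_on_compose_cnj_cnj[of E UNIV] holomorphic_on_subset[of E UNIV]
  by (auto simp: conj_star_def[abs_def] comp_def)

lemma conj_star_of_real [simp]: "conj_star E (of_real x) = cnj (E (of_real x))"
  by (simp add: conj_star_def)

locale de_branges =
  fixes E :: "complex \<Rightarrow> complex" and \<phi> :: "real \<Rightarrow> real"
  assumes HB: "hermite_biehler E" and nz: "E (of_real x) \<noteq> 0" and phase: "phase_function E \<phi>"
begin

lemma E_hol: "E holomorphic_on UNIV" and E_less: "Im z > 0 \<Longrightarrow> cmod (conj_star E z) < cmod (E z)"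
  using HB by (auto simp: hermite_biehler_def)

lemma E_nz: "Im z \<ge> 0 \<Longrightarrow> E z \<noteq> 0"
proof (cases "Im z = 0")
  case True then show ?thesis using nz[of "Re z"] by (simp add: complex_is_Real_iff[symmetric])
next
  case False
  moreover assume "Im z \<ge> 0"
  ultimately show ?thesis using E_less[of z] by auto
qed

lemma E_le: "Im z \<ge> 0 \<Longrightarrow> cmod (conj_star E z) \<le> cmod (E z)"
proof (cases "Im z = 0")
  case True
  then have "z = of_real (Re z)" by (simp add: complex_eq_iff)
  then show ?thesis by (metis complex_mod_cnj conj_star_of_real order_refl)
next
  case False
  moreover assume "Im z \<ge> 0"
  ultimately show ?thesis using E_less[of z] by auto
qed

lemma smooth_\<phi>: "smooth \<phi>" and mono_\<phi>: "strict_mono \<phi>"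
  and polar: "E (of_real x) = of_real (cmod (E (of_real x))) * cis (- \<phi> x)"
  using phase by (auto simp: phase_function_def smooth_def cis_conv_exp mult.commute)

lemma DERIV_\<phi>: "(\<phi> has_real_derivative deriv \<phi> x) (at x)"
  using smooth_deriv[OF smooth_\<phi>, of 0 x] by simp

text \<open>
  The function \<open>\<Theta> = E\<^sup>* / E\<close> has modulus less than one in the upper half-plane, and on the real line it equals \<open>exp (2 i \<phi>)\<close>,
  so that a zero of \<open>\<phi>'\<close> would be one of its derivative.
\<close>

lemma deriv_\<phi>_pos: "deriv \<phi> x > 0"
proof -
  have "deriv \<phi> x \<ge> 0"
    by (rule mono_on_imp_deriv_nonneg[OF _ DERIV_\<phi>, of UNIV]) (use mono_\<phi> in \<open>auto simp: strict_mono_mono mono_imp_mono_on\<close>)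
  moreover have "deriv \<phi> x \<noteq> 0"
  proof
    assume 0: "deriv \<phi> x = 0"
    define \<Theta> where "\<Theta> z = conj_star E z / E z" for z
    define S where "S = {z. E z \<noteq> 0}"
    have S: "open S" unfolding S_def
      using holomorphic_on_imp_continuous_on[OF E_hol] by (intro open_Collect_neq) auto
    have hol: "\<Theta> holomorphic_on S"
      unfolding \<Theta>_def[abs_def]
      using holomorphic_on_subset[OF E_hol] holomorphic_on_subset[OF holomorphic_conj_star[OF E_hol]]
      by (intro holomorphic_intros) (auto simp: S_def)
    have xS: "of_real x \<in> S" using nz by (simp add: S_def)
    have \<Theta>real: "\<Theta> (of_real t) = cis (2 * \<phi> t)" for t
    proof -
      have "\<Theta> (of_real t) = cnj (of_real (cmod (E (of_real t))) * cis (- \<phi> t)) / (of_real (cmod (E (of_real t))) * cis (- \<phi> t))"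
        unfolding \<Theta>_def conj_star_of_real polar[symmetric] ..
      also have "\<dots> = cis (\<phi> t) / cis (- \<phi> t)" using nz[of t] by (simp add: cis_cnj)
      also have "\<dots> = cis (2 * \<phi> t)" by (simp add: cis_divide)
      finally show ?thesis .
    qed
    have "deriv \<Theta> (of_real x) \<noteq> 0"
    proof (rule inner_function_boundary_deriv_nonzero[OF hol S xS])
      show "cmod (\<Theta> z) < 1" if "z \<in> S" "Im z > 0" for z
        using E_less[OF that(2)] that(1) by (simp add: \<Theta>_def norm_divide S_def divide_less_eq_1)
      show "cmod (\<Theta> (of_real x)) = 1" by (simp add: \<Theta>real)
    qed
    moreover have "deriv \<Theta> (of_real x) = 0"
    proof -
      have "(\<Theta> has_field_derivative deriv \<Theta> (of_real x)) (at (of_real x))"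
        using hol S xS by (rule holomorphic_derivI)
      then have "((\<lambda>t. \<Theta> (of_real t)) has_vector_derivative deriv \<Theta> (of_real x)) (at x)"
        by (rule has_vector_derivative_real_field)
      moreover have "((\<lambda>t. \<Theta> (of_real t)) has_vector_derivative 0) (at x)"
      proof -
        have "((\<lambda>t. 2 * \<phi> t) has_real_derivative 0) (at x)"
          using DERIV_cmult[OF DERIV_\<phi>[of x], of 2] 0 by simp
        then have "((\<lambda>t. cis (2 * \<phi> t)) has_vector_derivative 0) (at x)"
          using DERIV_chain2[OF DERIV_cos, of "\<lambda>t. 2 * \<phi> t" 0] DERIV_chain2[OF DERIV_sin, of "\<lambda>t. 2 * \<phi> t" 0]
          by (simp add: has_vector_derivative_complex_iff)
        then show ?thesis by (simp add: \<Theta>real)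
      qed
      ultimately show ?thesis by (rule vector_derivative_unique_at)
    qed
    ultimately show False by simp
  qed
  ultimately show ?thesis by simp
qed

end

section \<open>Reproducing kernels on the real line\<close>

context de_branges
begin

abbreviation kern :: "real \<Rightarrow> complex \<Rightarrow> complex" where
  "kern y z \<equiv> db_kernel E z (of_real y)"

definition numer :: "real \<Rightarrow> complex \<Rightarrow> complex" where
  "numer y u = E u * cnj (E (of_real y)) - conj_star E u * E (of_real y)"

lemma kern_eq: "kern y z = \<i> / (2 * of_real pi) *
    (if z = of_real y then deriv (numer y) (of_real y) else (numer y z - numer y (of_real y)) / (z - of_real y))"
  by (simp add: db_kernel_def numer_def[abs_def] Let_def)

lemma numer_hol: "numer y holomorphic_on UNIV"
  unfolding numer_def[abs_def] by (intro holomorphic_intros E_hol holomorphic_conj_star)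

lemma numer_self [simp]: "numer y (of_real y) = 0"
  by (simp add: numer_def)

lemma kern_hol: "kern y holomorphic_on UNIV"
  unfolding kern_eq by (intro holomorphic_intros pole_lemma numer_hol) auto

lemma numer_real: "numer y (of_real x) = - 2 * \<i> * of_real (cmod (E (of_real x)) * cmod (E (of_real y)) * sin (\<phi> x - \<phi> y))"
proof -
  have "numer y (of_real x) = of_real (cmod (E (of_real x)) * cmod (E (of_real y))) * (cis (\<phi> y - \<phi> x) - cis (\<phi> x - \<phi> y))"
  proof -
    define p q where pq: "p = complex_of_real (cmod (E (of_real x)))" "q = complex_of_real (cmod (E (of_real y)))"
    have E: "E (of_real x) = p * cis (- \<phi> x)" "E (of_real y) = q * cis (- \<phi> y)" unfolding pq by (rule polar)+
    have c: "cnj p = p" "cnj q = q" by (simp_all add: pq)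
    have c1: "cis (- \<phi> x) * cis (\<phi> y) = cis (\<phi> y - \<phi> x)" and c2: "cis (\<phi> x) * cis (- \<phi> y) = cis (\<phi> x - \<phi> y)"
      by (simp_all add: cis_mult)
    have "numer y (of_real x) = p * q * (cis (- \<phi> x) * cis (\<phi> y)) - p * q * (cis (\<phi> x) * cis (- \<phi> y))"
      unfolding numer_def conj_star_of_real E by (simp add: cis_cnj c)
    then show ?thesis unfolding c1 c2 by (simp add: pq right_diff_distrib)
  qed
  also have "cis (\<phi> y - \<phi> x) - cis (\<phi> x - \<phi> y) = - 2 * \<i> * of_real (sin (\<phi> x - \<phi> y))"
  proof -
    have c: "cos (\<phi> y - \<phi> x) = cos (\<phi> x - \<phi> y)" by (metis cos_minus minus_diff_eq)
    have s: "sin (\<phi> y - \<phi> x) = - sin (\<phi> x - \<phi> y)" by (metis sin_minus minus_diff_eq)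
    show ?thesis unfolding complex_eq_iff by (simp add: c s)
  qed
  finally show ?thesis by (simp add: mult_ac)
qed

text \<open>
  On the diagonal the kernel is defined by a complex derivative, which is computed as a limit along the real line.
\<close>

lemma kern_real: "kern y (of_real x) = of_real (cmod (E (of_real x)) * cmod (E (of_real y)) * phase_sinc \<phi> x y / pi)"
proof (cases "x = y")
  case False
  then have "(of_real x :: complex) - of_real y \<noteq> 0" by simp
  then show ?thesis using False
    unfolding kern_eq numer_real by (simp add: phase_sinc_def field_simps)
next
  case True
  let ?D = "deriv (numer y) (of_real y)"
  let ?q = "\<lambda>t. - 2 * \<i> * of_real (cmod (E (of_real t)) * cmod (E (of_real y)) * (sin (\<phi> t - \<phi> y) / (t - y)))"
  have "(numer y has_field_derivative ?D) (at (of_real y))"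
    using numer_hol by (intro holomorphic_derivI[of _ UNIV]) auto
  then have "((\<lambda>z. (numer y z - numer y (of_real y)) / (z - of_real y)) \<longlongrightarrow> ?D) (at (of_real y))"
    by (simp only: has_field_derivative_iff)
  moreover have "filterlim complex_of_real (at (of_real y)) (at y)"
    by (auto simp: filterlim_at eventually_at_filter intro!: tendsto_intros)
  ultimately have "((\<lambda>t. (numer y (of_real t) - numer y (of_real y)) / (of_real t - of_real y)) \<longlongrightarrow> ?D) (at y)"
    by (rule filterlim_compose)
  then have L1: "(?q \<longlongrightarrow> ?D) (at y)"
    by (rule Lim_transform_eventually) (auto simp: numer_real eventually_at_filter field_simps)
  have "((\<lambda>t. sin (\<phi> t - \<phi> y)) has_real_derivative cos (\<phi> y - \<phi> y) * (deriv \<phi> y - 0)) (at y)"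
    by (intro DERIV_chain2[OF DERIV_sin] DERIV_diff DERIV_\<phi> DERIV_const)
  then have "((\<lambda>t. sin (\<phi> t - \<phi> y) / (t - y)) \<longlongrightarrow> deriv \<phi> y) (at y)"
    by (simp add: has_field_derivative_iff)
  moreover have "((\<lambda>t. cmod (E (of_real t))) \<longlongrightarrow> cmod (E (of_real y))) (at y)"
  proof -
    have "isCont E (of_real y)" using holomorphic_on_imp_continuous_on[OF E_hol] by (simp add: continuous_on_eq_continuous_at)
    then have "((\<lambda>t. E (of_real t)) \<longlongrightarrow> E (of_real y)) (at y)"
      by (rule isCont_tendsto_compose) (auto intro!: tendsto_intros)
    then show ?thesis by (rule tendsto_norm)
  qed
  ultimately have L2: "(?q \<longlongrightarrow> - 2 * \<i> * of_real (cmod (E (of_real y)) * cmod (E (of_real y)) * deriv \<phi> y)) (at y)"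
    by (intro tendsto_mult tendsto_of_real tendsto_const)
  have "?D = - 2 * \<i> * of_real (cmod (E (of_real y)) * cmod (E (of_real y)) * deriv \<phi> y)"
    by (rule tendsto_unique[OF _ L1 L2]) simp
  then show ?thesis using True unfolding kern_eq by (simp add: phase_sinc_def field_simps)
qed

text \<open>
  The normalized kernel at \<open>w\<close> divided by \<open>|E|\<close>, a real function on the real line.
\<close>

definition rkernel :: "real \<Rightarrow> real \<Rightarrow> real" where
  "rkernel w x = phase_sinc \<phi> x w / sqrt (pi * deriv \<phi> w)"

lemma normalized_kernel_eq:
  "normalized_kernel E w z = of_real (1 / (cmod (E (of_real w)) * sqrt (deriv \<phi> w / pi))) * kern w z"
proof -
  have "kern w (of_real w) = of_real ((cmod (E (of_real w)))\<^sup>2 * (deriv \<phi> w / pi))"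
    by (simp add: kern_real phase_sinc_def power2_eq_square)
  moreover have "csqrt (of_real ((cmod (E (of_real w)))\<^sup>2 * (deriv \<phi> w / pi))) = of_real (cmod (E (of_real w)) * sqrt (deriv \<phi> w / pi))"
  proof -
    have "sqrt ((cmod (E (of_real w)))\<^sup>2 * (deriv \<phi> w / pi)) = cmod (E (of_real w)) * sqrt (deriv \<phi> w / pi)"
      by (simp only: real_sqrt_mult real_sqrt_abs abs_norm_cancel)
    then show ?thesis using deriv_\<phi>_pos[of w] by (subst csqrt_of_real) auto
  qed
  ultimately show ?thesis by (simp add: normalized_kernel_def)
qed

lemma normalized_kernel_real: "normalized_kernel E w (of_real x) = of_real (cmod (E (of_real x)) * rkernel w x)"
proof -
  have p: "deriv \<phi> w > 0" by (rule deriv_\<phi>_pos)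
  have "1 / (cmod (E (of_real w)) * sqrt (deriv \<phi> w / pi)) * (cmod (E (of_real x)) * cmod (E (of_real w)) * phase_sinc \<phi> x w / pi)
    = cmod (E (of_real x)) * rkernel w x"
  proof -
    have "sqrt (deriv \<phi> w / pi) * pi = sqrt (pi * deriv \<phi> w)"
      using p by (simp add: real_sqrt_mult real_sqrt_divide field_simps)
    then show ?thesis using nz[of w] by (simp add: rkernel_def field_simps)
  qed
  then show ?thesis unfolding normalized_kernel_eq kern_real of_real_mult[symmetric] by simp
qed

lemma phase_sinc_commute: "phase_sinc \<phi> x y = phase_sinc \<phi> y x"
proof -
  have "sin (\<phi> x - \<phi> y) = - sin (\<phi> y - \<phi> x)" by (metis sin_minus minus_diff_eq)
  then have "sin (\<phi> x - \<phi> y) / (x - y) = sin (\<phi> y - \<phi> x) / (y - x)" by (metis minus_diff_eq minus_divide_divide)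
  then show ?thesis by (simp add: phase_sinc_def)
qed

lemma phase_sinc_cont: "continuous_on UNIV (\<lambda>x. phase_sinc \<phi> x y)"
proof -
  have "continuous_on UNIV (\<lambda>x. pi * Re (kern y (of_real x)) / (cmod (E (of_real x)) * cmod (E (of_real y))))"
  proof -
    have "continuous_on UNIV (\<lambda>x::real. kern y (of_real x))" "continuous_on UNIV (\<lambda>x::real. E (of_real x))"
      using kern_hol E_hol
      by (auto intro!: continuous_on_compose2[OF holomorphic_on_imp_continuous_on, of _ UNIV _ of_real] continuous_intros)
    then show ?thesis using nz by (intro continuous_intros) auto
  qed
  also have "(\<lambda>x. pi * Re (kern y (of_real x)) / (cmod (E (of_real x)) * cmod (E (of_real y)))) = (\<lambda>x. phase_sinc \<phi> x y)"
    using nz by (auto simp: kern_real)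
  finally show ?thesis .
qed

end

section \<open>Real combinations of kernels\<close>

context de_branges
begin

text \<open>
  A class that contains the kernels at real points, is closed under real linear combinations, and has
  enough decay for all integrals below. Its members are real on the real line, and since \<open>f\<^sup>* = f\<close> the bound in the closed
  upper half-plane also controls the lower half-plane.
\<close>

definition db_tame :: "(complex \<Rightarrow> complex) \<Rightarrow> bool" where
  "db_tame f \<longleftrightarrow> f holomorphic_on UNIV \<and> conj_star f = f \<and>
     (\<exists>C\<ge>0. \<forall>z. Im z \<ge> 0 \<longrightarrow> cmod (f z / E z) \<le> C / (1 + cmod z))"

lemma db_tame_add:
  assumes "db_tame f" "db_tame g"
  shows "db_tame (\<lambda>z. f z + g z)"
proof -
  obtain C D where C: "C \<ge> 0" "\<And>z. Im z \<ge> 0 \<Longrightarrow> cmod (f z / E z) \<le> C / (1 + cmod z)"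
    and D: "D \<ge> 0" "\<And>z. Im z \<ge> 0 \<Longrightarrow> cmod (g z / E z) \<le> D / (1 + cmod z)"
    using assms unfolding db_tame_def by blast
  have "cmod ((f z + g z) / E z) \<le> (C + D) / (1 + cmod z)" if "Im z \<ge> 0" for z
    using C(2)[OF that] D(2)[OF that] norm_triangle_ineq[of "f z / E z" "g z / E z"]
    by (simp add: add_divide_distrib)
  moreover have "conj_star (\<lambda>z. f z + g z) = (\<lambda>z. conj_star f z + conj_star g z)"
    by (simp add: conj_star_def fun_eq_iff)
  ultimately show ?thesis
    using assms C(1) D(1) unfolding db_tame_def by (auto intro!: holomorphic_intros exI[of _ "C + D"])
qed

lemma db_tame_cmult:
  assumes "db_tame f"
  shows "db_tame (\<lambda>z. of_real r * f z)"
proof -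
  obtain C where C: "C \<ge> 0" "\<And>z. Im z \<ge> 0 \<Longrightarrow> cmod (f z / E z) \<le> C / (1 + cmod z)"
    using assms unfolding db_tame_def by blast
  have "cmod (of_real r * f z / E z) \<le> (\<bar>r\<bar> * C) / (1 + cmod z)" if "Im z \<ge> 0" for z
    using mult_left_mono[OF C(2)[OF that], of "\<bar>r\<bar>"] by (simp add: norm_mult norm_divide)
  moreover have "conj_star (\<lambda>z. of_real r * f z) = (\<lambda>z. of_real r * conj_star f z)"
    by (simp add: conj_star_def fun_eq_iff)
  ultimately show ?thesis
    using assms C(1) unfolding db_tame_def by (auto intro!: holomorphic_intros exI[of _ "\<bar>r\<bar> * C"])
qed

lemma db_tame_sum: "finite J \<Longrightarrow> (\<And>n. n \<in> J \<Longrightarrow> db_tame (e n)) \<Longrightarrow> db_tame (\<lambda>z. \<Sum>n\<in>J. of_real (b n) * e n z)"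
proof (induction J rule: finite_induct)
  case empty
  then show ?case by (auto simp: db_tame_def conj_star_def fun_eq_iff)
next
  case (insert n J)
  have "db_tame (\<lambda>z. of_real (b n) * e n z + (\<Sum>n\<in>J. of_real (b n) * e n z))"
    using insert by (intro db_tame_add db_tame_cmult) auto
  then show ?case using insert(1,2) by simp
qed

lemma db_tame_diff:
  assumes "db_tame f" "db_tame g"
  shows "db_tame (\<lambda>z. f z - g z)"
  using db_tame_add[OF assms(1) db_tame_cmult[OF assms(2), of "-1"]] by simp

text \<open>
  Near \<open>y\<close> the quotient is bounded by compactness. Away from \<open>y\<close> its numerator is at most \<open>2 |E(z)| |E(y)|\<close>, because
  \<open>|E\<^sup>*| \<le> |E|\<close> in the closed upper half-plane.
\<close>

lemma db_tame_kern: "db_tame (kern y)"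
  unfolding db_tame_def
proof (intro conjI)
  show "kern y holomorphic_on UNIV" by (rule kern_hol)
  show "conj_star (kern y) = kern y"
  proof
    fix z
    show "conj_star (kern y) z = kern y z"
    proof (cases "z = of_real y")
      case True then show ?thesis by (simp add: kern_real)
    next
      case False
      then have "cnj z \<noteq> of_real y" by (metis complex_cnj_cnj complex_cnj_complex_of_real)
      moreover have "cnj (numer y (cnj z)) = - numer y z" by (simp add: numer_def conj_star_def)
      ultimately show ?thesis using False
        unfolding conj_star_def kern_eq by simp
    qed
  qed
  let ?g = "\<lambda>z. kern y z / E z"
  let ?r = "\<bar>y\<bar> + 1"
  have cont: "continuous_on ({z. Im z \<ge> 0} \<inter> cball 0 ?r) ?g"
    using holomorphic_on_imp_continuous_on[OF kern_hol] holomorphic_on_imp_continuous_on[OF E_hol] E_nz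
    by (intro continuous_intros) (auto intro: continuous_on_subset)
  have "closed {z. Im z \<ge> 0}" by (intro closed_Collect_le continuous_intros)
  then have "compact ({z. Im z \<ge> 0} \<inter> cball 0 ?r)" by (intro closed_Int_compact) auto
  then have "bounded (?g ` ({z. Im z \<ge> 0} \<inter> cball 0 ?r))" using cont by (intro compact_imp_bounded compact_continuous_image)
  then obtain B where B: "B > 0" "\<And>z. Im z \<ge> 0 \<Longrightarrow> cmod z \<le> ?r \<Longrightarrow> cmod (?g z) \<le> B"
    unfolding bounded_pos by auto
  define A where "A = cmod (E (of_real y)) / pi"
  \<comment> \<open>\<open>1 + |z| \<le> (2 + |y|) (|z| - |y|)\<close> holds outside the disk of radius \<open>?r\<close>, and \<open>1 + |z| \<le> 2 + |y|\<close> inside.\<close>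
  define C where "C = (A + B) * (2 + \<bar>y\<bar>)"
  have A: "A \<ge> 0" by (simp add: A_def)
  have "cmod (?g z) \<le> C / (1 + cmod z)" if z: "Im z \<ge> 0" for z
  proof -
    have pos: "1 + cmod z > 0" by (simp add: add_pos_nonneg)
    show ?thesis
    proof (cases "cmod z \<le> ?r")
      case True
      have "cmod (?g z) * (1 + cmod z) \<le> B * (2 + \<bar>y\<bar>)"
        using True B z by (intro mult_mono) auto
      also have "\<dots> \<le> C" using A B by (simp add: C_def distrib_right)
      finally show ?thesis using pos by (simp add: pos_le_divide_eq)
    next
      case False
      have ne: "z \<noteq> of_real y" using False by auto
      have d: "cmod (z - of_real y) \<ge> cmod z - \<bar>y\<bar>" using norm_triangle_ineq2[of z "of_real y"] by simp
      have d0: "cmod (z - of_real y) > 0" using ne by simp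
      have "cmod (numer y z) \<le> cmod (E z) * cmod (E (of_real y)) + cmod (conj_star E z) * cmod (E (of_real y))"
        unfolding numer_def using norm_triangle_ineq4[of "E z * cnj (E (of_real y))" "conj_star E z * E (of_real y)"] by (simp add: norm_mult)
      also have "\<dots> \<le> 2 * (cmod (E z) * cmod (E (of_real y)))"
        using mult_right_mono[OF E_le[OF z], of "cmod (E (of_real y))"] by simp
      finally have n: "cmod (numer y z) \<le> 2 * (cmod (E z) * cmod (E (of_real y)))" .
      have "cmod (?g z) = cmod (numer y z) / (2 * pi * cmod (z - of_real y) * cmod (E z))"
        using ne by (simp add: kern_eq norm_mult norm_divide)
      also have "\<dots> \<le> 2 * (cmod (E z) * cmod (E (of_real y))) / (2 * pi * cmod (z - of_real y) * cmod (E z))"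
        by (rule divide_right_mono[OF n]) simp
      also have "\<dots> = A / cmod (z - of_real y)"
        using E_nz[OF z] by (simp add: A_def field_simps)
      also have "\<dots> \<le> C / (1 + cmod z)"
      proof -
        have "1 + cmod z \<le> (2 + \<bar>y\<bar>) * (cmod z - \<bar>y\<bar>)"
        proof -
          have "(2 + \<bar>y\<bar>) * (cmod z - \<bar>y\<bar>) - (1 + cmod z) = (1 + \<bar>y\<bar>) * (cmod z - \<bar>y\<bar> - 1)"
            by (simp add: algebra_simps)
          moreover have "0 \<le> (1 + \<bar>y\<bar>) * (cmod z - \<bar>y\<bar> - 1)"
            by (rule mult_nonneg_nonneg) (use False in auto)
          ultimately show ?thesis by linarith
        qed
        also have "\<dots> \<le> (2 + \<bar>y\<bar>) * cmod (z - of_real y)" using d by (intro mult_left_mono) auto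
        finally have "A * (1 + cmod z) \<le> A * ((2 + \<bar>y\<bar>) * cmod (z - of_real y))" using A by (rule mult_left_mono)
        also have "\<dots> \<le> C * cmod (z - of_real y)"
          using B A unfolding C_def mult.assoc by (intro mult_right_mono) auto
        finally show ?thesis using pos d0 by (simp add: divide_simps mult.commute)
      qed
      finally show ?thesis .
    qed
  qed
  then show "\<exists>C\<ge>0. \<forall>z. Im z \<ge> 0 \<longrightarrow> cmod (?g z) \<le> C / (1 + cmod z)"
    using A B by (intro exI[of _ C]) (auto simp: C_def)
qed

text \<open>
  The value relative to \<open>|E|\<close>: the norm of \<open>H(E)\<close> becomes the norm of \<open>L\<^sup>2\<close>.
\<close>

definition rvalue :: "(complex \<Rightarrow> complex) \<Rightarrow> real \<Rightarrow> real" where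
  "rvalue f t = Re (f (of_real t)) / cmod (E (of_real t))"

lemma db_tame_real:
  assumes "db_tame f"
  shows "f (of_real t) = of_real (rvalue f t * cmod (E (of_real t)))"
proof -
  have "cnj (f (of_real t)) = f (of_real t)"
    using assms by (metis conj_star_def complex_cnj_complex_of_real db_tame_def)
  then have "Im (f (of_real t)) = 0" by (metis cnj.simps(2) neg_equal_zero)
  then show ?thesis using nz[of t] by (simp add: rvalue_def complex_eq_iff)
qed

lemma rvalue_norm: "db_tame f \<Longrightarrow> cmod (f (of_real t) / E (of_real t)) = \<bar>rvalue f t\<bar>"
  using nz[of t] by (subst db_tame_real) (simp_all add: norm_divide norm_mult)

lemma rvalue_cont: "db_tame f \<Longrightarrow> continuous_on UNIV (rvalue f)"
proof -
  assume "db_tame f"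
  then have "f holomorphic_on UNIV" by (simp add: db_tame_def)
  then have "continuous_on UNIV (\<lambda>x::real. f (of_real x))" "continuous_on UNIV (\<lambda>x::real. E (of_real x))"
    using E_hol
    by (auto intro!: continuous_on_compose2[OF holomorphic_on_imp_continuous_on, of _ UNIV _ of_real] continuous_intros)
  then show ?thesis unfolding rvalue_def using nz by (intro continuous_intros) auto
qed

lemma cauchy_density_integrable: "integrable lborel (\<lambda>t::real. 1 / (1 + t\<^sup>2))"
  using integrable_inverse_1_plus_square
  by (simp add: set_integrable_def einterval_def inverse_eq_divide)

lemma cauchy_weight_bound:
  assumes "r \<le> C / (1 + cmod z)" "0 \<le> r"
  shows "r\<^sup>2 \<le> C\<^sup>2 * (1 / (1 + (Re z)\<^sup>2))"
proof -
  have pos: "1 + cmod z > 0" "1 + (Re z)\<^sup>2 > 0" by (simp_all add: add_pos_nonneg)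
  have "(Re z)\<^sup>2 \<le> (cmod z)\<^sup>2" using power_mono[OF abs_Re_le_cmod[of z], of 2] by simp
  then have "1 + (Re z)\<^sup>2 \<le> (1 + cmod z)\<^sup>2"
    unfolding power2_sum one_power2 using norm_ge_zero[of z] by linarith
  then have "C\<^sup>2 / (1 + cmod z)\<^sup>2 \<le> C\<^sup>2 / (1 + (Re z)\<^sup>2)" using pos by (intro divide_left_mono mult_pos_pos) auto
  moreover have "r\<^sup>2 \<le> (C / (1 + cmod z))\<^sup>2" using assms by (intro power_mono) auto
  ultimately show ?thesis by (simp add: power_divide)
qed

lemma rvalue_bound:
  assumes "db_tame f"
  obtains C where "C \<ge> 0" "\<And>t. (rvalue f t)\<^sup>2 \<le> C * (1 / (1 + t\<^sup>2))"
proof -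
  obtain C where C: "C \<ge> 0" "\<And>z. Im z \<ge> 0 \<Longrightarrow> cmod (f z / E z) \<le> C / (1 + cmod z)"
    using assms unfolding db_tame_def by blast
  have "(rvalue f t)\<^sup>2 \<le> C\<^sup>2 * (1 / (1 + t\<^sup>2))" for t
    using cauchy_weight_bound[OF C(2)[of "of_real t"]] rvalue_norm[OF assms, of t] by simp
  then show ?thesis using that[of "C\<^sup>2"] by simp
qed

lemma rvalue_mult_integrable:
  assumes "db_tame f" "db_tame g"
  shows "integrable lborel (\<lambda>t. rvalue f t * rvalue g t)"
proof -
  obtain C where C: "C \<ge> 0" "\<And>t. (rvalue f t)\<^sup>2 \<le> C * (1 / (1 + t\<^sup>2))" using rvalue_bound[OF assms(1)] by blast
  obtain D where D: "D \<ge> 0" "\<And>t. (rvalue g t)\<^sup>2 \<le> D * (1 / (1 + t\<^sup>2))" using rvalue_bound[OF assms(2)] by blast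
  show ?thesis
  proof (rule Bochner_Integration.integrable_bound)
    show "integrable lborel (\<lambda>t::real. (C + D) * (1 / (1 + t\<^sup>2)))"
      by (intro integrable_mult_right cauchy_density_integrable)
    show "(\<lambda>t. rvalue f t * rvalue g t) \<in> borel_measurable lborel"
      using rvalue_cont[OF assms(1)] rvalue_cont[OF assms(2)]
      by (auto intro!: borel_measurable_continuous_onI continuous_intros)
    have "\<bar>rvalue f t * rvalue g t\<bar> \<le> (C + D) * (1 / (1 + t\<^sup>2))" for t
    proof -
      have "\<bar>rvalue f t * rvalue g t\<bar> \<le> (rvalue f t)\<^sup>2 + (rvalue g t)\<^sup>2"
        using sum_squares_bound[of "\<bar>rvalue f t\<bar>" "\<bar>rvalue g t\<bar>"] mult_nonneg_nonneg[of "\<bar>rvalue f t\<bar>" "\<bar>rvalue g t\<bar>"]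
        unfolding abs_mult power2_abs by linarith
      also have "\<dots> \<le> (C + D) * (1 / (1 + t\<^sup>2))" using C(2)[of t] D(2)[of t] by (simp add: distrib_right add_divide_distrib)
      finally show ?thesis .
    qed
    then show "AE t in lborel. norm (rvalue f t * rvalue g t) \<le> norm ((C + D) * (1 / (1 + t\<^sup>2)))"
      using C(1) D(1) by (auto simp: abs_mult)
  qed
qed

lemma db_tame_in_space:
  assumes f: "db_tame f"
  shows "f \<in> de_branges_space E"
proof -
  have hol: "f holomorphic_on UNIV" and star: "conj_star f = f" using f by (auto simp: db_tame_def)
  obtain C where C: "C \<ge> 0" "\<And>z. Im z \<ge> 0 \<Longrightarrow> cmod (f z / E z) \<le> C / (1 + cmod z)"
    using f unfolding db_tame_def by blast
  have "(\<lambda>z. f z / E z) \<in> hardy_H2"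
    unfolding hardy_H2_def
  proof (intro CollectI conjI)
    show "(\<lambda>z. f z / E z) holomorphic_on {z. Im z > 0}"
      using holomorphic_on_subset[OF hol] holomorphic_on_subset[OF E_hol] E_nz
      by (intro holomorphic_intros) auto
    have b: "(\<integral>\<^sup>+x. ennreal ((cmod (f (Complex x y) / E (Complex x y)))\<^sup>2) \<partial>lborel) \<le> (\<integral>\<^sup>+x. ennreal (C\<^sup>2 * (1 / (1 + x\<^sup>2))) \<partial>lborel)"
      if "y > 0" for y
    proof (rule nn_integral_mono, rule ennreal_leI)
      show "(cmod (f (Complex x y) / E (Complex x y)))\<^sup>2 \<le> C\<^sup>2 * (1 / (1 + x\<^sup>2))" for x
        using cauchy_weight_bound[OF C(2), of "Complex x y"] that by simp
    qed
    have "(SUP y\<in>{0<..}. \<integral>\<^sup>+x. ennreal ((cmod (f (Complex x y) / E (Complex x y)))\<^sup>2) \<partial>lborel)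
        \<le> (\<integral>\<^sup>+x. ennreal (C\<^sup>2 * (1 / (1 + x\<^sup>2))) \<partial>lborel)"
      by (rule SUP_least) (use b in auto)
    also have "\<dots> < \<infinity>"
      by (subst nn_integral_eq_integral[OF integrable_mult_right[OF cauchy_density_integrable]])
         (auto simp: add_nonneg_nonneg)
    finally show "(SUP y\<in>{0<..}. \<integral>\<^sup>+x. ennreal ((cmod (f (Complex x y) / E (Complex x y)))\<^sup>2) \<partial>lborel) < \<infinity>" .
  qed
  then show ?thesis using hol star by (simp add: de_branges_space_def)
qed

end

section \<open>Point evaluations\<close>

text \<open>
  All sides of the rectangle except the one on the real axis lie in the region where \<open>h\<close> is small.
\<close>

lemma contour_integral_rectpath_bound:
  assumes cont: "continuous_on {z. Im z \<ge> 0 \<and> cmod z \<ge> R} h" and cont0: "continuous_on (closed_segment (Complex (-R) 0) (Complex R 0)) h"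
    and R: "R > 0" and B: "\<And>z. Im z \<ge> 0 \<Longrightarrow> cmod z \<ge> R \<Longrightarrow> cmod (h z) \<le> B" "B \<ge> 0"
    and c: "(h has_contour_integral c) (rectpath (Complex (-R) 0) (Complex R R))"
  shows "cmod (c - contour_integral (linepath (Complex (-R) 0) (Complex R 0)) h) \<le> 4 * R * B"
proof -
  let ?a1 = "Complex (-R) 0" and ?a2 = "Complex R 0" and ?a3 = "Complex R R" and ?a4 = "Complex (-R) R"
  have seg: "closed_segment ?a2 ?a3 \<subseteq> {z. Im z \<ge> 0 \<and> cmod z \<ge> R}" "closed_segment ?a3 ?a4 \<subseteq> {z. Im z \<ge> 0 \<and> cmod z \<ge> R}"
    "closed_segment ?a4 ?a1 \<subseteq> {z. Im z \<ge> 0 \<and> cmod z \<ge> R}"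
  proof -
    have re: "R \<le> cmod z" if "R \<le> \<bar>Re z\<bar>" for z using that abs_Re_le_cmod[of z] by linarith
    have im: "R \<le> cmod z" if "R \<le> \<bar>Im z\<bar>" for z using that abs_Im_le_cmod[of z] by linarith
    have "Re z = R \<and> Im z \<ge> 0" if "z \<in> closed_segment ?a2 ?a3" for z
      using that R closed_segment_same_Re[of ?a2 ?a3] by (simp add: closed_segment_eq_real_ivl)
    then show "closed_segment ?a2 ?a3 \<subseteq> {z. Im z \<ge> 0 \<and> cmod z \<ge> R}" using re by auto
    have "Im z = R" if "z \<in> closed_segment ?a3 ?a4" for z
      using that R closed_segment_same_Im[of ?a3 ?a4] by simp
    then show "closed_segment ?a3 ?a4 \<subseteq> {z. Im z \<ge> 0 \<and> cmod z \<ge> R}" using im R by auto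
    have "Re z = -R \<and> Im z \<ge> 0" if "z \<in> closed_segment ?a4 ?a1" for z
      using that R closed_segment_same_Re[of ?a4 ?a1] by (simp add: closed_segment_eq_real_ivl)
    then show "closed_segment ?a4 ?a1 \<subseteq> {z. Im z \<ge> 0 \<and> cmod z \<ge> R}" using re by auto
  qed
  have i: "h contour_integrable_on (linepath ?a1 ?a2)" "h contour_integrable_on (linepath ?a2 ?a3)"
    "h contour_integrable_on (linepath ?a3 ?a4)" "h contour_integrable_on (linepath ?a4 ?a1)"
    using cont0 continuous_on_subset[OF cont seg(1)] continuous_on_subset[OF cont seg(2)] continuous_on_subset[OF cont seg(3)]
    by (auto intro: contour_integrable_continuous_linepath)
  have "c = contour_integral (linepath ?a1 ?a2) h + contour_integral (linepath ?a2 ?a3) h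
      + contour_integral (linepath ?a3 ?a4) h + contour_integral (linepath ?a4 ?a1) h"
  proof -
    have "c = contour_integral (rectpath ?a1 ?a3) h" using c by (simp add: contour_integral_unique)
    then show ?thesis using i by (simp add: rectpath_def Let_def contour_integrable_joinI)
  qed
  moreover have "cmod (contour_integral (linepath ?a2 ?a3) h) \<le> B * cmod (?a3 - ?a2)"
    using seg(1) B by (intro contour_integral_bound_linepath i) auto
  moreover have "cmod (contour_integral (linepath ?a3 ?a4) h) \<le> B * cmod (?a4 - ?a3)"
    using seg(2) B by (intro contour_integral_bound_linepath i) auto
  moreover have "cmod (contour_integral (linepath ?a4 ?a1) h) \<le> B * cmod (?a1 - ?a4)"
    using seg(3) B by (intro contour_integral_bound_linepath i) auto
  moreover have "cmod (?a3 - ?a2) = R" "cmod (?a4 - ?a3) = 2 * R" "cmod (?a1 - ?a4) = R"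
    using R by (simp_all add: cmod_def real_sqrt_mult)
  ultimately have "cmod (c - contour_integral (linepath ?a1 ?a2) h) \<le> B * R + B * (2 * R) + B * R"
    using norm_triangle_ineq[of "contour_integral (linepath ?a2 ?a3) h + contour_integral (linepath ?a3 ?a4) h" "contour_integral (linepath ?a4 ?a1) h"]
      norm_triangle_ineq[of "contour_integral (linepath ?a2 ?a3) h" "contour_integral (linepath ?a3 ?a4) h"]
    by (simp add: algebra_simps)
  then show ?thesis by (simp add: algebra_simps)
qed

lemma integral_shifted_cauchy_density:
  fixes a \<eta> R :: real
  assumes "\<eta> > 0" "R > 0"
  obtains I where "((\<lambda>t. 1 / ((t - a)\<^sup>2 + \<eta>\<^sup>2)) has_integral I) {-R..R}" "I \<le> pi / \<eta>"
proof -
  have "((\<lambda>t. 1 / ((t - a)\<^sup>2 + \<eta>\<^sup>2)) has_integral arctan ((R - a) / \<eta>) / \<eta> - arctan ((- R - a) / \<eta>) / \<eta>) {-R..R}"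
  proof (rule fundamental_theorem_of_calculus)
    fix x :: real
    have d: "((\<lambda>t. (t - a) / \<eta>) has_real_derivative 1 / \<eta>) (at x)"
      using assms(1) by (auto intro!: derivative_eq_intros)
    have "((\<lambda>t. arctan ((t - a) / \<eta>) / \<eta>) has_real_derivative inverse (1 + ((x - a) / \<eta>)\<^sup>2) * (1 / \<eta>) / \<eta>) (at x)"
      by (rule DERIV_cdivide[OF DERIV_chain2[OF DERIV_arctan d]])
    also have "inverse (1 + ((x - a) / \<eta>)\<^sup>2) * (1 / \<eta>) / \<eta> = 1 / ((x - a)\<^sup>2 + \<eta>\<^sup>2)"
    proof -
      have "\<eta>\<^sup>2 * (1 + ((x - a) / \<eta>)\<^sup>2) = (x - a)\<^sup>2 + \<eta>\<^sup>2"
        using assms(1) by (simp add: power_divide distrib_left)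
      moreover have "inverse u * (1 / \<eta>) / \<eta> = 1 / (\<eta>\<^sup>2 * u)" for u
        by (simp add: inverse_eq_divide power2_eq_square)
      ultimately show ?thesis by simp
    qed
    finally show "((\<lambda>t. arctan ((t - a) / \<eta>) / \<eta>) has_vector_derivative 1 / ((x - a)\<^sup>2 + \<eta>\<^sup>2)) (at x within {-R..R})"
      by (simp add: has_real_derivative_iff_has_vector_derivative has_vector_derivative_at_within)
  qed (use assms in auto)
  moreover have "arctan ((R - a) / \<eta>) / \<eta> - arctan ((- R - a) / \<eta>) / \<eta> \<le> pi / \<eta>"
  proof -
    have "arctan ((R - a) / \<eta>) - arctan ((- R - a) / \<eta>) \<le> pi"
      using arctan_ubound[of "(R - a) / \<eta>"] arctan_lbound[of "(- R - a) / \<eta>"] by linarith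
    then show ?thesis unfolding diff_divide_distrib[symmetric] using assms(1) by (intro divide_right_mono) auto
  qed
  ultimately show ?thesis by (rule that)
qed

context de_branges
begin

text \<open>
  Cauchy's formula over the rectangles with vertices \<open>\<plusminus>R\<close> and \<open>\<plusminus>R + iR\<close>. The factor \<open>1 / |t - w|\<close> on the real axis is
  separated from \<open>f / E\<close> by the inequality \<open>2 u v \<le> u\<^sup>2 / \<epsilon> + \<epsilon> v\<^sup>2\<close>; the weight \<open>\<epsilon>\<close> replaces the
  Cauchy--Schwarz inequality for integrals.
\<close>

lemma tame_upper_bound:
  assumes f: "db_tame f" and \<epsilon>: "\<epsilon> > 0" and L2: "(LINT t|lborel. (rvalue f t)\<^sup>2) \<le> \<epsilon>\<^sup>2" and w: "Im w > 0"
  shows "cmod (f w / E w) \<le> \<epsilon> * (1 + 1 / Im w)"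
proof -
  define g where "g z = f z / E z" for z
  define h where "h z = g z / (z - w)" for z
  let ?\<eta> = "Im w" and ?a = "Re w"
  let ?U = "{z. Im z \<ge> 0}"
  have hol: "f holomorphic_on UNIV" using f by (simp add: db_tame_def)
  obtain C where C: "C \<ge> 0" "\<And>z. Im z \<ge> 0 \<Longrightarrow> cmod (g z) \<le> C / (1 + cmod z)"
    using f unfolding db_tame_def g_def by blast
  have gc: "continuous_on ?U g"
    unfolding g_def[abs_def]
    using holomorphic_on_imp_continuous_on[OF hol] holomorphic_on_imp_continuous_on[OF E_hol] E_nz
    by (intro continuous_intros) (auto intro: continuous_on_subset)
  have hc: "continuous_on (?U - {w}) h"
    unfolding h_def[abs_def] using continuous_on_subset[OF gc] by (intro continuous_intros) auto
  have intU: "z \<in> interior ?U \<Longrightarrow> Im z \<ge> 0" for z using interior_subset by blast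
  have wint: "w \<in> interior ?U"
  proof -
    have "open {z. Im z > 0}" by (intro open_Collect_less continuous_intros)
    then have "{z. Im z > 0} \<subseteq> interior ?U" by (rule interior_maximal[rotated]) auto
    then show ?thesis using w by auto
  qed
  have gd: "g field_differentiable at z" if "z \<in> interior ?U" for z
    unfolding g_def[abs_def] using E_nz[OF intU[OF that]] hol E_hol
    by (intro field_differentiable_divide) (auto intro: holomorphic_on_imp_differentiable_at[of _ UNIV])
  have I2: "integrable lborel (\<lambda>t. (rvalue f t)\<^sup>2)"
    using rvalue_mult_integrable[OF f f] by (simp add: power2_eq_square)
  have est: "2 * pi * cmod (g w) \<le> (\<epsilon> + \<epsilon> * (pi / ?\<eta>)) / 2 + 8 * C / R" if R: "R \<ge> 2 * cmod w + 1" for R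
  proof -
    have Rpos: "R > 0" using R norm_ge_zero[of w] by linarith
    have wR: "\<bar>Re w\<bar> < R" "Im w < R" using abs_Re_le_cmod[of w] abs_Im_le_cmod[of w] R norm_ge_zero[of w] by linarith+
    let ?\<gamma> = "rectpath (Complex (-R) 0) (Complex R R)"
    have wbox: "w \<in> box (Complex (-R) 0) (Complex R R)" using wR w by (auto simp: in_box_complex_iff)
    have pim: "path_image ?\<gamma> = cbox (Complex (-R) 0) (Complex R R) - box (Complex (-R) 0) (Complex R R)"
      using Rpos by (intro path_image_rectpath_cbox_minus_box) auto
    have "((\<lambda>z. g z / (z - w)) has_contour_integral (2 * pi * \<i> * winding_number ?\<gamma> w * g w)) ?\<gamma>"
    proof (rule Cauchy_integral_formula_weak[where S = ?U and k = "{}"])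
      show "path_image ?\<gamma> \<subseteq> ?U - {w}" using wbox unfolding pim by (auto simp: in_cbox_complex_iff)
    qed (use gc gd wint convex_halfspace_Im_ge in auto)
    then have cint: "(h has_contour_integral (2 * pi * \<i> * g w)) ?\<gamma>"
      using winding_number_rectpath[OF wbox] by (simp add: h_def[abs_def])
    have far: "cmod (z - w) \<ge> R / 2" if "cmod z \<ge> R" for z
      using that R norm_triangle_ineq2[of z w] norm_ge_zero[of w] by linarith
    have hb: "cmod (h z) \<le> 2 * C / R\<^sup>2" if "Im z \<ge> 0" "cmod z \<ge> R" for z
    proof -
      have "cmod (h z) = cmod (g z) / cmod (z - w)" by (simp add: h_def norm_divide)
      also have "\<dots> \<le> (C / R) / (R / 2)"
      proof (rule frac_le)
        have "C / (1 + cmod z) \<le> C / R" using that Rpos C(1) by (intro divide_left_mono mult_pos_pos) (auto intro: add_pos_nonneg)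
        then show "cmod (g z) \<le> C / R" using C(2)[OF that(1)] by linarith
      qed (use C(1) Rpos far[OF that(2)] in auto)
      also have "\<dots> = 2 * C / R\<^sup>2" by (simp add: power2_eq_square)
      finally show ?thesis .
    qed
    have cont1: "continuous_on {z. Im z \<ge> 0 \<and> cmod z \<ge> R} h"
      using far[of w] Rpos by (intro continuous_on_subset[OF hc]) auto
    have seg0: "closed_segment (Complex (-R) 0) (Complex R 0) \<subseteq> ?U - {w}"
      using w by (subst closed_segment_same_Im) auto
    have B: "cmod (2 * pi * \<i> * g w - contour_integral (linepath (Complex (-R) 0) (Complex R 0)) h) \<le> 4 * R * (2 * C / R\<^sup>2)"
      by (rule contour_integral_rectpath_bound[OF cont1 continuous_on_subset[OF hc seg0] Rpos hb _ cint]) (use C(1) in auto)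
    have lin: "contour_integral (linepath (Complex (-R) 0) (Complex R 0)) h = integral {-R..R} (\<lambda>t. h (of_real t))"
      using Rpos by (subst contour_integral_linepath_Reals_eq) (auto simp: complex_is_Real_iff)
    let ?q = "\<lambda>t. 1 / ((t - ?a)\<^sup>2 + ?\<eta>\<^sup>2)"
    obtain J where J: "(?q has_integral J) {-R..R}" "J \<le> pi / ?\<eta>" by (rule integral_shifted_cauchy_density[OF w Rpos])
    have I2': "((\<lambda>t. (rvalue f t)\<^sup>2) has_integral (LINT t|lborel. (rvalue f t)\<^sup>2)) UNIV"
      by (rule has_integral_integral_lborel[OF I2])
    have I3: "(\<lambda>t. (rvalue f t)\<^sup>2) integrable_on {-R..R}"
      using continuous_on_subset[OF rvalue_cont[OF f]] by (intro integrable_continuous_interval continuous_intros) auto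
    have I3le: "integral {-R..R} (\<lambda>t. (rvalue f t)\<^sup>2) \<le> \<epsilon>\<^sup>2"
    proof -
      have "integral {-R..R} (\<lambda>t. (rvalue f t)\<^sup>2) \<le> integral UNIV (\<lambda>t. (rvalue f t)\<^sup>2)"
        using I3 I2' by (intro integral_subset_le) auto
      then show ?thesis using I2' L2 by (simp add: integral_unique)
    qed
    have "cmod (integral {-R..R} (\<lambda>t. h (of_real t))) \<le> integral {-R..R} (\<lambda>t. ((rvalue f t)\<^sup>2 / \<epsilon> + \<epsilon> * ?q t) / 2)"
    proof (rule Henstock_Kurzweil_Integration.integral_norm_bound_integral)
      show "(\<lambda>t. h (of_real t)) integrable_on {-R..R}"
      proof (rule integrable_continuous_interval)
        show "continuous_on {-R..R} (\<lambda>t. h (of_real t))"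
          using w by (intro continuous_on_compose2[OF hc]) (auto intro!: continuous_intros)
      qed
      show "(\<lambda>t. ((rvalue f t)\<^sup>2 / \<epsilon> + \<epsilon> * ?q t) / 2) integrable_on {-R..R}"
        using I3 J(1) by (intro integrable_on_divide integrable_add integrable_on_mult_right) (auto simp: integrable_on_def)
      fix t :: real
      define u v where "u = \<bar>rvalue f t\<bar>" and "v = 1 / cmod (of_real t - w)"
      have "cmod (h (of_real t)) = cmod (f (of_real t) / E (of_real t)) / cmod (of_real t - w)"
        unfolding h_def g_def by (rule norm_divide)
      also have "\<dots> = u * v" unfolding rvalue_norm[OF f] u_def v_def by simp
      also have "u * v \<le> (u\<^sup>2 / \<epsilon> + \<epsilon> * v\<^sup>2) / 2"
      proof -
        have "0 \<le> (u - \<epsilon> * v)\<^sup>2 / \<epsilon>" using \<epsilon> by simp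
        also have "\<dots> = u\<^sup>2 / \<epsilon> - 2 * (u * v) + \<epsilon> * v\<^sup>2" using \<epsilon> by (simp add: power2_eq_square field_simps)
        finally show ?thesis by simp
      qed
      also have "v\<^sup>2 = ?q t"
        by (simp add: v_def power_divide cmod_power2)
      finally show "cmod (h (of_real t)) \<le> ((rvalue f t)\<^sup>2 / \<epsilon> + \<epsilon> * ?q t) / 2" by (simp add: u_def)
    qed
    also have "\<dots> = (integral {-R..R} (\<lambda>t. (rvalue f t)\<^sup>2) / \<epsilon> + \<epsilon> * J) / 2"
      using I3 J(1) by (intro integral_unique has_integral_divide has_integral_add has_integral_mult_right) (auto simp: integrable_integral)
    also have "\<dots> \<le> (\<epsilon> + \<epsilon> * (pi / ?\<eta>)) / 2"
    proof -
      have "integral {-R..R} (\<lambda>t. (rvalue f t)\<^sup>2) / \<epsilon> \<le> \<epsilon>\<^sup>2 / \<epsilon>" using I3le \<epsilon> by (intro divide_right_mono) auto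
      also have "\<epsilon>\<^sup>2 / \<epsilon> = \<epsilon>" using \<epsilon> by (simp add: power2_eq_square)
      finally have i1: "integral {-R..R} (\<lambda>t. (rvalue f t)\<^sup>2) / \<epsilon> \<le> \<epsilon>" .
      have i2: "\<epsilon> * J \<le> \<epsilon> * (pi / ?\<eta>)" using J(2) \<epsilon> by (intro mult_left_mono) auto
      show ?thesis by (rule divide_right_mono[OF add_mono[OF i1 i2]]) simp
    qed
    finally have main: "cmod (integral {-R..R} (\<lambda>t. h (of_real t))) \<le> (\<epsilon> + \<epsilon> * (pi / ?\<eta>)) / 2" .
    have "4 * R * (2 * C / R\<^sup>2) = 8 * C / R" using Rpos by (simp add: power2_eq_square)
    moreover have "cmod (2 * pi * \<i> * g w) \<le> cmod (2 * pi * \<i> * g w - integral {-R..R} (\<lambda>t. h (of_real t))) + cmod (integral {-R..R} (\<lambda>t. h (of_real t)))"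
      using norm_triangle_ineq[of "2 * pi * \<i> * g w - integral {-R..R} (\<lambda>t. h (of_real t))" "integral {-R..R} (\<lambda>t. h (of_real t))"] by simp
    moreover have "cmod (2 * pi * \<i> * g w) = 2 * pi * cmod (g w)" by (simp add: norm_mult)
    ultimately show ?thesis using B main unfolding lin by linarith
  qed
  have "((\<lambda>R. (\<epsilon> + \<epsilon> * (pi / ?\<eta>)) / 2 + 8 * C / R) \<longlongrightarrow> (\<epsilon> + \<epsilon> * (pi / ?\<eta>)) / 2 + 0) at_top"
    by (intro tendsto_intros tendsto_divide_0[OF tendsto_const] filterlim_at_top_imp_at_infinity filterlim_ident)
  then have "2 * pi * cmod (g w) \<le> (\<epsilon> + \<epsilon> * (pi / ?\<eta>)) / 2 + 0"
    by (rule tendsto_lowerbound) (use est in \<open>auto intro: eventually_mono[OF eventually_ge_at_top[of "2 * cmod w + 1"]]\<close>)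
  then have "2 * pi * cmod (g w) \<le> \<epsilon> * (1 + pi / ?\<eta>) / 2" by (simp add: algebra_simps)
  also have "\<dots> \<le> \<epsilon> * (pi + pi / ?\<eta>) / 2"
    using \<epsilon> pi_ge_two by (intro divide_right_mono mult_left_mono) auto
  also have "\<dots> = 2 * pi * (\<epsilon> * (1 + 1 / ?\<eta>) / 4)" by (simp add: algebra_simps add_divide_distrib)
  finally have "cmod (g w) \<le> \<epsilon> * (1 + 1 / ?\<eta>) / 4" by simp
  moreover have "0 \<le> \<epsilon> * (1 + 1 / ?\<eta>)" using \<epsilon> w by simp
  moreover have "X / 4 \<le> X" if "0 \<le> X" for X :: real using that by simp
  ultimately have "cmod (g w) \<le> \<epsilon> * (1 + 1 / ?\<eta>)" by (meson order_trans)
  then show ?thesis by (simp add: g_def)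
qed

text \<open>
  The bound off the real line blows up like \<open>1 / |Im z|\<close>. On the circle \<open>|z - x| = 1\<close> one has \<open>|(z - x)\<^sup>2 - 1| = 2 |Im z|\<close>,
  which compensates for this; the maximum principle for \<open>f(z) ((z - x)\<^sup>2 - 1)\<close> then bounds \<open>f(x)\<close>.
\<close>

lemma evaluation_bound:
  "\<exists>C>0. \<forall>f \<epsilon>. db_tame f \<longrightarrow> \<epsilon> > 0 \<longrightarrow> (LINT t|lborel. (rvalue f t)\<^sup>2) \<le> \<epsilon>\<^sup>2 \<longrightarrow> \<bar>rvalue f x\<bar> \<le> C * \<epsilon>"
proof -
  let ?x = "of_real x :: complex"
  have "continuous_on (cball ?x 1) E" using holomorphic_on_imp_continuous_on[OF E_hol] continuous_on_subset by blast
  then have "bounded (E ` cball ?x 1)" by (intro compact_imp_bounded compact_continuous_image) auto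
  then obtain K where K: "K > 0" "\<And>z. z \<in> cball ?x 1 \<Longrightarrow> cmod (E z) \<le> K" unfolding bounded_pos by auto
  define C where "C = 4 * K / cmod (E ?x)"
  have "C > 0" using K nz[of x] by (simp add: C_def)
  moreover have "\<bar>rvalue f x\<bar> \<le> C * \<epsilon>"
    if f: "db_tame f" and \<epsilon>: "\<epsilon> > 0" and L2: "(LINT t|lborel. (rvalue f t)\<^sup>2) \<le> \<epsilon>\<^sup>2" for f \<epsilon>
  proof -
    have hol: "f holomorphic_on UNIV" and star: "conj_star f = f" using f by (auto simp: db_tame_def)
    have up: "cmod (f z) \<le> K * (\<epsilon> * (1 + 1 / Im z))" if z: "Im z > 0" "z \<in> cball ?x 1" for z
    proof -
      have "cmod (f z) = cmod (E z) * cmod (f z / E z)" using E_nz[of z] z by (simp add: norm_divide)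
      also have "\<dots> \<le> K * (\<epsilon> * (1 + 1 / Im z))"
        using K(2)[OF z(2)] tame_upper_bound[OF f \<epsilon> L2 z(1)] K(1) by (intro mult_mono) auto
      finally show ?thesis .
    qed
    have both: "cmod (f z) \<le> K * (\<epsilon> * (1 + 1 / \<bar>Im z\<bar>))" if z: "Im z \<noteq> 0" "z \<in> cball ?x 1" for z
    proof (cases "Im z > 0")
      case True then show ?thesis using up z by simp
    next
      case False
      have "cmod (cnj z - ?x) = cmod (z - ?x)" by (metis complex_cnj_complex_of_real complex_cnj_diff complex_mod_cnj)
      then have "cnj z \<in> cball ?x 1" using z(2) by (simp add: dist_norm norm_minus_commute)
      moreover have "cmod (f z) = cmod (f (cnj z))" using star by (metis complex_mod_cnj conj_star_def)
      ultimately show ?thesis using up[of "cnj z"] False z(1) by simp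
    qed
    define h where "h z = f z * ((z - ?x)\<^sup>2 - 1)" for z
    have "cmod (h ?x) \<le> 4 * K * \<epsilon>"
    proof (rule maximum_modulus_frontier[where S = "cball ?x 1" and f = h and \<xi> = ?x])
      show "h holomorphic_on interior (cball ?x 1)"
        unfolding h_def[abs_def] using hol by (intro holomorphic_intros) (auto intro: holomorphic_on_subset)
      show "continuous_on (closure (cball ?x 1)) h"
        unfolding h_def[abs_def] using holomorphic_on_imp_continuous_on[OF hol]
        by (intro continuous_intros) (auto intro: continuous_on_subset)
      fix z assume "z \<in> frontier (cball ?x 1)"
      then have z: "cmod (z - ?x) = 1" by (simp add: frontier_cball sphere_def dist_norm norm_minus_commute)
      then have zc: "z \<in> cball ?x 1" by (simp add: dist_norm norm_minus_commute)
      define \<zeta> where "\<zeta> = z - ?x"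
      have "cmod \<zeta> = 1" using z by (simp add: \<zeta>_def)
      then have "\<zeta> * cnj \<zeta> = 1" using complex_norm_square[of \<zeta>] by simp
      then have "\<zeta>\<^sup>2 - 1 = \<zeta> * (\<zeta> - cnj \<zeta>)" by (simp add: power2_eq_square right_diff_distrib)
      also have "\<zeta> - cnj \<zeta> = of_real (2 * Im z) * \<i>" by (simp add: \<zeta>_def complex_eq_iff)
      finally have n: "cmod (\<zeta>\<^sup>2 - 1) = 2 * \<bar>Im z\<bar>" using z by (simp add: norm_mult \<zeta>_def[symmetric])
      show "cmod (h z) \<le> 4 * K * \<epsilon>"
      proof (cases "Im z = 0")
        case True
        then have "\<zeta>\<^sup>2 - 1 = 0" using n by simp
        then have "h z = 0" by (simp add: h_def \<zeta>_def)
        then show ?thesis using K \<epsilon> by simp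
      next
        case False
        have im: "\<bar>Im z\<bar> \<le> 1" using abs_Im_le_cmod[of "z - ?x"] z by simp
        have "cmod (h z) = cmod (f z) * (2 * \<bar>Im z\<bar>)" by (simp add: h_def norm_mult n[unfolded \<zeta>_def])
        also have "\<dots> \<le> K * (\<epsilon> * (1 + 1 / \<bar>Im z\<bar>)) * (2 * \<bar>Im z\<bar>)"
          using both[OF False zc] by (intro mult_right_mono) auto
        also have "\<dots> = K * \<epsilon> * (2 * \<bar>Im z\<bar> + 2)" using False by (simp add: field_simps)
        also have "\<dots> \<le> K * \<epsilon> * 4" using im K \<epsilon> by (intro mult_left_mono) auto
        finally show ?thesis by simp
      qed
    qed auto
    then have fx: "cmod (f ?x) \<le> 4 * K * \<epsilon>" by (simp add: h_def norm_mult)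
    have "\<bar>rvalue f x\<bar> = cmod (f ?x) / cmod (E ?x)" using rvalue_norm[OF f, of x] by (simp add: norm_divide)
    also have "\<dots> \<le> 4 * K * \<epsilon> / cmod (E ?x)" using fx by (intro divide_right_mono) auto
    finally show ?thesis by (simp add: C_def)
  qed
  ultimately show ?thesis by blast
qed

end

section \<open>Expansion of the kernel in the basis\<close>

context de_branges
begin

lemma db_tame_normalized_kernel: "db_tame (normalized_kernel E w)"
  unfolding normalized_kernel_eq[abs_def] by (rule db_tame_cmult[OF db_tame_kern])

lemma rvalue_normalized_kernel: "rvalue (normalized_kernel E w) t = rkernel w t"
  using nz[of t] by (simp add: rvalue_def normalized_kernel_real)

lemma rvalue_kern: "rvalue (kern y) t = cmod (E (of_real y)) * phase_sinc \<phi> t y / pi"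
  using nz[of t] by (simp add: rvalue_def kern_real)

lemma db_inner_tame:
  assumes "db_tame f" "db_tame g"
  shows "db_inner E f g = of_real (LINT t|lborel. rvalue f t * rvalue g t)"
proof -
  have A: "f (of_real t) * cnj (g (of_real t)) / of_real ((cmod (E (of_real t)))\<^sup>2) = of_real (rvalue f t * rvalue g t)" for t
    using nz[of t] unfolding db_tame_real[OF assms(1), of t] db_tame_real[OF assms(2), of t]
    by (simp add: power2_eq_square)
  show ?thesis unfolding db_inner_def A by (rule integral_complex_of_real)
qed

definition residual :: "(complex \<Rightarrow> complex) \<Rightarrow> ('i \<Rightarrow> complex \<Rightarrow> complex) \<Rightarrow> 'i set \<Rightarrow> ('i \<Rightarrow> real) \<Rightarrow> complex \<Rightarrow> complex" where
  "residual f e J d z = f z - (\<Sum>n\<in>J. of_real (d n) * e n z)"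

lemma db_tame_residual:
  "db_tame f \<Longrightarrow> finite J \<Longrightarrow> (\<And>n. n \<in> J \<Longrightarrow> db_tame (e n)) \<Longrightarrow> db_tame (residual f e J d)"
  unfolding residual_def[abs_def] by (intro db_tame_diff db_tame_sum) auto

lemma rvalue_residual: "rvalue (residual f e J d) t = rvalue f t - (\<Sum>n\<in>J. d n * rvalue (e n) t)"
  by (simp add: rvalue_def residual_def diff_divide_distrib sum_divide_distrib)

lemma residual_norm:
  assumes f: "db_tame f" and J: "finite J" and e: "\<And>n. n \<in> J \<Longrightarrow> db_tame (e n)"
    and on: "\<And>m n. m \<in> J \<Longrightarrow> n \<in> J \<Longrightarrow> (LINT t|lborel. rvalue (e m) t * rvalue (e n) t) = (if m = n then 1 else 0)"
  shows "(LINT t|lborel. (rvalue (residual f e J d) t)\<^sup>2)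
    = (LINT t|lborel. (rvalue f t)\<^sup>2) - 2 * (\<Sum>n\<in>J. d n * (LINT t|lborel. rvalue f t * rvalue (e n) t)) + (\<Sum>n\<in>J. (d n)\<^sup>2)"
proof -
  let ?v = "\<lambda>n t. rvalue (e n) t"
  have i1: "integrable lborel (\<lambda>t. (rvalue f t)\<^sup>2)" using rvalue_mult_integrable[OF f f] by (simp add: power2_eq_square)
  have i2: "integrable lborel (\<lambda>t. d n * (rvalue f t * ?v n t))" if "n \<in> J" for n
    by (intro integrable_mult_right rvalue_mult_integrable f e that)
  have i3: "integrable lborel (\<lambda>t. d m * d n * (?v m t * ?v n t))" if "m \<in> J" "n \<in> J" for m n
    by (intro integrable_mult_right rvalue_mult_integrable e that)
  have "(rvalue (residual f e J d) t)\<^sup>2 = (rvalue f t)\<^sup>2 - 2 * (\<Sum>n\<in>J. d n * (rvalue f t * ?v n t))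
      + (\<Sum>m\<in>J. \<Sum>n\<in>J. d m * d n * (?v m t * ?v n t))" for t
    unfolding rvalue_residual power2_diff
    by (simp add: power2_eq_square sum_product sum_distrib_left mult_ac)
  then have "(LINT t|lborel. (rvalue (residual f e J d) t)\<^sup>2) = (LINT t|lborel. (rvalue f t)\<^sup>2)
      - 2 * (LINT t|lborel. (\<Sum>n\<in>J. d n * (rvalue f t * ?v n t)))
      + (LINT t|lborel. (\<Sum>m\<in>J. \<Sum>n\<in>J. d m * d n * (?v m t * ?v n t)))"
    using i1 i2 i3 by (simp add: Bochner_Integration.integrable_sum)
  also have "(LINT t|lborel. (\<Sum>n\<in>J. d n * (rvalue f t * ?v n t))) = (\<Sum>n\<in>J. d n * (LINT t|lborel. rvalue f t * ?v n t))"
    by (subst Bochner_Integration.integral_sum) (auto intro: i2 rvalue_mult_integrable f e simp: integral_mult_right_zero)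
  also have "(LINT t|lborel. (\<Sum>m\<in>J. \<Sum>n\<in>J. d m * d n * (?v m t * ?v n t))) = (\<Sum>m\<in>J. \<Sum>n\<in>J. d m * d n * (LINT t|lborel. ?v m t * ?v n t))"
    by (subst Bochner_Integration.integral_sum, intro Bochner_Integration.integrable_sum i3, assumption, assumption,
        intro sum.cong refl, subst Bochner_Integration.integral_sum) (auto intro: i3 rvalue_mult_integrable e)
  also have "\<dots> = (\<Sum>m\<in>J. \<Sum>n\<in>J. if n = m then (d m)\<^sup>2 else 0)"
    by (intro sum.cong refl) (auto simp: on power2_eq_square)
  also have "\<dots> = (\<Sum>n\<in>J. (d n)\<^sup>2)" using J by simp
  finally show ?thesis .
qed

text \<open>
  The definition of an orthonormal basis allows complex coefficients. Their real parts approximate at least as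
  well, since all functions involved are real on the real line.
\<close>

lemma db_norm_ge_real_part:
  assumes f: "db_tame f" and J: "finite J" and e: "\<And>n. n \<in> J \<Longrightarrow> db_tame (e n)"
  shows "(LINT t|lborel. (rvalue (residual f e J (\<lambda>n. Re (c n))) t)\<^sup>2) \<le> (db_norm E (\<lambda>z. f z - (\<Sum>n\<in>J. c n * e n z)))\<^sup>2"
proof -
  let ?p = "\<lambda>t. rvalue (residual f e J (\<lambda>n. Re (c n))) t"
  let ?q = "\<lambda>t. rvalue (residual (\<lambda>z. 0) e J (\<lambda>n. Im (c n))) t"
  have z: "db_tame (\<lambda>z. 0)" using db_tame_sum[of "{}"] by simp
  have i: "integrable lborel (\<lambda>t. (?p t)\<^sup>2)" "integrable lborel (\<lambda>t. (?q t)\<^sup>2)"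
    unfolding power2_eq_square by (intro rvalue_mult_integrable db_tame_residual f z J e, assumption+)+
  have eq: "(cmod ((f (of_real t) - (\<Sum>n\<in>J. c n * e n (of_real t))) / E (of_real t)))\<^sup>2 = (?p t)\<^sup>2 + (?q t)\<^sup>2" for t
  proof -
    let ?r = "cmod (E (of_real t))"
    have e': "e n (of_real t) = of_real (rvalue (e n) t) * of_real ?r" if "n \<in> J" for n
      using db_tame_real[OF e[OF that], of t] by simp
    have "f (of_real t) - (\<Sum>n\<in>J. c n * e n (of_real t)) = of_real ?r * (of_real (rvalue f t) - (\<Sum>n\<in>J. c n * of_real (rvalue (e n) t)))"
      using db_tame_real[OF f, of t] by (simp add: e' right_diff_distrib sum_distrib_left mult_ac)
    also have "of_real (rvalue f t) - (\<Sum>n\<in>J. c n * of_real (rvalue (e n) t)) = Complex (?p t) (?q t)"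
      by (simp add: complex_eq_iff rvalue_residual) (simp add: rvalue_def)
    finally have "cmod ((f (of_real t) - (\<Sum>n\<in>J. c n * e n (of_real t))) / E (of_real t)) = cmod (Complex (?p t) (?q t))"
      using nz[of t] by (simp add: norm_mult norm_divide)
    then show ?thesis by (simp add: cmod_power2)
  qed
  have "(LINT t|lborel. (?p t)\<^sup>2) \<le> (LINT t|lborel. (?p t)\<^sup>2 + (?q t)\<^sup>2)"
    using i by (intro integral_mono) auto
  also have "\<dots> = (db_norm E (\<lambda>z. f z - (\<Sum>n\<in>J. c n * e n z)))\<^sup>2"
    unfolding db_norm_def eq by (simp add: integral_nonneg_AE)
  finally show ?thesis .
qed

text \<open>
  The coefficients \<open>b n\<close> of the orthogonal projection do at least as well as any others, on every index set
  \<open>J'\<close> that contains \<open>J\<close>. By the evaluation bound, the expansion of \<open>kern y\<close> with these coefficients converges pointwise. At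
  the point \<open>\<omega> m\<close> only the \<open>m\<close>-th term is nonzero, which identifies \<open>b m\<close>.
\<close>

lemma phase_sinc_expansion:
  assumes kb: "kernel_orthonormal_basis E \<phi> I \<omega>" and \<epsilon>: "\<epsilon> > 0"
  shows "\<exists>J. finite J \<and> J \<subseteq> I \<and> (\<forall>J'. finite J' \<longrightarrow> J \<subseteq> J' \<longrightarrow> J' \<subseteq> I \<longrightarrow>
    \<bar>(\<Sum>n\<in>J'. rkernel (\<omega> n) x * rkernel (\<omega> n) y) - phase_sinc \<phi> x y / pi\<bar> \<le> \<epsilon>)"
proof -
  define e where "e n = normalized_kernel E (\<omega> n)" for n
  have te: "db_tame (e n)" for n by (simp add: e_def db_tame_normalized_kernel)
  have re: "rvalue (e n) t = rkernel (\<omega> n) t" for n t by (simp add: e_def rvalue_normalized_kernel)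
  have tf: "db_tame (kern y)" by (rule db_tame_kern)
  obtain \<alpha> where \<omega>: "\<And>n. n \<in> I \<Longrightarrow> \<phi> (\<omega> n) = \<alpha> + pi * of_int n"
    using kb unfolding kernel_orthonormal_basis_def by blast
  have ob: "db_orthonormal_basis E I e"
    using kb unfolding kernel_orthonormal_basis_def e_def[abs_def] by blast
  have on: "(LINT t|lborel. rvalue (e m) t * rvalue (e n) t) = (if m = n then 1 else 0)" if "m \<in> I" "n \<in> I" for m n
  proof -
    have "db_inner E (e m) (e n) = (if m = n then 1 else 0)" using ob that unfolding db_orthonormal_basis_def by blast
    then show ?thesis unfolding db_inner_tame[OF te te] by (auto split: if_splits)
  qed
  define b where "b n = (LINT t|lborel. rvalue (kern y) t * rvalue (e n) t)" for n
  define Q where "Q J d = (LINT t|lborel. (rvalue (residual (kern y) e J d) t)\<^sup>2)" for J d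
  define U where "U = (LINT t|lborel. (rvalue (kern y) t)\<^sup>2)"
  have QE: "Q J d = U - 2 * (\<Sum>n\<in>J. d n * b n) + (\<Sum>n\<in>J. (d n)\<^sup>2)" if "finite J" "J \<subseteq> I" for J d
    unfolding Q_def U_def b_def
    by (rule residual_norm[OF tf that(1) te]) (rule on; use that(2) in blast)
  \<comment> \<open>Pythagoras: completing the square, \<open>Q J d\<close> exceeds \<open>Q J b\<close> by the squared distance of the coefficients, and
    \<open>Q J b\<close> decreases in \<open>J\<close>.\<close>
  have best: "Q J' b \<le> Q J d" if J: "finite J'" "J \<subseteq> J'" "J' \<subseteq> I" for J J' d
  proof -
    have fJ: "finite J" "J \<subseteq> I" using J finite_subset by auto
    have "Q J d = U + (\<Sum>n\<in>J. (d n - b n)\<^sup>2) - (\<Sum>n\<in>J. (b n)\<^sup>2)"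
      unfolding QE[OF fJ] by (simp add: power2_diff sum.distrib sum_subtractf sum_distrib_left mult_ac)
    moreover have "Q J' b = U - (\<Sum>n\<in>J'. (b n)\<^sup>2)"
      unfolding QE[OF J(1,3)] by (simp add: power2_eq_square)
    moreover have "(\<Sum>n\<in>J. (b n)\<^sup>2) \<le> (\<Sum>n\<in>J'. (b n)\<^sup>2)" using J by (intro sum_mono2) auto
    moreover have "(\<Sum>n\<in>J. (d n - b n)\<^sup>2) \<ge> 0" by (intro sum_nonneg) auto
    ultimately show ?thesis by linarith
  qed
  have approx: "\<exists>J. finite J \<and> J \<subseteq> I \<and> (\<forall>J'. finite J' \<longrightarrow> J \<subseteq> J' \<longrightarrow> J' \<subseteq> I \<longrightarrow> Q J' b \<le> \<epsilon>\<^sup>2)" if \<epsilon>: "\<epsilon> > 0" for \<epsilon>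
  proof -
    have "kern y \<in> de_branges_space E" by (rule db_tame_in_space[OF tf])
    then obtain J c where J: "finite J" "J \<subseteq> I" "db_norm E (\<lambda>z. kern y z - (\<Sum>n\<in>J. c n * e n z)) < \<epsilon>"
      using ob \<epsilon> unfolding db_orthonormal_basis_def by meson
    have "Q J (\<lambda>n. Re (c n)) \<le> (db_norm E (\<lambda>z. kern y z - (\<Sum>n\<in>J. c n * e n z)))\<^sup>2"
      unfolding Q_def by (rule db_norm_ge_real_part[OF tf J(1) te])
    also have "\<dots> \<le> \<epsilon>\<^sup>2" using J(3) by (intro power_mono) (auto simp: db_norm_def intro!: integral_nonneg_AE)
    finally show ?thesis using J best by (meson order_trans)
  qed
  have pointwise: "\<exists>J. finite J \<and> J \<subseteq> I \<and> (\<forall>J'. finite J' \<longrightarrow> J \<subseteq> J' \<longrightarrow> J' \<subseteq> I \<longrightarrow>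
      \<bar>rvalue (kern y) t - (\<Sum>n\<in>J'. b n * rkernel (\<omega> n) t)\<bar> \<le> \<epsilon>)" if \<epsilon>: "\<epsilon> > 0" for t \<epsilon>
  proof -
    obtain C where C: "C > 0" "\<And>f \<epsilon>. db_tame f \<Longrightarrow> \<epsilon> > 0 \<Longrightarrow> (LINT t|lborel. (rvalue f t)\<^sup>2) \<le> \<epsilon>\<^sup>2 \<Longrightarrow> \<bar>rvalue f t\<bar> \<le> C * \<epsilon>"
      using evaluation_bound[of t] by blast
    have e2: "\<epsilon> / C > 0" using \<epsilon> C(1) by simp
    obtain J where J: "finite J" "J \<subseteq> I" "\<And>J'. finite J' \<Longrightarrow> J \<subseteq> J' \<Longrightarrow> J' \<subseteq> I \<Longrightarrow> Q J' b \<le> (\<epsilon> / C)\<^sup>2"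
      using approx[OF e2] by blast
    have "\<bar>rvalue (kern y) t - (\<Sum>n\<in>J'. b n * rkernel (\<omega> n) t)\<bar> \<le> \<epsilon>" if J': "finite J'" "J \<subseteq> J'" "J' \<subseteq> I" for J'
    proof -
      have "\<bar>rvalue (residual (kern y) e J' b) t\<bar> \<le> C * (\<epsilon> / C)"
        by (rule C(2)[OF db_tame_residual[OF tf J'(1) te] e2]) (use J(3)[OF J'] in \<open>simp add: Q_def\<close>)
      then show ?thesis using C(1) by (simp add: rvalue_residual re)
    qed
    then show ?thesis using J(1,2) by blast
  qed
  have rkernel_diag: "rkernel (\<omega> m) (\<omega> m) = sqrt (deriv \<phi> (\<omega> m) / pi)" for m
  proof -
    define d where "d = deriv \<phi> (\<omega> m)"
    have "d > 0" using deriv_\<phi>_pos by (simp add: d_def)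
    then have "d / sqrt (pi * d) = sqrt (d / pi)"
      by (simp add: real_sqrt_mult real_sqrt_divide real_div_sqrt divide_divide_eq_left[symmetric] mult.commute[of "sqrt pi"])
    then show ?thesis by (simp add: rkernel_def phase_sinc_def d_def)
  qed
  have rkernel_off: "rkernel (\<omega> n) (\<omega> m) = 0" if mn: "m \<in> I" "n \<in> I" "m \<noteq> n" for m n
  proof -
    have "\<phi> (\<omega> m) - \<phi> (\<omega> n) = pi * of_int (m - n)" using \<omega> mn by (simp add: algebra_simps)
    then have "sin (\<phi> (\<omega> m) - \<phi> (\<omega> n)) = 0" unfolding sin_zero_iff_int2 by (intro exI[of _ "m - n"]) simp
    moreover have "\<omega> m \<noteq> \<omega> n" using \<omega>[OF mn(1)] \<omega>[OF mn(2)] mn(3) by auto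
    ultimately show ?thesis by (simp add: rkernel_def phase_sinc_def)
  qed
  have bE: "b m = cmod (E (of_real y)) * rkernel (\<omega> m) y" if m: "m \<in> I" for m
  proof -
    have "\<bar>rvalue (kern y) (\<omega> m) - b m * rkernel (\<omega> m) (\<omega> m)\<bar> \<le> \<delta>" if \<delta>: "\<delta> > 0" for \<delta>
    proof -
      obtain J where J: "finite J" "J \<subseteq> I" "\<And>J'. finite J' \<Longrightarrow> J \<subseteq> J' \<Longrightarrow> J' \<subseteq> I \<Longrightarrow>
          \<bar>rvalue (kern y) (\<omega> m) - (\<Sum>n\<in>J'. b n * rkernel (\<omega> n) (\<omega> m))\<bar> \<le> \<delta>"
        using pointwise[OF \<delta>, of "\<omega> m"] by (elim exE conjE) simp
      have "(\<Sum>n\<in>insert m J. b n * rkernel (\<omega> n) (\<omega> m)) = (\<Sum>n\<in>insert m J. if n = m then b m * rkernel (\<omega> m) (\<omega> m) else 0)"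
        using J(2) m rkernel_off by (intro sum.cong) auto
      also have "\<dots> = b m * rkernel (\<omega> m) (\<omega> m)" using J(1) by simp
      finally show ?thesis using J(3)[of "insert m J"] J(1,2) m by auto
    qed
    then have "\<bar>rvalue (kern y) (\<omega> m) - b m * rkernel (\<omega> m) (\<omega> m)\<bar> \<le> 0" by (rule field_le_epsilon) simp
    then have eq: "b m * rkernel (\<omega> m) (\<omega> m) = cmod (E (of_real y)) * phase_sinc \<phi> (\<omega> m) y / pi" by (simp add: rvalue_kern)
    let ?d = "deriv \<phi> (\<omega> m)"
    have d: "?d > 0" by (rule deriv_\<phi>_pos)
    have "cmod (E (of_real y)) * rkernel (\<omega> m) y * rkernel (\<omega> m) (\<omega> m) = cmod (E (of_real y)) * phase_sinc \<phi> (\<omega> m) y / pi"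
    proof -
      have "sqrt (?d / pi) / sqrt (pi * ?d) = 1 / pi"
        using d by (simp add: real_sqrt_mult real_sqrt_divide)
      then show ?thesis unfolding rkernel_diag by (simp add: rkernel_def phase_sinc_commute[of y] field_simps)
    qed
    then have "b m * rkernel (\<omega> m) (\<omega> m) = cmod (E (of_real y)) * rkernel (\<omega> m) y * rkernel (\<omega> m) (\<omega> m)" using eq by simp
    moreover have "rkernel (\<omega> m) (\<omega> m) \<noteq> 0" unfolding rkernel_diag using d by simp
    ultimately show ?thesis by simp
  qed
  define r where "r = cmod (E (of_real y))"
  have r: "r > 0" using nz[of y] by (simp add: r_def)
  obtain J where J: "finite J" "J \<subseteq> I" "\<And>J'. finite J' \<Longrightarrow> J \<subseteq> J' \<Longrightarrow> J' \<subseteq> I \<Longrightarrow>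
      \<bar>rvalue (kern y) x - (\<Sum>n\<in>J'. b n * rkernel (\<omega> n) x)\<bar> \<le> r * \<epsilon>"
    using pointwise[OF mult_pos_pos[OF r \<epsilon>], of x] by (elim exE conjE) simp
  have "\<bar>(\<Sum>n\<in>J'. rkernel (\<omega> n) x * rkernel (\<omega> n) y) - phase_sinc \<phi> x y / pi\<bar> \<le> \<epsilon>"
    if J': "finite J'" "J \<subseteq> J'" "J' \<subseteq> I" for J'
  proof -
    have "(\<Sum>n\<in>J'. b n * rkernel (\<omega> n) x) = r * (\<Sum>n\<in>J'. rkernel (\<omega> n) x * rkernel (\<omega> n) y)"
      unfolding sum_distrib_left using J'(3) by (intro sum.cong) (auto simp: bE r_def)
    then have "r * \<bar>phase_sinc \<phi> x y / pi - (\<Sum>n\<in>J'. rkernel (\<omega> n) x * rkernel (\<omega> n) y)\<bar> \<le> r * \<epsilon>"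
      using J(3)[OF J'] r by (simp add: rvalue_kern r_def[symmetric] abs_mult right_diff_distrib[symmetric] flip: times_divide_eq_right)
    then show ?thesis using r by (simp add: abs_minus_commute)
  qed
  then show ?thesis using J(1,2) by blast
qed

end

section \<open>Convergence of the GAF on the real line\<close>

lemma abel_inequality:
  fixes t \<nu> :: "nat \<Rightarrow> real"
  assumes mn: "m \<le> n" and part: "\<And>j. m \<le> j \<Longrightarrow> j \<le> n \<Longrightarrow> \<bar>\<Sum>k=m..<j. t k\<bar> \<le> \<epsilon>"
    and dec: "\<And>k. m \<le> k \<Longrightarrow> \<nu> (Suc k) \<le> \<nu> k" and nonneg: "\<And>k. m \<le> k \<Longrightarrow> 0 \<le> \<nu> k"
  shows "\<bar>\<Sum>k=m..<n. t k * \<nu> k\<bar> \<le> \<epsilon> * \<nu> m"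
proof -
  define P where "P j = (\<Sum>k=m..<j. t k)" for j
  have parts: "(\<Sum>k=m..<n. t k * \<nu> k) = P n * \<nu> n + (\<Sum>k=m..<n. P (Suc k) * (\<nu> k - \<nu> (Suc k)))"
    using mn by (induction n rule: dec_induct) (simp_all add: P_def algebra_simps)
  have "\<bar>P n * \<nu> n + (\<Sum>k=m..<n. P (Suc k) * (\<nu> k - \<nu> (Suc k)))\<bar>
      \<le> \<epsilon> * \<nu> n + (\<Sum>k=m..<n. \<epsilon> * (\<nu> k - \<nu> (Suc k)))"
  proof (intro order_trans[OF abs_triangle_ineq] add_mono order_trans[OF sum_abs] sum_mono)
    show "\<bar>P n * \<nu> n\<bar> \<le> \<epsilon> * \<nu> n"
      unfolding abs_mult using part[of n] mn nonneg[OF mn] by (intro mult_mono) (auto simp: P_def)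
    fix k assume "k \<in> {m..<n}"
    then show "\<bar>P (Suc k) * (\<nu> k - \<nu> (Suc k))\<bar> \<le> \<epsilon> * (\<nu> k - \<nu> (Suc k))"
      unfolding abs_mult using part[of "Suc k"] dec[of k] by (intro mult_mono) (auto simp: P_def)
  qed
  also have "\<dots> = \<epsilon> * \<nu> m"
    using mn by (induction n rule: dec_induct) (simp_all add: algebra_simps)
  finally show ?thesis unfolding parts .
qed

lemma abel_uniform_convergence:
  fixes t :: "nat \<Rightarrow> real" and \<nu> :: "nat \<Rightarrow> 'a \<Rightarrow> real"
  assumes t: "summable t"
    and \<nu>: "\<And>n x. n \<ge> n0 \<Longrightarrow> x \<in> S \<Longrightarrow> 0 \<le> \<nu> (Suc n) x \<and> \<nu> (Suc n) x \<le> \<nu> n x \<and> \<nu> n x \<le> 1"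
  shows "uniformly_convergent_on S (\<lambda>N x. \<Sum>n<N. t n * \<nu> n x)"
  unfolding uniformly_convergent_eq_Cauchy
proof (rule uniformly_Cauchy_onI')
  fix e :: real assume e: "e > 0"
  have "Cauchy (\<lambda>N. \<Sum>n<N. t n)" using t by (simp add: summable_iff_convergent Cauchy_convergent_iff)
  then obtain M where M: "\<And>m n. m \<ge> M \<Longrightarrow> n \<ge> M \<Longrightarrow> dist (\<Sum>n<m. t n) (\<Sum>n<n. t n) < e / 2"
    using e unfolding Cauchy_def by (metis half_gt_zero)
  have split: "(\<Sum>k<n. f k) - (\<Sum>k<m. f k) = (\<Sum>k=m..<n. f k)" if "m \<le> n" for m n and f :: "nat \<Rightarrow> real"
    using that by (simp add: lessThan_atLeast0 sum_diff_nat_ivl)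
  have "dist (\<Sum>k<m. t k * \<nu> k x) (\<Sum>k<n. t k * \<nu> k x) < e"
    if x: "x \<in> S" and m: "m \<ge> max M (Suc n0)" and n: "n > m" for x m n
  proof -
    have "\<bar>\<Sum>k=m..<n. t k * \<nu> k x\<bar> \<le> e / 2 * \<nu> m x"
    proof (rule abel_inequality)
      fix j assume "m \<le> j" "j \<le> n"
      then show "\<bar>\<Sum>k=m..<j. t k\<bar> \<le> e / 2"
        using M[of j m] m split[of m j t] by (simp add: dist_real_def)
    next
      fix k assume k: "m \<le> k"
      then obtain k' where "k = Suc k'" "k' \<ge> n0" using m by (cases k) auto
      then show "\<nu> (Suc k) x \<le> \<nu> k x" "0 \<le> \<nu> k x" using \<nu>[of k x] \<nu>[of k' x] x by auto
    qed (use n in auto)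
    also have "\<dots> \<le> e / 2" using \<nu>[of m x] x m e by (simp add: mult_left_le)
    finally show ?thesis using split[of m n "\<lambda>k. t k * \<nu> k x"] n e by (simp add: dist_real_def abs_minus_commute)
  qed
  then show "\<exists>M. \<forall>x\<in>S. \<forall>m\<ge>M. \<forall>n>m. dist (\<Sum>k<m. t k * \<nu> k x) (\<Sum>k<n. t k * \<nu> k x) < e" by blast
qed

lemma sum_inter_image:
  assumes "inj \<iota>"
  shows "(\<Sum>i\<in>I \<inter> \<iota> ` {..<N::nat}. f i) = (\<Sum>n<N. if \<iota> n \<in> I then f (\<iota> n) else 0)"
proof -
  have "(\<Sum>i\<in>I \<inter> \<iota> ` {..<N}. f i) = (\<Sum>i\<in>\<iota> ` {..<N}. if i \<in> I then f i else 0)"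
    by (subst Int_commute, rule sum.inter_restrict) simp
  also have "\<dots> = (\<Sum>n<N. if \<iota> n \<in> I then f (\<iota> n) else 0)"
    using assms by (subst sum.reindex) (auto simp: inj_on_def)
  finally show ?thesis .
qed

context de_branges
begin

text \<open>
  One half of the index set is run through by \<open>\<iota> n = \<plusminus>n + k\<close>, and \<open>\<sigma> = \<plusminus>1\<close> reflects the line so that the points
  \<open>w n = \<sigma> \<omega>(\<iota> n)\<close> increase. Since \<open>sin (\<phi>(x) - \<phi>(\<omega>\<^sub>n)) = (-1)\<^sup>n sin (\<phi>(x) - \<alpha>)\<close>, the \<open>n\<close>-th term at \<open>x\<close> is the one at \<open>x0\<close>
  times \<open>s x (1 + \<sigma> (x - x0) \<nu> n x)\<close> with \<open>\<nu> n x = 1 / (w n - \<sigma> x)\<close>. For large \<open>n\<close> this is positive and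
  decreasing in \<open>n\<close>, and Abel summation applies. The index \<open>n0\<close> is chosen past the points near \<open>{-L..L}\<close> and such
  that the indices \<open>n \<ge> n0\<close> with \<open>\<iota> n \<in> I\<close> form an initial segment, because \<open>\<omega>\<close> is meaningless off \<open>I\<close>.
\<close>

lemma half_series_continuous:
  fixes \<omega> :: "int \<Rightarrow> real" and b :: "int \<Rightarrow> real"
  assumes I: "I = {n. \<exists>x. \<phi> x = \<alpha> + pi * of_int n}" and \<omega>: "\<And>n. n \<in> I \<Longrightarrow> \<phi> (\<omega> n) = \<alpha> + pi * of_int n"
    and x0: "sin (\<phi> x0 - \<alpha>) \<noteq> 0" and sg: "sg = 1 \<or> sg = (-1::int)" and \<iota>: "\<And>n. \<iota> n = sg * int n + k"
    and conv: "convergent (\<lambda>N. \<Sum>i\<in>I \<inter> \<iota> ` {..<N}. b i * rkernel (\<omega> i) x0)"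
  shows "\<exists>h. continuous_on {-L..L} h \<and> (\<forall>x\<in>{-L..L}. (\<lambda>N. \<Sum>i\<in>I \<inter> \<iota> ` {..<N}. b i * rkernel (\<omega> i) x) \<longlonglongrightarrow> h x)"
proof -
  define D where "D = sin (\<phi> x0 - \<alpha>)"
  define \<sigma> where "\<sigma> = real_of_int sg"
  have \<sigma>: "\<sigma> = 1 \<or> \<sigma> = -1" "\<sigma> * \<sigma> = 1" using sg by (auto simp: \<sigma>_def)
  have inj: "inj \<iota>" using sg \<iota> by (auto simp: inj_on_def)
  note reidx = sum_inter_image[OF inj, where I = I]
  define P where "P = {n. \<iota> n \<in> I}"
  define w where "w n = \<sigma> * \<omega> (\<iota> n)" for n
  define t where "t n = (if n \<in> P then b (\<iota> n) * rkernel (\<omega> (\<iota> n)) x0 else 0)" for n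
  have t: "summable t"
    using conv unfolding reidx summable_iff_convergent by (simp add: t_def P_def)
  have \<phi>less: "x < y" if "\<phi> x < \<phi> y" for x y using mono_\<phi> that by (simp add: strict_mono_less)
  have \<phi>\<iota>: "\<phi> (\<omega> (\<iota> n)) = \<alpha> + pi * (\<sigma> * real n + k)" if "n \<in> P" for n
    using \<omega>[of "\<iota> n"] that by (simp add: P_def \<iota> \<sigma>_def)
  have wmono: "w n \<le> w (Suc n)" if "n \<in> P" "Suc n \<in> P" for n
  proof -
    have e: "\<phi> (\<omega> (\<iota> (Suc n))) = \<phi> (\<omega> (\<iota> n)) + pi * \<sigma>"
      unfolding \<phi>\<iota>[OF that(1)] \<phi>\<iota>[OF that(2)] of_nat_Suc by (simp add: algebra_simps)
    show ?thesis using \<sigma>(1)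
    proof
      assume s: "\<sigma> = 1"
      then have "\<phi> (\<omega> (\<iota> n)) < \<phi> (\<omega> (\<iota> (Suc n)))" using e pi_gt_zero by simp
      then have "\<omega> (\<iota> n) < \<omega> (\<iota> (Suc n))" by (rule \<phi>less)
      then show ?thesis by (simp add: w_def s)
    next
      assume s: "\<sigma> = -1"
      then have "\<phi> (\<omega> (\<iota> (Suc n))) < \<phi> (\<omega> (\<iota> n))" using e pi_gt_zero by simp
      then have "\<omega> (\<iota> (Suc n)) < \<omega> (\<iota> n)" by (rule \<phi>less)
      then show ?thesis by (simp add: w_def s)
    qed
  qed
  have interval: "n \<in> I" if "m1 \<in> I" "m2 \<in> I" "m1 \<le> n" "n \<le> m2" for m1 m2 n
  proof -
    have c: "continuous_on {\<omega> m1..\<omega> m2} \<phi>" using smooth_cont[OF smooth_\<phi>, of 0] continuous_on_subset by auto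
    have le: "\<phi> (\<omega> m1) \<le> \<alpha> + pi * of_int n" "\<alpha> + pi * of_int n \<le> \<phi> (\<omega> m2)"
      using that \<omega>[of m1] \<omega>[of m2] by (auto intro!: mult_left_mono)
    then have "\<omega> m1 \<le> \<omega> m2" using mono_\<phi> by (meson order_trans strict_mono_less_eq)
    then show ?thesis using IVT'[OF le _ c] unfolding I by auto
  qed
  obtain n0 where n0: "\<And>n. n \<ge> n0 \<Longrightarrow> Suc n \<in> P \<Longrightarrow> n \<in> P" "\<And>n. n \<ge> n0 \<Longrightarrow> n \<in> P \<Longrightarrow> w n \<ge> L + 1"
  proof -
    obtain m where m: "P \<noteq> {} \<Longrightarrow> m \<in> P" by blast
    \<comment> \<open>From index \<open>R\<close> on, the levels \<open>\<alpha> + \<pi> \<iota> n\<close> lie beyond the values of the phase at \<open>\<plusminus>(L + 1)\<close>. If some index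
      \<open>m\<close> belongs to \<open>P\<close>, then by the intermediate value theorem \<open>P\<close> has no gaps after \<open>m\<close>.\<close>
    define R where "R = (\<bar>\<phi> (L + 1)\<bar> + \<bar>\<phi> (-(L + 1))\<bar> + \<bar>\<alpha>\<bar>) / pi + \<bar>real_of_int k\<bar> + 1"
    obtain r :: nat where r: "R \<le> real r" using real_arch_simple by blast
    show ?thesis
    proof (rule that[of "max m r"])
      fix n assume n: "n \<ge> max m r"
      show "n \<in> P" if "Suc n \<in> P"
      proof -
        have "m \<in> P" using m that by auto
        then have a: "\<iota> m \<in> I" "\<iota> (Suc n) \<in> I" using that by (auto simp: P_def)
        have mn: "int m \<le> int n" using n by simp
        from sg show ?thesis
        proof
          assume s: "sg = 1"
          have "\<iota> n \<in> I" by (rule interval[OF a]) (use s mn in \<open>auto simp: \<iota>\<close>)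
          then show ?thesis by (simp add: P_def)
        next
          assume s: "sg = -1"
          have "\<iota> n \<in> I" by (rule interval[OF a(2,1)]) (use s mn in \<open>auto simp: \<iota>\<close>)
          then show ?thesis by (simp add: P_def)
        qed
      qed
      show "w n \<ge> L + 1" if "n \<in> P"
      proof -
        have "R \<le> real n" using r n by linarith
        then have "(\<bar>\<phi> (L + 1)\<bar> + \<bar>\<phi> (-(L + 1))\<bar> + \<bar>\<alpha>\<bar>) / pi + 1 \<le> real n - \<bar>real_of_int k\<bar>" unfolding R_def by linarith
        then have "(\<bar>\<phi> (L + 1)\<bar> + \<bar>\<phi> (-(L + 1))\<bar> + \<bar>\<alpha>\<bar>) / pi < real n - \<bar>real_of_int k\<bar>" by linarith
        then have big: "\<bar>\<phi> (L + 1)\<bar> + \<bar>\<phi> (-(L + 1))\<bar> + \<bar>\<alpha>\<bar> < pi * (real n - \<bar>real_of_int k\<bar>)"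
          unfolding pos_divide_less_eq[OF pi_gt_zero] by (simp only: mult.commute)
        from \<sigma>(1) show ?thesis
        proof
          assume s: "\<sigma> = 1"
          have "pi * (real n - \<bar>real_of_int k\<bar>) \<le> pi * (\<sigma> * real n + k)" by (intro mult_left_mono) (auto simp: s)
          then have "\<phi> (L + 1) < \<phi> (\<omega> (\<iota> n))" unfolding \<phi>\<iota>[OF that] using big by linarith
          then have "L + 1 < \<omega> (\<iota> n)" by (rule \<phi>less)
          then show ?thesis by (simp add: w_def s)
        next
          assume s: "\<sigma> = -1"
          have "pi * (\<sigma> * real n + k) \<le> pi * (- (real n - \<bar>real_of_int k\<bar>))" by (intro mult_left_mono) (auto simp: s)
          also have "\<dots> = - (pi * (real n - \<bar>real_of_int k\<bar>))" by (rule mult_minus_right)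
          finally have "\<phi> (\<omega> (\<iota> n)) < \<phi> (-(L + 1))" unfolding \<phi>\<iota>[OF that] using big by linarith
          then have "\<omega> (\<iota> n) < -(L + 1)" by (rule \<phi>less)
          then show ?thesis by (simp add: w_def s)
        qed
      qed
    qed
  qed
  define \<nu> where "\<nu> n x = (if n \<in> P \<and> n0 \<le> n then 1 / (w n - \<sigma> * x) else 0)" for n x
  have \<sigma>x: "\<sigma> * x \<le> L" if "x \<in> {-L..L}" for x using \<sigma>(1) that by auto
  have "uniformly_convergent_on {-L..L} (\<lambda>N x. \<Sum>n<N. t n * \<nu> n x)"
  proof (rule abel_uniform_convergence[OF t, of n0])
    fix n x assume n: "n0 \<le> n" and x: "x \<in> {-L..L}"
    note sx = \<sigma>x[OF x]
    show "0 \<le> \<nu> (Suc n) x \<and> \<nu> (Suc n) x \<le> \<nu> n x \<and> \<nu> n x \<le> 1"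
    proof (cases "Suc n \<in> P")
      case True
      then have P: "n \<in> P" using n0(1) n by blast
      have "w n - \<sigma> * x \<ge> 1" "w (Suc n) - \<sigma> * x \<ge> w n - \<sigma> * x"
        using n0(2)[OF n P] wmono[OF P True] sx by linarith+
      then show ?thesis using True P n by (auto simp: \<nu>_def intro!: divide_left_mono)
    next
      case False
      have "w n - \<sigma> * x \<ge> 1" if "n \<in> P" using n0(2)[OF n that] sx by linarith
      then show ?thesis using False n by (auto simp: \<nu>_def)
    qed
  qed
  then obtain V where V: "uniform_limit {-L..L} (\<lambda>N x. \<Sum>n<N. t n * \<nu> n x) V sequentially"
    by (auto simp: uniformly_convergent_on_def)
  have "continuous_on {-L..L} (\<nu> n)" for n
  proof (cases "n \<in> P \<and> n0 \<le> n")
    case True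
    then have "w n - \<sigma> * x \<noteq> 0" if "x \<in> {-L..L}" for x using n0(2)[of n] \<sigma>x[OF that] by auto
    moreover have "\<nu> n = (\<lambda>x. 1 / (w n - \<sigma> * x))" using True by (auto simp: \<nu>_def fun_eq_iff)
    ultimately show ?thesis by (auto intro!: continuous_intros)
  next
    case False
    then have "\<nu> n = (\<lambda>x. 0)" by (auto simp: \<nu>_def fun_eq_iff)
    then show ?thesis by simp
  qed
  then have Vc: "continuous_on {-L..L} V"
    by (intro uniform_limit_theorem[OF _ V]) (auto intro!: always_eventually continuous_intros)
  have Vlim: "(\<lambda>N. \<Sum>n<N. t n * \<nu> n x) \<longlonglongrightarrow> V x" if "x \<in> {-L..L}" for x
    using tendsto_uniform_limitI[OF V that] .
  define p where "p n x = (if n \<in> P then b (\<iota> n) * rkernel (\<omega> (\<iota> n)) x else 0)" for n x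
  define s where "s x = sin (\<phi> x - \<alpha>) / D" for x
  have key: "p n x = s x * t n + s x * (\<sigma> * (x - x0)) * (t n * \<nu> n x)" if n: "n0 \<le> n" and x: "x \<in> {-L..L}" for n x
  proof (cases "n \<in> P")
    case True
    define q where "q = \<omega> (\<iota> n)"
    have qI: "\<phi> q = \<alpha> + pi * of_int (\<iota> n)" using \<omega>[of "\<iota> n"] True by (simp add: P_def q_def)
    have sinq: "sin (\<phi> z - \<phi> q) = sin (\<phi> z - \<alpha>) * cos (pi * of_int (\<iota> n))" for z
    proof -
      have "\<phi> z - \<phi> q = (\<phi> z - \<alpha>) - pi * of_int (\<iota> n)" by (simp add: qI)
      then show ?thesis by (simp only:) (subst sin_diff, simp)
    qed
    have "w n - \<sigma> * x \<noteq> 0" using n0(2)[OF n True] \<sigma>x[OF x] by linarith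
    moreover have wq: "w n - \<sigma> * x = \<sigma> * (q - x)" by (simp add: w_def q_def algebra_simps)
    ultimately have qx: "q \<noteq> x" by auto
    have qx0: "q \<noteq> x0" using sinq[of x0] x0 by (auto split: if_splits)
    have "\<nu> n x = \<sigma> / (q - x)"
    proof -
      have "1 / (\<sigma> * (q - x)) = \<sigma> / (q - x)" using \<sigma>(1) by (auto simp: minus_divide_right)
      then show ?thesis using True n by (simp add: \<nu>_def wq)
    qed
    then have \<nu>E: "\<sigma> * \<nu> n x = 1 / (q - x)" using \<sigma>(2) by (simp add: mult.assoc[symmetric])
    define c where "c = cos (pi * of_int (\<iota> n)) / sqrt (pi * deriv \<phi> q)"
    have g: "rkernel q z = sin (\<phi> z - \<alpha>) * c / (z - q)" if "z \<noteq> q" for z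
      using that by (simp add: rkernel_def phase_sinc_def sinq c_def)
    have D: "D \<noteq> 0" using x0 by (simp add: D_def)
    have "rkernel q x = s x * rkernel q x0 + s x * (x - x0) * (rkernel q x0 * (1 / (q - x)))"
    proof -
      have "x - q \<noteq> 0" "x0 - q \<noteq> 0" "q - x \<noteq> 0" using qx qx0 by auto
      have a: "(1 + (x - x0) * (1 / (q - x))) / (x0 - q) = 1 / (x - q)"
      proof -
        have "1 + (x - x0) * (1 / (q - x)) = (q - x0) / (q - x)" using \<open>q - x \<noteq> 0\<close> by (simp add: field_simps)
        also have "\<dots> = (x0 - q) / (x - q)" by (metis minus_diff_eq minus_divide_divide)
        finally show ?thesis using \<open>x0 - q \<noteq> 0\<close> by simp
      qed
      have "s x * rkernel q x0 + s x * (x - x0) * (rkernel q x0 * (1 / (q - x))) = s x * (D * c) * ((1 + (x - x0) * (1 / (q - x))) / (x0 - q))"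
        using qx0 by (simp add: g D_def[symmetric] algebra_simps add_divide_distrib)
      also have "\<dots> = s x * (D * c) * (1 / (x - q))" unfolding a ..
      also have "\<dots> = rkernel q x" using qx D by (simp add: g s_def)
      finally show ?thesis ..
    qed
    then have "b (\<iota> n) * rkernel q x = b (\<iota> n) * (s x * rkernel q x0 + s x * (x - x0) * (rkernel q x0 * (\<sigma> * \<nu> n x)))"
      unfolding \<nu>E by (rule arg_cong)
    then have "b (\<iota> n) * rkernel q x = s x * (b (\<iota> n) * rkernel q x0) + s x * (x - x0) * (b (\<iota> n) * rkernel q x0) * (\<sigma> * \<nu> n x)"
      by (simp only: distrib_left mult_ac)
    then show ?thesis using True by (simp add: p_def t_def q_def mult_ac)
  qed (simp add: p_def t_def)
  \<comment> \<open>Below \<open>n0\<close> the factorization may fail, for instance at the points \<open>\<omega>(\<iota> n)\<close>; these finitely many errors are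
    collected in \<open>fin\<close>.\<close>
  define fin where "fin x = (\<Sum>n<n0. p n x - s x * t n - s x * (\<sigma> * (x - x0)) * (t n * \<nu> n x))" for x
  define h where "h x = fin x + s x * suminf t + s x * (\<sigma> * (x - x0)) * V x" for x
  have split: "(\<Sum>n<N. p n x) = fin x + s x * (\<Sum>n<N. t n) + s x * (\<sigma> * (x - x0)) * (\<Sum>n<N. t n * \<nu> n x)"
    if N: "n0 \<le> N" and x: "x \<in> {-L..L}" for N x
  proof -
    have "(\<Sum>n<N. p n x - s x * t n - s x * (\<sigma> * (x - x0)) * (t n * \<nu> n x)) = fin x"
      unfolding fin_def using N key[OF _ x] by (intro sum.mono_neutral_right) auto
    then have "(\<Sum>n<N. p n x) - (\<Sum>n<N. s x * t n) - (\<Sum>n<N. s x * (\<sigma> * (x - x0)) * (t n * \<nu> n x)) = fin x"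
      by (simp only: sum_subtractf)
    then show ?thesis unfolding sum_distrib_left by linarith
  qed
  have lim: "(\<lambda>N. \<Sum>n<N. p n x) \<longlonglongrightarrow> h x" if x: "x \<in> {-L..L}" for x
  proof -
    have "(\<lambda>N. fin x + s x * (\<Sum>n<N. t n) + s x * (\<sigma> * (x - x0)) * (\<Sum>n<N. t n * \<nu> n x)) \<longlonglongrightarrow> h x"
      unfolding h_def by (intro tendsto_intros Vlim[OF x] summable_LIMSEQ t)
    then show ?thesis
      by (rule Lim_transform_eventually) (use eventually_ge_at_top[of n0] in eventually_elim, use split x in auto)
  qed
  have rkernel_cont: "continuous_on {-L..L} (rkernel q)" for q
    unfolding rkernel_def[abs_def] using continuous_on_subset[OF phase_sinc_cont] deriv_\<phi>_pos[of q] by (intro continuous_intros) auto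
  have pc: "continuous_on {-L..L} (p n)" for n
    using rkernel_cont[of "\<omega> (\<iota> n)"] by (cases "n \<in> P") (auto simp: p_def[abs_def] intro!: continuous_intros)
  have sc: "continuous_on {-L..L} s"
  proof -
    have "continuous_on {-L..L} \<phi>" using smooth_cont[OF smooth_\<phi>, of 0] continuous_on_subset by auto
    then show ?thesis unfolding s_def[abs_def] using x0 by (intro continuous_intros) (auto simp: D_def)
  qed
  have "continuous_on {-L..L} h"
    unfolding h_def[abs_def] fin_def using Vc sc pc \<open>\<And>n. continuous_on {-L..L} (\<nu> n)\<close> by (intro continuous_intros) auto
  moreover have "(\<lambda>N. \<Sum>i\<in>I \<inter> \<iota> ` {..<N}. b i * rkernel (\<omega> i) x) = (\<lambda>N. \<Sum>n<N. p n x)" for x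
    unfolding reidx by (simp add: p_def P_def)
  ultimately show ?thesis using lim by (intro exI[of _ h]) auto
qed


lemma exists_off_level: "\<exists>x0. sin (\<phi> x0 - \<alpha>) \<noteq> 0"
proof (cases "sin (\<phi> 0 - \<alpha>) = 0")
  case True
  have "isCont \<phi> 0" using DERIV_\<phi> by (rule DERIV_isCont)
  then have "(\<phi> \<longlongrightarrow> \<phi> 0) (at_right 0)" unfolding isCont_def by (rule filterlim_mono) (auto intro: at_le)
  then have "eventually (\<lambda>t. \<phi> t < \<phi> 0 + pi) (at_right 0)" by (rule order_tendstoD) (simp add: pi_gt_zero)
  moreover have "eventually (\<lambda>t::real. t > 0) (at_right 0)" by (rule eventually_at_right_less)
  ultimately have "eventually (\<lambda>t. \<phi> t < \<phi> 0 + pi \<and> t > 0) (at_right 0)" by eventually_elim simp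
  then obtain t where t: "\<phi> t < \<phi> 0 + pi" "t > 0" using eventually_happens trivial_limit_at_right_real by blast
  have "\<phi> 0 < \<phi> t" using mono_\<phi> t(2) by (simp add: strict_mono_def)
  then have "sin (\<phi> t - \<phi> 0) > 0" using t by (intro sin_gt_zero) auto
  moreover have "cos (\<phi> 0 - \<alpha>) \<noteq> 0" using True sin_zero_norm_cos_one by fastforce
  moreover have "sin (\<phi> t - \<alpha>) = sin ((\<phi> t - \<phi> 0) + (\<phi> 0 - \<alpha>))" by simp
  then have "sin (\<phi> t - \<alpha>) = sin (\<phi> t - \<phi> 0) * cos (\<phi> 0 - \<alpha>)" unfolding sin_add True by simp
  ultimately show ?thesis by (intro exI[of _ t]) simp
qed blast

lemma expansion_limit:
  assumes kb: "kernel_orthonormal_basis E \<phi> I \<omega>"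
  shows "(\<lambda>N. \<Sum>n\<in>I \<inter> {- int N..int N}. rkernel (\<omega> n) x * rkernel (\<omega> n) y) \<longlonglongrightarrow> phase_sinc \<phi> x y / pi"
proof (rule LIMSEQ_I)
  fix r :: real assume r: "r > 0"
  obtain J where J: "finite J" "J \<subseteq> I" "\<And>J'. finite J' \<Longrightarrow> J \<subseteq> J' \<Longrightarrow> J' \<subseteq> I \<Longrightarrow>
    \<bar>(\<Sum>n\<in>J'. rkernel (\<omega> n) x * rkernel (\<omega> n) y) - phase_sinc \<phi> x y / pi\<bar> \<le> r / 2"
    using phase_sinc_expansion[OF kb half_gt_zero[OF r], of x y] by (elim exE conjE) simp
  obtain N0 where N0: "\<And>n. n \<in> J \<Longrightarrow> nat \<bar>n\<bar> \<le> N0"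
    using J(1) finite_nat_set_iff_bounded_le[of "(\<lambda>n. nat \<bar>n\<bar>) ` J"] by auto
  have "norm ((\<Sum>n\<in>I \<inter> {- int N..int N}. rkernel (\<omega> n) x * rkernel (\<omega> n) y) - phase_sinc \<phi> x y / pi) < r" if N: "N \<ge> N0" for N
  proof -
    have "n \<in> {- int N..int N}" if "n \<in> J" for n using N0[OF that] N by auto
    then have "\<bar>(\<Sum>n\<in>I \<inter> {- int N..int N}. rkernel (\<omega> n) x * rkernel (\<omega> n) y) - phase_sinc \<phi> x y / pi\<bar> \<le> r / 2"
      using J(2) by (intro J(3)) auto
    then show ?thesis using r by simp
  qed
  then show "\<exists>N0. \<forall>N\<ge>N0. norm ((\<Sum>n\<in>I \<inter> {- int N..int N}. rkernel (\<omega> n) x * rkernel (\<omega> n) y) - phase_sinc \<phi> x y / pi) < r" by blast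
qed

lemma AE_half_series:
  fixes a :: "int \<Rightarrow> 's \<Rightarrow> real"
  assumes M: "prob_space M" and a: "iid_std_normal M I a" and kb: "kernel_orthonormal_basis E \<phi> I \<omega>"
    and x0: "sin (\<phi> x0 - \<alpha>) \<noteq> 0"
  shows "AE s in M. convergent (\<lambda>N. \<Sum>i\<in>I \<inter> \<iota> ` {..<N::nat}. a i s * rkernel (\<omega> i) x0)"
proof (rule convergent_gaussian_series[OF M a])
  show "mono (\<lambda>N. I \<inter> \<iota> ` {..<N})" by (auto simp: mono_def)
  fix N
  let ?J = "I \<inter> \<iota> ` {..<N}"
  let ?B = "\<lambda>N. I \<inter> {- int N..int N}"
  have fin: "finite ?J" by simp
  obtain N0 where N0: "\<And>n. n \<in> ?J \<Longrightarrow> nat \<bar>n\<bar> \<le> N0"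
    using fin finite_nat_set_iff_bounded_le[of "(\<lambda>n. nat \<bar>n\<bar>) ` ?J"] by auto
  have "n \<in> {- int N0..int N0}" if "n \<in> ?J" for n using N0[OF that] by auto
  then have "(\<Sum>i\<in>?J. (rkernel (\<omega> i) x0)\<^sup>2) \<le> (\<Sum>i\<in>?B N0. (rkernel (\<omega> i) x0)\<^sup>2)" by (intro sum_mono2) auto
  also have "\<dots> \<le> phase_sinc \<phi> x0 x0 / pi"
  proof (rule incseq_le)
    show "incseq (\<lambda>N. \<Sum>i\<in>?B N. (rkernel (\<omega> i) x0)\<^sup>2)" by (auto simp: incseq_def intro!: sum_mono2)
    show "(\<lambda>N. \<Sum>i\<in>?B N. (rkernel (\<omega> i) x0)\<^sup>2) \<longlonglongrightarrow> phase_sinc \<phi> x0 x0 / pi"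
      using expansion_limit[OF kb, of x0 x0] by (simp add: power2_eq_square)
  qed
  finally show "(\<Sum>i\<in>?J. (rkernel (\<omega> i) x0)\<^sup>2) \<le> phase_sinc \<phi> x0 x0 / pi" .
qed auto

text \<open>
  The symmetric partial sums split into sums over the nonnegative and over the negative integers, of which each
  converges.
\<close>

lemma AE_series_continuous:
  fixes a :: "int \<Rightarrow> 's \<Rightarrow> real"
  assumes M: "prob_space M" and a: "iid_std_normal M I a" and kb: "kernel_orthonormal_basis E \<phi> I \<omega>"
  shows "AE s in M. (\<forall>x. convergent (\<lambda>N. \<Sum>n\<in>I \<inter> {- int N..int N}. a n s * rkernel (\<omega> n) x)) \<and>
    continuous_on UNIV (\<lambda>x. lim (\<lambda>N. \<Sum>n\<in>I \<inter> {- int N..int N}. a n s * rkernel (\<omega> n) x))"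
proof -
  obtain \<alpha> where I: "I = {n. \<exists>x. \<phi> x = \<alpha> + pi * of_int n}" and \<omega>: "\<And>n. n \<in> I \<Longrightarrow> \<phi> (\<omega> n) = \<alpha> + pi * of_int n"
    using kb unfolding kernel_orthonormal_basis_def by blast
  \<comment> \<open>A point of reference where no \<open>g\<^sub>n\<close> vanishes.\<close>
  obtain x0 where x0: "sin (\<phi> x0 - \<alpha>) \<noteq> 0" using exists_off_level by blast
  let ?p = "\<lambda>n::nat. int n" and ?m = "\<lambda>n::nat. - int n - 1"
  have "AE s in M. convergent (\<lambda>N. \<Sum>i\<in>I \<inter> ?p ` {..<N}. a i s * rkernel (\<omega> i) x0)"
    by (rule AE_half_series[OF M a kb x0])
  moreover have "AE s in M. convergent (\<lambda>N. \<Sum>i\<in>I \<inter> ?m ` {..<N}. a i s * rkernel (\<omega> i) x0)"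
    by (rule AE_half_series[OF M a kb x0])
  ultimately show ?thesis
  proof eventually_elim
    case (elim s)
    let ?S = "\<lambda>N x. \<Sum>n\<in>I \<inter> {- int N..int N}. a n s * rkernel (\<omega> n) x"
    have ex: "\<exists>h. continuous_on {-L..L} h \<and> (\<forall>x\<in>{-L..L}. (\<lambda>N. ?S N x) \<longlonglongrightarrow> h x)" for L
    proof -
      obtain h1 where h1: "continuous_on {-L..L} h1" "\<And>x. x \<in> {-L..L} \<Longrightarrow> (\<lambda>N. \<Sum>i\<in>I \<inter> ?p ` {..<N}. a i s * rkernel (\<omega> i) x) \<longlonglongrightarrow> h1 x"
        using half_series_continuous[OF I \<omega> x0, where sg = 1 and \<iota> = ?p and k = 0 and b = "\<lambda>i. a i s" and L = L] elim(1) by auto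
      obtain h2 where h2: "continuous_on {-L..L} h2" "\<And>x. x \<in> {-L..L} \<Longrightarrow> (\<lambda>N. \<Sum>i\<in>I \<inter> ?m ` {..<N}. a i s * rkernel (\<omega> i) x) \<longlonglongrightarrow> h2 x"
        using half_series_continuous[OF I \<omega> x0, where sg = "-1" and \<iota> = ?m and k = "-1" and b = "\<lambda>i. a i s" and L = L] elim(2) by auto
      have split: "?S N x = (\<Sum>i\<in>I \<inter> ?p ` {..<Suc N}. a i s * rkernel (\<omega> i) x) + (\<Sum>i\<in>I \<inter> ?m ` {..<N}. a i s * rkernel (\<omega> i) x)" for N x
      proof -
        have "I \<inter> {- int N..int N} = (I \<inter> ?p ` {..<Suc N}) \<union> (I \<inter> ?m ` {..<N})"
        proof -
          have "i \<in> ?p ` {..<Suc N} \<union> ?m ` {..<N}" if "i \<in> {- int N..int N}" for i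
          proof (cases "i \<ge> 0")
            case True then show ?thesis using that by (intro UnI1 image_eqI[of _ _ "nat i"]) auto
          next
            case False then show ?thesis using that by (intro UnI2 image_eqI[of _ _ "nat (- i - 1)"]) auto
          qed
          moreover have "?p ` {..<Suc N} \<union> ?m ` {..<N} \<subseteq> {- int N..int N}" by auto
          ultimately show ?thesis by blast
        qed
        moreover have "(I \<inter> ?p ` {..<Suc N}) \<inter> (I \<inter> ?m ` {..<N}) = {}" by auto
        ultimately show ?thesis by (simp add: sum.union_disjoint)
      qed
      have "(\<lambda>N. ?S N x) \<longlonglongrightarrow> h1 x + h2 x" if "x \<in> {-L..L}" for x
        unfolding split by (intro tendsto_add h2(2)[OF that] LIMSEQ_Suc[OF h1(2)[OF that]])
      then show ?thesis using h1(1) h2(1) by (intro exI[of _ "\<lambda>x. h1 x + h2 x"]) (auto intro: continuous_intros)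
    qed
    have conv: "convergent (\<lambda>N. ?S N x)" for x
    proof -
      obtain h where "\<forall>z\<in>{-\<bar>x\<bar>..\<bar>x\<bar>}. (\<lambda>N. ?S N z) \<longlonglongrightarrow> h z" using ex by blast
      moreover have "x \<in> {-\<bar>x\<bar>..\<bar>x\<bar>}" by auto
      ultimately have "(\<lambda>N. ?S N x) \<longlonglongrightarrow> h x" by blast
      then show ?thesis by (rule convergentI)
    qed
    have "continuous_on {-L..L} (\<lambda>x. lim (\<lambda>N. ?S N x))" for L
    proof -
      obtain h where h: "continuous_on {-L..L} h" "\<forall>x\<in>{-L..L}. (\<lambda>N. ?S N x) \<longlonglongrightarrow> h x" using ex by blast
      show ?thesis by (rule continuous_on_eq[OF h(1)]) (use h(2)[rule_format, THEN limI] in simp)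
    qed
    then have "isCont (\<lambda>x. lim (\<lambda>N. ?S N x)) x" for x
      by (rule continuous_on_interior[of "{-(\<bar>x\<bar> + 1)..\<bar>x\<bar> + 1}"]) (auto simp: interior_atLeastAtMost_real)
    then show ?case using conv by (simp add: continuous_on_eq_continuous_at)
  qed
qed

end

section \<open>The first intensity\<close>

theorem theorem1p5:
  fixes E :: "complex \<Rightarrow> complex" and \<phi> :: "real \<Rightarrow> real"
    and I :: "int set" and \<omega> :: "int \<Rightarrow> real"
    and M :: "'s measure" and a :: "int \<Rightarrow> 's \<Rightarrow> real" and \<rho> :: "real \<Rightarrow> real"
  assumes "hermite_biehler E"
    and "\<And>x::real. E (of_real x) \<noteq> 0"
    and "phase_function E \<phi>"
    and "kernel_orthonormal_basis E \<phi> I \<omega>"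
    and "prob_space M"
    and "iid_std_normal M I a"
  shows "first_intensity M (de_branges_GAF E I \<omega> a) \<rho> \<longleftrightarrow>
    (\<forall>x. \<rho> x = 1 / pi * sqrt ((deriv \<phi> x)\<^sup>2 / 3 + schwarzian \<phi> x / 6))"
proof -
  interpret D: de_branges E \<phi> by unfold_locales (use assms in auto)
  note kb = assms(4) and M = assms(5) and iid = assms(6)
  define A where "A N = I \<inter> {- int N..int N}" for N
  define g where "g n = D.rkernel (\<omega> n)" for n
  have pos: "deriv \<phi> x > 0" for x by (rule D.deriv_\<phi>_pos)
  have cov: "(\<lambda>N. \<Sum>n\<in>A N. g n x * g n y) \<longlonglongrightarrow> phase_sinc \<phi> x y / pi" for x y
    unfolding A_def g_def by (rule D.expansion_limit[OF kb])
  have diag: "phase_sinc \<phi> x x / pi > 0" for x using pos by (simp add: phase_sinc_def)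
  interpret G: gaussian_series M I a A g
  proof -
    interpret prob_space M by fact
    show "gaussian_series M I a A g"
    proof
      show "iid_std_normal M I a" by fact
      show "mono A" by (auto simp: A_def mono_def)
      show "finite (A k)" for k by (simp add: A_def)
      have "n \<in> {- int (nat \<bar>n\<bar>)..int (nat \<bar>n\<bar>)}" for n by auto
      then show "(\<Union>k. A k) = I" unfolding A_def by blast
      show "continuous_on UNIV (g n)" for n
        unfolding g_def D.rkernel_def[abs_def] using D.phase_sinc_cont pos[of "\<omega> n"] by (intro continuous_intros) auto
      show "\<exists>n\<in>I. g n x \<noteq> 0" for x
      proof (rule ccontr)
        assume "\<not> ?thesis"
        then have "(\<Sum>n\<in>A N. g n x * g n x) = 0" for N by (auto simp: A_def intro!: sum.neutral)
        then have "phase_sinc \<phi> x x / pi = 0" using cov[of x x] by (simp add: LIMSEQ_const_iff)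
        then show False using diag[of x] by simp
      qed
      show "AE s in M. (\<forall>x. convergent (\<lambda>N. \<Sum>n\<in>A N. a n s * g n x)) \<and>
          continuous_on UNIV (\<lambda>x. lim (\<lambda>N. \<Sum>n\<in>A N. a n s * g n x))"
        unfolding A_def g_def by (rule D.AE_series_continuous[OF M iid kb])
    qed
  qed
  have corr: "phase_sinc \<phi> x y / pi / sqrt (phase_sinc \<phi> x x / pi * (phase_sinc \<phi> y y / pi)) = phase_corr \<phi> x y" for x y
  proof -
    have "sqrt (phase_sinc \<phi> x x / pi * (phase_sinc \<phi> y y / pi)) = sqrt (deriv \<phi> x * deriv \<phi> y) / pi"
      by (simp add: phase_sinc_def real_sqrt_divide real_sqrt_mult)
    then show ?thesis by (simp add: phase_corr_def)
  qed
  have bound: "(phase_corr \<phi> x y)\<^sup>2 \<le> 1" for x y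
    using G.correlation_bounded[OF cov diag, of x y] unfolding corr by (simp add: abs_square_le_1)
  let ?\<rho> = "\<lambda>x. 1 / pi * angular_speed \<phi> x"
  have \<rho>c: "continuous_on UNIV ?\<rho>"
    using continuous_angular_speed[OF D.smooth_\<phi> pos] by (intro continuous_intros)
  have \<rho>0: "0 \<le> ?\<rho> x" for x
    using angular_speed_nonneg[OF D.smooth_\<phi> D.mono_\<phi> pos bound] by simp
  have count: "(\<integral>\<^sup>+s. emeasure (count_space UNIV) ({x. G.F s x = 0} \<inter> B) \<partial>M) = (\<integral>\<^sup>+x\<in>B. ennreal (?\<rho> x) \<partial>lborel)"
    if "B \<in> sets borel" for B
  proof (rule expected_count_eq_density[OF \<rho>c _ that])
    fix u v :: real assume uv: "u < v"
    show "\<exists>f\<in>borel_measurable M. (AE s in M. f s = emeasure (count_space UNIV) ({x. G.F s x = 0} \<inter> {u<..<v})) \<and>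
        (\<integral>\<^sup>+s. f s \<partial>M) = (\<integral>\<^sup>+x\<in>{u<..<v}. ennreal (?\<rho> x) \<partial>lborel)"
      by (rule G.expected_zeros_interval[OF cov diag uv])
         (unfold corr, rule sum_arccos_tendsto[OF D.smooth_\<phi> D.mono_\<phi> pos bound uv])
  qed
  have zeros: "AE s in M. real_zeros (de_branges_GAF E I \<omega> a s) = {x. G.F s x = 0}"
    using G.continuous_sum
  proof eventually_elim
    case (elim s)
    have "de_branges_GAF E I \<omega> a s (of_real x) = of_real (cmod (E (of_real x)) * G.F s x)" for x
    proof -
      have "(\<lambda>N. \<Sum>n\<in>A N. a n s * g n x) \<longlonglongrightarrow> G.F s x"
        unfolding G.F_def using elim by (simp add: convergent_LIMSEQ_iff)
      then have "(\<lambda>N. complex_of_real (cmod (E (of_real x)) * (\<Sum>n\<in>A N. a n s * g n x))) \<longlonglongrightarrow> of_real (cmod (E (of_real x)) * G.F s x)"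
        by (intro tendsto_of_real tendsto_mult tendsto_const)
      moreover have "complex_of_real (cmod (E (of_real x)) * (\<Sum>n\<in>A N. a n s * g n x))
          = (\<Sum>n\<in>I \<inter> {- int N..int N}. of_real (a n s) * normalized_kernel E (\<omega> n) (of_real x))" for N
        by (simp add: D.normalized_kernel_real A_def g_def sum_distrib_left mult_ac)
      ultimately show ?thesis unfolding de_branges_GAF_def by (simp add: limI)
    qed
    then show ?case using assms(2) by (simp add: real_zeros_def)
  qed
  have intensity: "first_intensity M (de_branges_GAF E I \<omega> a) ?\<rho>"
    unfolding first_intensity_def
  proof (intro conjI ballI allI \<rho>c \<rho>0)
    fix B :: "real set" assume B: "B \<in> sets borel"
    have "(\<integral>\<^sup>+s. emeasure (count_space UNIV) (real_zeros (de_branges_GAF E I \<omega> a s) \<inter> B) \<partial>M)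
        = (\<integral>\<^sup>+s. emeasure (count_space UNIV) ({x. G.F s x = 0} \<inter> B) \<partial>M)"
      by (rule nn_integral_cong_AE) (use zeros in \<open>eventually_elim, simp\<close>)
    then show "(\<integral>\<^sup>+s. emeasure (count_space UNIV) (real_zeros (de_branges_GAF E I \<omega> a s) \<inter> B) \<partial>M)
        = (\<integral>\<^sup>+x\<in>B. ennreal (?\<rho> x) \<partial>lborel)" using count[OF B] by simp
  qed
  have "first_intensity M (de_branges_GAF E I \<omega> a) \<rho> \<longleftrightarrow> \<rho> = ?\<rho>"
  proof
    assume r: "first_intensity M (de_branges_GAF E I \<omega> a) \<rho>"
    show "\<rho> = ?\<rho>"
      by (rule continuous_density_unique) (use r intensity in \<open>auto simp: first_intensity_def\<close>)
  qed (use intensity in simp)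
  then show ?thesis by (simp add: fun_eq_iff angular_speed_def)
qed

end
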